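(* Let $K$ be a CM-field of degree $2N$ over $\mathbb{Q}$, and let $\Lambda$ be a system of representatives for the conjugacy classes of the CM-types of $K$. Let $J_{\mathrm{odd}}$ be a system of representatives for the orbits of $G$ on the subsets $I\subset G/H_0$ of odd cardinality. Then, as characters of $G=\mathrm{Gal}(K^c/\mathbb{Q})$, $$\sum_{(K,\Phi)\in\Lambda}\mathrm{Ind}^{G}_{H_0^*(\Phi)}\big(\chi_{H_0^*(\Phi)/H^*(\Phi)}\big)=\sum_{I\in J_{\mathrm{odd}}}\mathrm{Ind}^{G}_{\tilde H_0(I)}(\tilde\chi_I),$$ where $\tilde H_0(I)=\{\sigma\in G:\sigma I=I\}$ and $\tilde\chi_I(\sigma)=(-1)^{\sum_{\varphi H_0\in I}r_{\Phi_0}(\sigma)(\varphi H_0)}$ for $\sigma\in\tilde H_0(I)$.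
   Context: $K_0$ is the maximal totally real subfield of $K$; $K^c$ is the Galois closure of $K$ over $\mathbb{Q}$ (inside $\mathbb{C}$); $G=\mathrm{Gal}(K^c/\mathbb{Q})$, $H=\mathrm{Gal}(K^c/K)$, $H_0=\mathrm{Gal}(K^c/K_0)$; $\iota\in G$ is complex conjugation (central). $G$ acts on $G/H_0$ (which has $N$ elements) by left multiplication, hence on its subsets. A CM-type $(K,\Phi)$ is a set $\Phi$ of embeddings $K\hookrightarrow\mathbb{C}$ with $\Phi\cap\iota\Phi=\emptyset$ and $\Phi\cup\iota\Phi$ equal to the set of all embeddings; embeddings of $K$ are identified with cosets in $G/H$, and $\Phi=\{\varphi_1,\dots,\varphi_N\}$ is in bijection with $G/H_0=\{\varphi_1H_0,\dots,\varphi_NH_0\}$. Two CM-types $\Phi,\Phi'$ are conjugate if $\Phi'=\tau\Phi$ for some $\tau\in G$. With $S_\Phi=\bigcup_{\varphi\in\Phi}\varphi H$, put $H^*(\Phi)=\{\sigma\in G:\sigma S_\Phi=S_\Phi\}$; its fixed field $K^*(\Phi)$ is the reflex field (a CM-field), $K_0^*(\Phi)$ is its maximal totally real subfield, and $H_0^*(\Phi)=\mathrm{Gal}(K^c/K_0^*(\Phi))=H^*(\Phi)\cup\iota H^*(\Phi)$. For a group $B$ and a normal subgroup $A$ of index $2$, $\chi_{B/A}$ denotes the nontrivial character of $B$ obtained from $B\twoheadrightarrow B/A\cong\{\pm1\}$. Fix a CM-type $\Phi_0=\{\varphi_1,\dots,\varphi_N\}$ of $K$. For $\tau\in G$, $r_{\Phi_0}(\tau):G/H_0\to\mathbb{Z}/2$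 is defined by $r_{\Phi_0}(\tau)(\varphi_iH_0)=0$ if $\tau^{-1}\varphi_i\in\Phi_0$, and $=1$ otherwise. For $|I|$ odd, $\tilde\chi_I$ is a character of $\tilde H_0(I)$, which is independent of the choice of $\Phi_0$; its kernel is $H(I)=\{\sigma\in G:\sigma I=I,\ \sum_{\varphi H_0\in I}r_{\Phi_0}(\sigma)(\varphi H_0)=0\}$, of index $2$ in $\tilde H_0(I)$, and the fixed fields $K(I)$ of $H(I)$ and $K_0(I)$ of $\tilde H_0(I)$ are respectively a CM-field and its maximal totally real subfield. *)

theory Defs
  imports
    "HOL-Algebra.Algebraic_Closure_Type"
    "HOL-Algebra.Embedded_Algebras"
    "HOL-Algebra.Group_Action"
    "HOL-Algebra.Left_Coset"
    "HOL-Algebra.Bij"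
    "HOL-Computational_Algebra.Polynomial"
    "HOL-Computational_Algebra.Factorial_Ring"
begin

abbreviation CC :: "complex ring" where
  "CC \<equiv> ring_of_type_algebra"

definition number_field :: "complex set \<Rightarrow> bool" where
  "number_field K \<longleftrightarrow> subfield K CC \<and> ring.finite_dimension CC \<rat> K"

text \<open>Embeddings are taken to be extensional (undefined outside the field), so that
  equality of embeddings is equality of functions.\<close>

definition embeddings :: "complex set \<Rightarrow> (complex \<Rightarrow> complex) set" where
  "embeddings K = ring_hom (CC\<lparr>carrier := K\<rparr>) CC \<inter> extensional K"

definition totally_real :: "complex set \<Rightarrow> bool" where
  "totally_real F \<longleftrightarrow> number_field F \<and> (\<forall>\<phi>\<in>embeddings F. \<phi> ` F \<subseteq> \<real>)"

definition totally_imaginary :: "complex set \<Rightarrow> bool" where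
  "totally_imaginary K \<longleftrightarrow> number_field K \<and> (\<forall>\<phi>\<in>embeddings K. \<not> \<phi> ` K \<subseteq> \<real>)"

definition CM_field :: "complex set \<Rightarrow> bool" where
  "CM_field K \<longleftrightarrow> totally_imaginary K \<and>
     (\<exists>F. totally_real F \<and> F \<subseteq> K \<and> ring.dimension CC 2 F K)"

definition max_totally_real :: "complex set \<Rightarrow> complex set" where
  "max_totally_real K = (GREATEST F. F \<subseteq> K \<and> totally_real F)"

text \<open>Separability is automatic in characteristic zero, so a number field is Galois over
  the rationals as soon as it is normal.\<close>

definition Galois_over_rat :: "complex set \<Rightarrow> bool" where
  "Galois_over_rat L \<longleftrightarrow> number_field L \<and>
     (\<forall>p :: rat poly. Factorial_Ring.irreducible p \<longrightarrow>
        (\<exists>x\<in>L. poly (map_poly of_rat p) x = 0) \<longrightarrow>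
        {x. poly (map_poly of_rat p) x = 0} \<subseteq> L)"

definition galois_closure :: "complex set \<Rightarrow> complex set" where
  "galois_closure K = \<Inter>{L. K \<subseteq> L \<and> Galois_over_rat L}"

definition gal :: "complex set \<Rightarrow> complex set \<Rightarrow> (complex \<Rightarrow> complex) set" where
  "gal L F = {\<sigma> \<in> ring_iso (CC\<lparr>carrier := L\<rparr>) (CC\<lparr>carrier := L\<rparr>) \<inter> extensional L.
     \<forall>x\<in>F. \<sigma> x = x}"

definition gal_group :: "complex set \<Rightarrow> (complex \<Rightarrow> complex) monoid" where
  "gal_group L = (BijGroup L)\<lparr>carrier := gal L \<rat>\<rparr>"

definition fixed_field :: "complex set \<Rightarrow> (complex \<Rightarrow> complex) set \<Rightarrow> complex set" where
  "fixed_field L A = {x \<in> L. \<forall>\<sigma>\<in>A. \<sigma> x = x}"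

definition GG :: "complex set \<Rightarrow> (complex \<Rightarrow> complex) monoid" where
  "GG K = gal_group (galois_closure K)"

definition H0 :: "complex set \<Rightarrow> (complex \<Rightarrow> complex) set" where
  "H0 K = gal (galois_closure K) (max_totally_real K)"

definition conj_elt :: "complex set \<Rightarrow> complex \<Rightarrow> complex" where
  "conj_elt K = restrict cnj (galois_closure K)"

text \<open>The coset of \<open>gal (galois_closure K) K\<close> in \<open>GG K\<close> that is identified with the
  embedding \<open>\<phi>\<close> consists of all extensions of \<open>\<phi>\<close> to the Galois closure.\<close>

definition emb_coset ::
    "complex set \<Rightarrow> (complex \<Rightarrow> complex) \<Rightarrow> (complex \<Rightarrow> complex) set" where
  "emb_coset K \<phi> = {\<sigma> \<in> carrier (GG K). restrict \<sigma> K = \<phi>}"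

definition act_type ::
    "complex set \<Rightarrow> (complex \<Rightarrow> complex) \<Rightarrow> (complex \<Rightarrow> complex) set \<Rightarrow> (complex \<Rightarrow> complex) set"
  where "act_type K \<tau> \<Phi> = (\<lambda>\<phi>. compose K \<tau> \<phi>) ` \<Phi>"

definition CM_types :: "complex set \<Rightarrow> (complex \<Rightarrow> complex) set set" where
  "CM_types K = {\<Phi>. \<Phi> \<inter> act_type K (conj_elt K) \<Phi> = {} \<and>
     \<Phi> \<union> act_type K (conj_elt K) \<Phi> = embeddings K}"

definition S_type :: "complex set \<Rightarrow> (complex \<Rightarrow> complex) set \<Rightarrow> (complex \<Rightarrow> complex) set" where
  "S_type K \<Phi> = (\<Union>\<phi>\<in>\<Phi>. emb_coset K \<phi>)"

definition Hstar :: "complex set \<Rightarrow> (complex \<Rightarrow> complex) set \<Rightarrow> (complex \<Rightarrow> complex) set" where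
  "Hstar K \<Phi> = {\<sigma> \<in> carrier (GG K). \<sigma> <#\<^bsub>GG K\<^esub> S_type K \<Phi> = S_type K \<Phi>}"

definition reflex_field :: "complex set \<Rightarrow> (complex \<Rightarrow> complex) set \<Rightarrow> complex set" where
  "reflex_field K \<Phi> = fixed_field (galois_closure K) (Hstar K \<Phi>)"

definition H0star :: "complex set \<Rightarrow> (complex \<Rightarrow> complex) set \<Rightarrow> (complex \<Rightarrow> complex) set" where
  "H0star K \<Phi> = gal (galois_closure K) (max_totally_real (reflex_field K \<Phi>))"

definition act_subset ::
    "complex set \<Rightarrow> (complex \<Rightarrow> complex) \<Rightarrow> (complex \<Rightarrow> complex) set set
      \<Rightarrow> (complex \<Rightarrow> complex) set set" where
  "act_subset K \<tau> I = (\<lambda>c. \<tau> <#\<^bsub>GG K\<^esub> c) ` I"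

definition odd_subsets :: "complex set \<Rightarrow> (complex \<Rightarrow> complex) set set set" where
  "odd_subsets K = {I. I \<subseteq> lcosets\<^bsub>GG K\<^esub> (H0 K) \<and> odd (card I)}"

definition H0tilde ::
    "complex set \<Rightarrow> (complex \<Rightarrow> complex) set set \<Rightarrow> (complex \<Rightarrow> complex) set" where
  "H0tilde K I = {\<sigma> \<in> carrier (GG K). act_subset K \<sigma> I = I}"

text \<open>The value in \<open>\<int>/2\<close> is represented by its representative 0 or 1 in the natural
  numbers; only the parity of sums of such values is used. For a CM-type \<open>\<Phi>\<^sub>0\<close> each coset
  in \<open>G/H\<^sub>0\<close> is \<open>\<phi>H\<^sub>0\<close> for exactly one \<open>\<phi> \<in> \<Phi>\<^sub>0\<close>.\<close>

definition r_fun ::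
    "complex set \<Rightarrow> (complex \<Rightarrow> complex) set \<Rightarrow> (complex \<Rightarrow> complex)
      \<Rightarrow> (complex \<Rightarrow> complex) set \<Rightarrow> nat" where
  "r_fun K \<Phi>\<^sub>0 \<tau> c =
     (let \<phi> = (THE \<phi>. \<phi> \<in> \<Phi>\<^sub>0 \<and> emb_coset K \<phi> <#>\<^bsub>GG K\<^esub> H0 K = c)
      in if compose K (inv\<^bsub>GG K\<^esub> \<tau>) \<phi> \<in> \<Phi>\<^sub>0 then 0 else 1)"

definition chi_tilde ::
    "complex set \<Rightarrow> (complex \<Rightarrow> complex) set \<Rightarrow> (complex \<Rightarrow> complex) set set
      \<Rightarrow> (complex \<Rightarrow> complex) \<Rightarrow> complex" where
  "chi_tilde K \<Phi>\<^sub>0 I \<sigma> = (-1) ^ (\<Sum>c\<in>I. r_fun K \<Phi>\<^sub>0 \<sigma> c)"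

text \<open>The nontrivial character of a group \<open>B\<close> with kernel the subgroup \<open>A\<close> of index 2;
  only its values on \<open>B\<close> are meaningful.\<close>

definition index2_char :: "'g set \<Rightarrow> 'g \<Rightarrow> complex" where
  "index2_char A b = (if b \<in> A then 1 else -1)"

text \<open>The usual formula for induced class functions on a finite group, summing over all
  elements of \<open>G\<close> rather than over representatives of \<open>G/B\<close>, hence the division by \<open>|B|\<close>.\<close>

definition Ind :: "('g, 'm) monoid_scheme \<Rightarrow> 'g set \<Rightarrow> ('g \<Rightarrow> complex) \<Rightarrow> 'g \<Rightarrow> complex" where
  "Ind G B \<chi> g =
     (\<Sum>x | x \<in> carrier G \<and> inv\<^bsub>G\<^esub> x \<otimes>\<^bsub>G\<^esub> g \<otimes>\<^bsub>G\<^esub> x \<in> B.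
        \<chi> (inv\<^bsub>G\<^esub> x \<otimes>\<^bsub>G\<^esub> g \<otimes>\<^bsub>G\<^esub> x)) / of_nat (card B)"

definition system_of_reps :: "'a set \<Rightarrow> 'a set set \<Rightarrow> bool" where
  "system_of_reps R P \<longleftrightarrow> R \<subseteq> \<Union>P \<and> (\<forall>Y\<in>P. \<exists>!x. x \<in> R \<inter> Y)"

end

theory Submission
  imports Defs
begin

text \<open>
Fix \<open>g\<close> in \<open>G\<close>. Each side of the identity is a signed count of objects that \<open>g\<close> fixes, and a
Fourier transform over \<open>\<int>/2\<close> turns one count into the other.

If a finite group acts on a finite set, the sum over orbit representatives of the characters induced
from the stabilisers is a sum over all the points of the set that \<open>g\<close> fixes
(\<open>sum_induced_over_orbit_representatives\<close>). On the left, \<open>H\<^sup>*(\<Phi>)\<close> is the stabiliser of \<open>\<Phi>\<close>, it has index 2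
in \<open>H\<^sub>0\<^sup>*(\<Phi>) = H\<^sup>*(\<Phi>) \<union> \<iota> H\<^sup>*(\<Phi>)\<close>, and the quadratic character is the difference of the indicators of these two
cosets; so the left-hand side is half of the number of CM-types with \<open>g\<Phi> = \<Phi>\<close> minus half of the number of
those with \<open>g\<Phi> = \<iota>\<Phi>\<close>. On the right, the values \<open>(-1) ^ r g c\<close> satisfy a cocycle identity, hence the sign
attached to \<open>I\<close> is compatible with conjugation, and the right-hand side is the sum of
\<open>(-1) ^ (\<Sum>c\<in>I. r g c)\<close> over the odd sets \<open>I\<close> with \<open>gI = I\<close>.

The base point \<open>\<Phi>\<^sub>0\<close> identifies CM-types with subsets of \<open>Y = G/H\<^sub>0\<close>, that is, with vectors \<open>f\<close> in \<open>(\<int>/2)\<^sup>Y\<close>.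
There \<open>g\<close> acts by the affine map \<open>f \<mapsto> gf + r(g)\<close> and \<open>\<iota>\<close> by adding the constant vector 1. The number of fixed
points is the trace of this permutation on the functions on \<open>(\<int>/2)\<^sup>Y\<close>. The characters of \<open>(\<int>/2)\<^sup>Y\<close> are
another basis of these functions. They are indexed by the subsets \<open>I\<close> of \<open>Y\<close>, and the permutation sends the
character of \<open>I\<close> to a sign times the character of \<open>gI\<close>. Computing the trace in this basis gives the sum of
\<open>(-1) ^ (\<Sum>c\<in>I. r g c)\<close> over all \<open>I\<close> with \<open>gI = I\<close> (\<open>card_twisted_invariant_subsets\<close>). Composing with \<open>\<iota>\<close>
replaces \<open>r\<close> by \<open>r + 1\<close>, which multiplies the term of \<open>I\<close> by \<open>(-1) ^ card I\<close>. In half of the difference the even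
sets cancel and each odd set is counted once (\<open>fixed_minus_antifixed\<close>).

It remains to see that the arithmetic objects have this shape. Embeddings of a number field extend to
larger number fields (\<open>hom_on_extends_to_number_field\<close>), so \<open>G\<close> acts transitively on the embeddings of \<open>K\<close>.
Complex conjugation commutes with \<open>G\<close> (\<open>gal_cnj\<close>), therefore the maximal totally real subfield of
a subfield \<open>M\<close> of \<open>K\<^sup>c\<close> is \<open>M \<inter> \<real>\<close> (\<open>max_totally_real_eq\<close>), and two embeddings of \<open>K\<close> lie over the same coset of \<open>H\<^sub>0\<close>
exactly if they are equal or conjugate (\<open>emb_coset_mult_H0_eq_iff\<close>). Finally, the Galois
correspondence (\<open>gal_fixed_field\<close>) identifies \<open>H\<^sub>0\<^sup>*(\<Phi>)\<close>, which is defined through fields, with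
\<open>H\<^sup>*(\<Phi>) \<union> \<iota> H\<^sup>*(\<Phi>)\<close> (\<open>H0star_eq\<close>).
\<close>

section \<open>Subfields of the complex numbers and their homomorphisms\<close>

interpretation CC: domain CC
  by (rule field.axioms(1)[OF field_from_type_algebra])

lemma CC_simps [simp]:
  "carrier CC = UNIV" "x \<otimes>\<^bsub>CC\<^esub> y = x * y" "x \<oplus>\<^bsub>CC\<^esub> y = x + y" "\<one>\<^bsub>CC\<^esub> = 1" "\<zero>\<^bsub>CC\<^esub> = 0"
  by (auto simp: ring_of_type_algebra_def)

lemma CC_a_inv [simp]: "\<ominus>\<^bsub>CC\<^esub> x = - x"
  using CC.minus_equality[of "- x" x] by simp

lemma CC_m_inv: "x \<noteq> 0 \<Longrightarrow> inv\<^bsub>CC\<^esub> x = inverse x"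
  by (rule CC.comm_inv_char) simp_all

lemma CC_nat_pow [simp]: "x [^]\<^bsub>CC\<^esub> (n::nat) = x ^ n"
  by (induction n) simp_all

lemma subring_CC_closed:
  assumes "subring F CC"
  shows "0 \<in> F" "1 \<in> F" "x \<in> F \<Longrightarrow> y \<in> F \<Longrightarrow> x + y \<in> F" "x \<in> F \<Longrightarrow> y \<in> F \<Longrightarrow> x * y \<in> F"
    "x \<in> F \<Longrightarrow> - x \<in> F" "x \<in> F \<Longrightarrow> y \<in> F \<Longrightarrow> x - y \<in> F"
proof -
  show "0 \<in> F" "1 \<in> F" "x \<in> F \<Longrightarrow> y \<in> F \<Longrightarrow> x + y \<in> F" "x \<in> F \<Longrightarrow> y \<in> F \<Longrightarrow> x * y \<in> F"
    "x \<in> F \<Longrightarrow> - x \<in> F"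
    using subringE[OF assms] by auto
  show "x \<in> F \<Longrightarrow> y \<in> F \<Longrightarrow> x - y \<in> F"
    using subringE(5)[OF assms, of y] subringE(7)[OF assms, of x "- y"] by simp
qed

lemma subfield_CC_closed:
  assumes "subfield F CC"
  shows "0 \<in> F" "1 \<in> F" "x \<in> F \<Longrightarrow> y \<in> F \<Longrightarrow> x + y \<in> F" "x \<in> F \<Longrightarrow> y \<in> F \<Longrightarrow> x * y \<in> F"
    "x \<in> F \<Longrightarrow> - x \<in> F" "x \<in> F \<Longrightarrow> y \<in> F \<Longrightarrow> x - y \<in> F" "x \<in> F \<Longrightarrow> inverse x \<in> F"
    "x \<in> F \<Longrightarrow> y \<in> F \<Longrightarrow> x / y \<in> F"
proof -
  note subring_CC_closed[OF subfieldE(1)[OF assms]]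
  moreover have *: "inverse x \<in> F" if "x \<in> F" for x
    using CC.subfield_m_inv(1)[OF assms, of x] that CC_m_inv[of x] calculation
    by (cases "x = 0") auto
  ultimately show "0 \<in> F" "1 \<in> F" "x \<in> F \<Longrightarrow> y \<in> F \<Longrightarrow> x + y \<in> F" "x \<in> F \<Longrightarrow> y \<in> F \<Longrightarrow> x * y \<in> F"
    "x \<in> F \<Longrightarrow> - x \<in> F" "x \<in> F \<Longrightarrow> y \<in> F \<Longrightarrow> x - y \<in> F" "x \<in> F \<Longrightarrow> inverse x \<in> F"
    "x \<in> F \<Longrightarrow> y \<in> F \<Longrightarrow> x / y \<in> F"
    by (auto simp: divide_inverse)
qed

lemma subfield_CC_I:
  assumes "1 \<in> F" "\<And>x y. x \<in> F \<Longrightarrow> y \<in> F \<Longrightarrow> x + y \<in> F" "\<And>x y. x \<in> F \<Longrightarrow> y \<in> F \<Longrightarrow> x * y \<in> F"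
    "\<And>x. x \<in> F \<Longrightarrow> - x \<in> F" "\<And>x. x \<in> F \<Longrightarrow> inverse x \<in> F"
  shows "subfield F CC"
proof (rule field.subfieldI'[OF field_from_type_algebra])
  show "subring F CC"
    by (rule CC.subringI) (use assms in auto)
  show "inv\<^bsub>CC\<^esub> k \<in> F" if "k \<in> F - {\<zero>\<^bsub>CC\<^esub>}" for k
    using that assms(5)[of k] by (simp add: CC_m_inv)
qed

lemma of_int_mem_subfield: "subfield F CC \<Longrightarrow> of_int n \<in> F"
proof (induction n rule: int_induct[of _ 0])
qed (auto dest: subfield_CC_closed)

lemma Rats_subset_subfield:
  assumes "subfield F CC" shows "\<rat> \<subseteq> F"
proof
  fix x :: complex assume "x \<in> \<rat>"
  then obtain q where "x = of_rat q" by (auto elim: Rats_cases)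
  moreover obtain a b where "q = Rat.Fract a b" "b > 0" by (cases q)
  ultimately show "x \<in> F"
    using subfield_CC_closed(8)[OF assms of_int_mem_subfield[OF assms] of_int_mem_subfield[OF assms]]
    by (simp add: Fract_of_int_quotient of_rat_divide)
qed

lemma subfield_Rats: "subfield \<rat> CC"
  by (rule subfield_CC_I) auto

lemma subfield_Reals_Int: "subfield F CC \<Longrightarrow> subfield (F \<inter> \<real>) CC"
  by (rule subfield_CC_I) (auto dest: subfield_CC_closed)

text \<open>Only the restriction to \<open>F\<close> matters, so that one function can be regarded as a homomorphism on
every subfield of its domain; extensionality is imposed separately where embeddings are compared.\<close>

definition hom_on :: "complex set \<Rightarrow> (complex \<Rightarrow> complex) \<Rightarrow> bool" where
  "hom_on F \<phi> \<longleftrightarrow> \<phi> 1 = 1 \<and>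
     (\<forall>x\<in>F. \<forall>y\<in>F. \<phi> (x + y) = \<phi> x + \<phi> y \<and> \<phi> (x * y) = \<phi> x * \<phi> y)"

lemma ring_hom_CC_iff:
  "\<phi> \<in> ring_hom (CC\<lparr>carrier := F\<rparr>) (CC\<lparr>carrier := E\<rparr>) \<longleftrightarrow> hom_on F \<phi> \<and> \<phi> ` F \<subseteq> E"
  by (auto simp: ring_hom_def hom_on_def)

lemma embeddings_eq: "embeddings F = {\<phi>. hom_on F \<phi> \<and> \<phi> \<in> extensional F}"
  by (auto simp: embeddings_def ring_hom_def hom_on_def)

lemma hom_on_add: "hom_on F \<phi> \<Longrightarrow> x \<in> F \<Longrightarrow> y \<in> F \<Longrightarrow> \<phi> (x + y) = \<phi> x + \<phi> y"
  and hom_on_mult: "hom_on F \<phi> \<Longrightarrow> x \<in> F \<Longrightarrow> y \<in> F \<Longrightarrow> \<phi> (x * y) = \<phi> x * \<phi> y"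
  and hom_on_one: "hom_on F \<phi> \<Longrightarrow> \<phi> 1 = 1"
  by (auto simp: hom_on_def)

lemma hom_on_subset: "hom_on F \<phi> \<Longrightarrow> E \<subseteq> F \<Longrightarrow> hom_on E \<phi>"
  by (auto simp: hom_on_def)

lemma hom_on_cong: "hom_on F \<phi> \<Longrightarrow> 1 \<in> F \<Longrightarrow> (\<And>x y. x \<in> F \<Longrightarrow> y \<in> F \<Longrightarrow> x + y \<in> F \<and> x * y \<in> F) \<Longrightarrow>
  (\<And>x. x \<in> F \<Longrightarrow> \<psi> x = \<phi> x) \<Longrightarrow> hom_on F \<psi>"
  by (auto simp: hom_on_def)

lemma hom_on_restrict: "subfield F CC \<Longrightarrow> hom_on F \<phi> \<Longrightarrow> hom_on F (restrict \<phi> F)"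
  by (rule hom_on_cong) (auto dest: subfield_CC_closed)

lemma hom_on_comp: "hom_on F \<phi> \<Longrightarrow> hom_on E \<psi> \<Longrightarrow> \<phi> ` F \<subseteq> E \<Longrightarrow> hom_on F (\<lambda>x. \<psi> (\<phi> x))"
  by (auto simp: hom_on_def image_subset_iff)

lemma hom_on_cnj: "hom_on F cnj"
  by (auto simp: hom_on_def)

lemma hom_on_zero: "subfield F CC \<Longrightarrow> hom_on F \<phi> \<Longrightarrow> \<phi> 0 = 0"
  using hom_on_add[of F \<phi> 0 0] by (simp add: subfield_CC_closed)

lemma hom_on_minus: "subfield F CC \<Longrightarrow> hom_on F \<phi> \<Longrightarrow> x \<in> F \<Longrightarrow> \<phi> (- x) = - \<phi> x"
  using hom_on_add[of F \<phi> x "- x"] by (simp add: subfield_CC_closed hom_on_zero eq_neg_iff_add_eq_0 add.commute)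

lemma hom_on_diff: "subfield F CC \<Longrightarrow> hom_on F \<phi> \<Longrightarrow> x \<in> F \<Longrightarrow> y \<in> F \<Longrightarrow> \<phi> (x - y) = \<phi> x - \<phi> y"
  using hom_on_add[of F \<phi> x "- y"] by (simp add: subfield_CC_closed hom_on_minus)

lemma hom_on_inj: "subfield F CC \<Longrightarrow> hom_on F \<phi> \<Longrightarrow> inj_on \<phi> F"
proof (rule inj_onI, rule ccontr)
  fix x y assume F: "subfield F CC" "hom_on F \<phi>" "x \<in> F" "y \<in> F" "\<phi> x = \<phi> y" "x \<noteq> y"
  then have "\<phi> ((x - y) * inverse (x - y)) = (\<phi> x - \<phi> y) * \<phi> (inverse (x - y))"
    by (simp only: hom_on_mult hom_on_diff subfield_CC_closed)
  with F show False
    by (simp add: hom_on_one)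
qed

lemma hom_on_inverse:
  assumes "subfield F CC" "hom_on F \<phi>" "x \<in> F" shows "\<phi> (inverse x) = inverse (\<phi> x)"
proof (cases "x = 0")
  case False
  then have "\<phi> x * \<phi> (inverse x) = 1"
    using hom_on_mult[OF assms(2,3) subfield_CC_closed(7)[OF assms(1,3)]] hom_on_one[OF assms(2)] by simp
  then show ?thesis by (metis inverse_unique)
qed (use assms in \<open>simp add: hom_on_zero\<close>)

lemma subfield_preimage:
  assumes "subfield F CC" "subfield E CC" "hom_on F \<phi>"
  shows "subfield {x \<in> F. \<phi> x \<in> E} CC"
  by (rule subfield_CC_I)
    (use assms in \<open>auto simp: subfield_CC_closed hom_on_one hom_on_add hom_on_mult hom_on_minus hom_on_inverse\<close>)

text \<open>The device by which agreement of two homomorphisms on generators propagates to a whole field.\<close>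

lemma subfield_equalizer:
  assumes "subfield F CC" "hom_on F \<phi>" "hom_on F \<psi>"
  shows "subfield {x \<in> F. \<phi> x = \<psi> x} CC"
  by (rule subfield_CC_I)
    (use assms in \<open>auto simp: subfield_CC_closed hom_on_one hom_on_add hom_on_mult hom_on_minus hom_on_inverse\<close>)

lemma hom_on_id: "hom_on F (\<lambda>x. x)"
  by (auto simp: hom_on_def)

lemma hom_on_Rats:
  assumes "subfield F CC" "hom_on F \<phi>" "x \<in> \<rat>"
  shows "\<phi> x = x"
  using Rats_subset_subfield[OF subfield_equalizer[OF assms(1,2) hom_on_id]] assms(3) by auto

section \<open>Polynomials over a subfield\<close>

text \<open>The ring \<open>F[X]\<close> for a subfield \<open>F\<close> given as a set, realised inside the polynomials over the complex
numbers so that roots and evaluation need no change of type.\<close>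

definition polys_over :: "complex set \<Rightarrow> complex poly set" where
  "polys_over F = {p. \<forall>i. coeff p i \<in> F}"

lemma polys_over_coeff: "p \<in> polys_over F \<Longrightarrow> coeff p i \<in> F"
  by (simp add: polys_over_def)

lemma sum_mem_subfield: "subfield F CC \<Longrightarrow> (\<And>i. i \<in> A \<Longrightarrow> f i \<in> F) \<Longrightarrow> sum f A \<in> F"
  by (induction A rule: infinite_finite_induct) (auto simp: subfield_CC_closed)

lemma hom_on_sum: "subfield F CC \<Longrightarrow> hom_on F \<phi> \<Longrightarrow> (\<And>i. i \<in> A \<Longrightarrow> f i \<in> F) \<Longrightarrow>
   \<phi> (sum f A) = (\<Sum>i\<in>A. \<phi> (f i))"
  by (induction A rule: infinite_finite_induct) (auto simp: hom_on_zero hom_on_add sum_mem_subfield)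

lemma polys_over_closed:
  assumes "subfield F CC"
  shows "0 \<in> polys_over F" "1 \<in> polys_over F"
    "p \<in> polys_over F \<Longrightarrow> q \<in> polys_over F \<Longrightarrow> p + q \<in> polys_over F"
    "p \<in> polys_over F \<Longrightarrow> q \<in> polys_over F \<Longrightarrow> p - q \<in> polys_over F"
    "p \<in> polys_over F \<Longrightarrow> q \<in> polys_over F \<Longrightarrow> p * q \<in> polys_over F"
    "c \<in> F \<Longrightarrow> p \<in> polys_over F \<Longrightarrow> pCons c p \<in> polys_over F"
    "c \<in> F \<Longrightarrow> Polynomial.monom c n \<in> polys_over F"
  using assms
  by (auto simp: polys_over_def subfield_CC_closed coeff_mult coeff_pCons split: nat.splits
      intro!: sum_mem_subfield)

lemma poly_mem_subfield: "subfield F CC \<Longrightarrow> p \<in> polys_over F \<Longrightarrow> x \<in> F \<Longrightarrow> poly p x \<in> F"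
proof (induction p)
  case (pCons c p)
  have "c \<in> F" "p \<in> polys_over F"
    using pCons.prems(2) polys_over_coeff[OF pCons.prems(2), of 0]
      polys_over_coeff[OF pCons.prems(2), of "Suc i" for i] by (auto simp: polys_over_def)
  then show ?case
    using pCons by (simp add: subfield_CC_closed)
qed (simp add: subfield_CC_closed)

context
  fixes F \<phi>
  assumes F: "subfield F CC" and \<phi>: "hom_on F \<phi>"
begin

lemma coeff_map_hom [simp]: "coeff (map_poly \<phi> p) i = \<phi> (coeff p i)"
  by (simp add: coeff_map_poly hom_on_zero[OF F \<phi>])

lemma map_poly_hom_add: "p \<in> polys_over F \<Longrightarrow> q \<in> polys_over F \<Longrightarrow>
    map_poly \<phi> (p + q) = map_poly \<phi> p + map_poly \<phi> q"
  by (rule poly_eqI) (simp add: hom_on_add[OF \<phi>] polys_over_coeff)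

lemma map_poly_hom_diff: "p \<in> polys_over F \<Longrightarrow> q \<in> polys_over F \<Longrightarrow>
    map_poly \<phi> (p - q) = map_poly \<phi> p - map_poly \<phi> q"
  by (rule poly_eqI) (simp add: hom_on_diff[OF F \<phi>] polys_over_coeff)

lemma map_poly_hom_mult: "p \<in> polys_over F \<Longrightarrow> q \<in> polys_over F \<Longrightarrow>
    map_poly \<phi> (p * q) = map_poly \<phi> p * map_poly \<phi> q"
  by (rule poly_eqI)
    (simp add: coeff_mult hom_on_sum[OF F \<phi>] hom_on_mult[OF \<phi>] polys_over_coeff subfield_CC_closed(4)[OF F])

lemma map_poly_hom_pCons: "map_poly \<phi> (pCons c p) = pCons (\<phi> c) (map_poly \<phi> p)"
  by (simp add: map_poly_pCons hom_on_zero[OF F \<phi>])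

lemma poly_map_hom: "p \<in> polys_over F \<Longrightarrow> x \<in> F \<Longrightarrow> poly (map_poly \<phi> p) (\<phi> x) = \<phi> (poly p x)"
proof (induction p)
  case 0
  then show ?case by (simp add: hom_on_zero[OF F \<phi>])
next
  case (pCons c p)
  have cp: "c \<in> F" "p \<in> polys_over F"
    using pCons.prems(1) polys_over_coeff[OF pCons.prems(1), of 0]
      polys_over_coeff[OF pCons.prems(1), of "Suc i" for i] by (auto simp: polys_over_def)
  then have "poly p x \<in> F"
    using pCons.prems F poly_mem_subfield by blast
  with pCons cp show ?case
    by (simp add: map_poly_hom_pCons hom_on_add[OF \<phi>] hom_on_mult[OF \<phi>] subfield_CC_closed[OF F])
qed

lemma degree_map_hom: "p \<in> polys_over F \<Longrightarrow> Polynomial.degree (map_poly \<phi> p) = Polynomial.degree p"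
proof (cases "p = 0")
  case False
  assume "p \<in> polys_over F"
  with False show ?thesis
    using inj_onD[OF hom_on_inj[OF F \<phi>], of "Polynomial.lead_coeff p" 0]
    by (intro map_poly_degree_eq)
      (auto simp: polys_over_coeff hom_on_zero[OF F \<phi>] subfield_CC_closed[OF F])
qed simp

end

lemma CC_eval: "CC.eval l a = poly (Poly (rev l)) a"
  by (induction l) (simp_all add: Poly_snoc poly_monom algebra_simps)

text \<open>Links the list polynomials in which algebraic elements and finite extensions are developed to the
polynomial type. Coefficient lists run in opposite directions, whence the reversals.\<close>

lemma algebraic_CC_iff:
  assumes "subfield F CC"
  shows "(CC.algebraic over F) a \<longleftrightarrow> (\<exists>p\<in>polys_over F. p \<noteq> 0 \<and> poly p a = 0)"
proof
  assume "(CC.algebraic over F) a"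
  then obtain l where l: "l \<in> carrier (F [X]\<^bsub>CC\<^esub>)" "l \<noteq> []" "CC.eval l a = 0"
    using CC.algebraicE[OF subfieldE(1)[OF assms], of a] by auto
  then have l': "set l \<subseteq> F" "hd l \<noteq> 0"
    by (auto simp: univ_poly_def polynomial_def)
  have "Poly (rev l) \<in> polys_over F"
    using l'(1) subfield_CC_closed(1)[OF assms] nth_mem[of _ "rev l"]
    by (auto simp: polys_over_def nth_default_def simp del: nth_mem)
  moreover have "coeff (Poly (rev l)) (length l - 1) = hd l"
    using l(2) by (simp add: nth_default_def rev_nth hd_conv_nth)
  then have "Poly (rev l) \<noteq> 0"
    using l' by (metis coeff_0)
  ultimately show "\<exists>p\<in>polys_over F. p \<noteq> 0 \<and> poly p a = 0"
    using l(3) by (auto simp: CC_eval)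
next
  assume "\<exists>p\<in>polys_over F. p \<noteq> 0 \<and> poly p a = 0"
  then obtain p where p: "p \<in> polys_over F" "p \<noteq> 0" "poly p a = 0" by blast
  have "set (coeffs p) \<subseteq> F"
    using p(1) by (auto simp: polys_over_def coeffs_def)
  moreover have "hd (rev (coeffs p)) \<noteq> 0"
    using p(2) by (simp add: hd_rev last_coeffs_eq_coeff_degree)
  ultimately have "rev (coeffs p) \<in> carrier (F [X]\<^bsub>CC\<^esub>)"
    by (simp add: univ_poly_def polynomial_def)
  moreover have "CC.eval (rev (coeffs p)) a = 0"
    using p by (simp add: CC_eval)
  ultimately show "(CC.algebraic over F) a"
    using CC.algebraicI[of "rev (coeffs p)" F a] p(2) by simp
qed

lemma simple_extension_CC:
  assumes "subfield F CC"
  shows "CC.simple_extension F a = {poly p a | p. p \<in> polys_over F}"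
proof (intro equalityI subsetI)
  fix x assume "x \<in> CC.simple_extension F a"
  then show "x \<in> {poly p a | p. p \<in> polys_over F}"
  proof (induction rule: CC.simple_extension.induct)
    case zero
    then show ?case using polys_over_closed(1)[OF assms] by force
  next
    case (lin k1 k2)
    then obtain p where p: "p \<in> polys_over F" "k1 = poly p a" by auto
    then have "poly (pCons k2 p) a = k1 * a + k2" "pCons k2 p \<in> polys_over F"
      using polys_over_closed(6)[OF assms lin(2) p(1)] by auto
    then show ?case by (metis (mono_tags, lifting) CC_simps(2,3) mem_Collect_eq)
  qed
next
  have "poly p a \<in> CC.simple_extension F a" if "p \<in> polys_over F" for p
    using that
  proof (induction p)
    case (pCons c p)
    have "c \<in> F" "p \<in> polys_over F"
      using pCons.prems polys_over_coeff[OF pCons.prems, of 0]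
        polys_over_coeff[OF pCons.prems, of "Suc i" for i] by (auto simp: polys_over_def)
    then show ?case
      using CC.simple_extension.lin[of "poly p a" F a c] pCons.IH by (simp add: algebra_simps)
  qed (use CC.simple_extension.zero in auto)
  then show "x \<in> CC.simple_extension F a" if "x \<in> {poly p a | p. p \<in> polys_over F}" for x
    using that by auto
qed

text \<open>Long division: subtracting the multiple of \<open>m\<close> that matches the leading term of \<open>p\<close> lowers the degree, and the
quotient of the leading coefficients lies in \<open>F\<close>.\<close>

lemma polys_over_division:
  assumes F: "subfield F CC" and m: "m \<in> polys_over F" "m \<noteq> 0" and p: "p \<in> polys_over F"
  shows "\<exists>q\<in>polys_over F. \<exists>r\<in>polys_over F. p = q * m + r \<and>
    (r = 0 \<or> Polynomial.degree r < Polynomial.degree m)"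
  using p
proof (induction "Polynomial.degree p" arbitrary: p rule: less_induct)
  case less
  show ?case
  proof (cases "p = 0 \<or> Polynomial.degree p < Polynomial.degree m")
    case True
    then show ?thesis using less(2) polys_over_closed(1)[OF F]
      by (intro bexI[of _ 0] bexI[of _ p]) auto
  next
    case False
    let ?c = "Polynomial.lead_coeff p / Polynomial.lead_coeff m"
    let ?n = "Polynomial.degree p - Polynomial.degree m"
    define t where "t = Polynomial.monom ?c ?n"
    have t: "t \<in> polys_over F"
      unfolding t_def using less(2) m(1)
      by (intro polys_over_closed(7)[OF F] subfield_CC_closed(8)[OF F] polys_over_coeff)
    have tm: "t * m \<in> polys_over F" "p - t * m \<in> polys_over F"
      using polys_over_closed[OF F] t m(1) less(2) by auto
    have c: "?c \<noteq> 0" using False m(2) by simp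
    have "Polynomial.degree t = ?n"
      unfolding t_def by (rule degree_monom_eq[OF c])
    moreover have "t \<noteq> 0"
      unfolding t_def monom_eq_0_iff by (rule c)
    ultimately have deg: "Polynomial.degree (t * m) = Polynomial.degree p"
      using False m(2) by (simp add: degree_mult_eq)
    have lead: "Polynomial.lead_coeff (t * m) = Polynomial.lead_coeff p"
    proof -
      have "Polynomial.lead_coeff t = ?c"
        unfolding t_def by (rule lead_coeff_monom)
      with m(2) show ?thesis
        unfolding lead_coeff_mult by simp
    qed
    show ?thesis
    proof (cases "p - t * m = 0")
      case True
      then show ?thesis using t polys_over_closed(1)[OF F] by (intro bexI[of _ t] bexI[of _ 0]) auto
    next
      case F': False
      have "Polynomial.degree (p - t * m) < Polynomial.degree p"
      proof -
        have "Polynomial.degree (p - t * m) \<le> Polynomial.degree p"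
          by (rule degree_diff_le) (simp_all only: deg order_refl)
        moreover have "coeff (p - t * m) (Polynomial.degree p) = 0"
          using lead unfolding deg by simp
        ultimately show ?thesis
          using F' by (metis le_neq_implies_less leading_coeff_0_iff)
      qed
      from less(1)[OF this tm(2)] obtain q r where qr: "q \<in> polys_over F" "r \<in> polys_over F"
        "p - t * m = q * m + r" "r = 0 \<or> Polynomial.degree r < Polynomial.degree m" by blast
      then have "p = (t + q) * m + r" by (simp add: algebra_simps)
      moreover have "t + q \<in> polys_over F" using polys_over_closed(3)[OF F t qr(1)] .
      ultimately show ?thesis using qr by blast
    qed
  qed
qed

text \<open>Take a polynomial of least degree: the remainder of \<open>p\<close> modulo it vanishes at \<open>a\<close> and is too short to be
nonzero.\<close>

lemma minimal_polynomial_exists: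
  assumes F: "subfield F CC" and a: "(CC.algebraic over F) a"
  obtains m where "m \<in> polys_over F" "m \<noteq> 0" "poly m a = 0"
    "\<And>p. p \<in> polys_over F \<Longrightarrow> poly p a = 0 \<Longrightarrow> \<exists>q\<in>polys_over F. p = q * m"
proof -
  define P where "P = (\<lambda>p. p \<in> polys_over F \<and> p \<noteq> 0 \<and> poly p a = 0)"
  obtain p0 where "P p0" using a unfolding algebraic_CC_iff[OF F] P_def by blast
  then obtain m where m: "P m" "\<And>p. Polynomial.degree p < Polynomial.degree m \<Longrightarrow> \<not> P p"
    using exists_least_iff[of "\<lambda>n. \<exists>p. P p \<and> Polynomial.degree p = n"] by blast
  have m': "m \<in> polys_over F" "m \<noteq> 0" "poly m a = 0" using m(1) by (auto simp: P_def)
  have "\<exists>q\<in>polys_over F. p = q * m" if p: "p \<in> polys_over F" "poly p a = 0" for p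
  proof -
    obtain q r where qr: "q \<in> polys_over F" "r \<in> polys_over F" "p = q * m + r"
      "r = 0 \<or> Polynomial.degree r < Polynomial.degree m"
      using polys_over_division[OF F m'(1,2) p(1)] by blast
    then have "poly r a = 0" using p(2) m'(3) by simp
    with qr m(2)[of r] have "r = 0" by (auto simp: P_def)
    with qr show ?thesis by auto
  qed
  with m' that show ?thesis by blast
qed

text \<open>The value at \<open>poly p a\<close> must be \<open>poly (map_poly \<phi> p) b\<close>. The hypothesis on \<open>b\<close>, applied to a difference of two
representations, says that this is well defined.\<close>

lemma hom_on_simple_extension:
  assumes F: "subfield F CC" and \<phi>: "hom_on F \<phi>"
    and b: "\<And>p. p \<in> polys_over F \<Longrightarrow> poly p a = 0 \<Longrightarrow> poly (map_poly \<phi> p) b = 0"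
  shows "\<exists>\<psi>. hom_on (CC.simple_extension F a) \<psi> \<and> (\<forall>x\<in>F. \<psi> x = \<phi> x) \<and> \<psi> a = b"
proof -
  define g where "g = (\<lambda>p. poly (map_poly \<phi> p) b)"
  define \<psi> where "\<psi> = (\<lambda>y. g (SOME p. p \<in> polys_over F \<and> poly p a = y))"
  note cl = polys_over_closed[OF F]
  have \<psi>: "\<psi> (poly p a) = g p" if p: "p \<in> polys_over F" for p
  proof -
    define q where "q = (SOME q. q \<in> polys_over F \<and> poly q a = poly p a)"
    have q: "q \<in> polys_over F" "poly q a = poly p a"
      using someI[of "\<lambda>q. q \<in> polys_over F \<and> poly q a = poly p a" p] p by (auto simp: q_def)
    then have "poly (map_poly \<phi> (q - p)) b = 0"
      using p by (intro b cl) auto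
    then have "g q = g p"
      using p q by (simp add: g_def map_poly_hom_diff[OF F \<phi>])
    then show ?thesis by (simp add: \<psi>_def q_def)
  qed
  have c: "\<psi> x = \<phi> x" if "x \<in> F" for x
    using \<psi>[of "[:x:]"] cl(6)[OF that cl(1)] by (simp add: g_def map_poly_hom_pCons[OF F \<phi>])
  have one: "\<psi> 1 = 1"
    using c[of 1] subfield_CC_closed(2)[OF F] hom_on_one[OF \<phi>] by simp
  have "\<psi> (x + y) = \<psi> x + \<psi> y \<and> \<psi> (x * y) = \<psi> x * \<psi> y"
    if "x \<in> CC.simple_extension F a" "y \<in> CC.simple_extension F a" for x y
  proof -
    obtain p q where pq: "p \<in> polys_over F" "q \<in> polys_over F" "x = poly p a" "y = poly q a"
      using \<open>x \<in> _\<close> \<open>y \<in> _\<close> unfolding simple_extension_CC[OF F] by blast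
    have "x + y = poly (p + q) a" "x * y = poly (p * q) a"
      using pq by auto
    then have "\<psi> (x + y) = g (p + q)" "\<psi> (x * y) = g (p * q)"
      using \<psi>[of "p + q"] \<psi>[of "p * q"] cl pq by simp_all
    then show ?thesis
      using pq \<psi> by (simp add: g_def map_poly_hom_add[OF F \<phi>] map_poly_hom_mult[OF F \<phi>])
  qed
  then have "hom_on (CC.simple_extension F a) \<psi>"
    using one by (simp add: hom_on_def)
  moreover have "[:0, 1:] \<in> polys_over F"
    using cl(6)[OF _ cl(6)[OF _ cl(1)]] subfield_CC_closed(1,2)[OF F] by simp
  then have "\<psi> a = b"
    using \<psi>[of "[:0, 1:]"]
    by (simp add: g_def map_poly_hom_pCons[OF F \<phi>] hom_on_zero[OF F \<phi>] hom_on_one[OF \<phi>])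
  ultimately show ?thesis using c by blast
qed

text \<open>The complex numbers contain a root of the image of the minimal polynomial, since \<open>\<phi>\<close> is injective and
therefore preserves its positive degree.\<close>

lemma hom_on_extends_to_simple_extension:
  assumes F: "subfield F CC" and \<phi>: "hom_on F \<phi>" and a: "(CC.algebraic over F) a"
  shows "\<exists>\<psi>. hom_on (CC.simple_extension F a) \<psi> \<and> (\<forall>x\<in>F. \<psi> x = \<phi> x)"
proof -
  obtain m where m: "m \<in> polys_over F" "m \<noteq> 0" "poly m a = 0"
    "\<And>p. p \<in> polys_over F \<Longrightarrow> poly p a = 0 \<Longrightarrow> \<exists>q\<in>polys_over F. p = q * m"
    using minimal_polynomial_exists[OF F a] by blast
  have "Polynomial.degree m \<noteq> 0"
  proof
    assume "Polynomial.degree m = 0"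
    then obtain c where "m = [:c:]" by (meson degree_eq_zeroE)
    with m(2,3) show False by simp
  qed
  then obtain b where b: "poly (map_poly \<phi> m) b = 0"
    using fundamental_theorem_of_algebra[of "map_poly \<phi> m"] degree_map_hom[OF F \<phi> m(1)]
    by (metis constant_degree)
  have "poly (map_poly \<phi> p) b = 0" if "p \<in> polys_over F" "poly p a = 0" for p
  proof -
    obtain q where q: "q \<in> polys_over F" "p = q * m" using m(4)[OF \<open>p \<in> _\<close> \<open>poly p a = 0\<close>] by blast
    then show ?thesis using b m(1) by (simp add: map_poly_hom_mult[OF F \<phi>])
  qed
  from hom_on_simple_extension[OF F \<phi> this] show ?thesis by blast
qed

lemma hom_on_extends_to_finite_extension:
  assumes F: "subfield F CC" and \<phi>: "hom_on F \<phi>"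
    and "\<And>x. x \<in> set xs \<Longrightarrow> (CC.algebraic over F) x"
  shows "\<exists>\<psi>. hom_on (CC.finite_extension F xs) \<psi> \<and> (\<forall>x\<in>F. \<psi> x = \<phi> x)"
  using assms(3)
proof (induction xs)
  case Nil
  then show ?case using \<phi> by auto
next
  case (Cons a xs)
  let ?E = "CC.finite_extension F xs"
  obtain \<psi> where \<psi>: "hom_on ?E \<psi>" "\<forall>x\<in>F. \<psi> x = \<phi> x" using Cons by auto
  have E: "subfield ?E CC" "F \<subseteq> ?E"
    using CC.finite_extension_is_subfield[OF F] CC.finite_extension_incl[of F xs] Cons.prems by auto
  have "(CC.algebraic over ?E) a"
    using CC.algebraic_mono[OF E(2)] Cons.prems by simp
  from hom_on_extends_to_simple_extension[OF E(1) \<psi>(1) this] \<psi>(2) E(2)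
  show ?case by (metis CC.finite_extension.simps comp_apply foldr.simps(2) subsetD)
qed

section \<open>Number fields\<close>

lemma number_field_subfield: "number_field L \<Longrightarrow> subfield L CC"
  by (simp add: number_field_def)

lemma number_field_algebraic: "number_field L \<Longrightarrow> x \<in> L \<Longrightarrow> (CC.algebraic over \<rat>) x"
  using CC.finite_dimension_imp_algebraic[OF subfield_Rats, of L x] subfieldE(1)
  by (auto simp: number_field_def)

text \<open>A basis over the rationals generates the field, so inclusions of \<open>L\<close> and equalities of homomorphisms on \<open>L\<close> can
be tested on finitely many elements.\<close>

lemma number_field_generators:
  assumes "number_field L"
  obtains Us where "set Us \<subseteq> L" "\<And>M. subfield M CC \<Longrightarrow> set Us \<subseteq> M \<Longrightarrow> L \<subseteq> M"
proof -
  obtain n where "CC.dimension n \<rat> L"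
    using assms by (auto simp: number_field_def CC.finite_dimension_def)
  then obtain Us where Us: "CC.Span \<rat> Us = L"
    using CC.exists_base[OF subfield_Rats] by blast
  have "set Us \<subseteq> L"
    using CC.Span_base_incl[OF subfield_Rats, of Us] Us by simp
  moreover have "L \<subseteq> M" if M: "subfield M CC" "set Us \<subseteq> M" for M
  proof
    fix x assume "x \<in> L"
    then obtain Ks where Ks: "set Ks \<subseteq> \<rat>" "x = CC.combine Ks Us"
      using CC.Span_mem_iff_length_version[OF subfield_Rats, of Us x] Us by auto
    have "CC.combine Ks Us \<in> M" if "set Ks \<subseteq> M" "set Us \<subseteq> M" for Ks Us
      using that by (induction Ks Us rule: CC.combine.induct) (auto simp: subfield_CC_closed[OF M(1)])
    with Ks M show "x \<in> M" using Rats_subset_subfield[OF M(1)] by blast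
  qed
  ultimately show thesis using that by blast
qed

lemma number_field_mono:
  assumes "number_field L" "subfield M CC" "M \<subseteq> L"
  shows "number_field M"
proof -
  obtain n where n: "CC.dimension n \<rat> L"
    using assms(1) by (auto simp: number_field_def CC.finite_dimension_def)
  \<comment> \<open>A longest independent list in \<open>M\<close> spans \<open>M\<close>.\<close>
  define P where "P = (\<lambda>k. \<exists>Us. CC.independent \<rat> Us \<and> set Us \<subseteq> M \<and> length Us = k)"
  have "P 0" by (auto simp: P_def)
  moreover have "k \<le> n" if "P k" for k
    using CC.independent_length_le_dimension[OF subfield_Rats n] that assms(3) unfolding P_def by blast
  ultimately obtain k where k: "P k" "\<And>j. P j \<Longrightarrow> j \<le> k"
    using Nat.ex_has_greatest_nat[of P 0 n] by blast
  then obtain Us where Us: "CC.independent \<rat> Us" "set Us \<subseteq> M" "length Us = k"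
    by (auto simp: P_def)
  have "CC.Span \<rat> Us \<subseteq> M"
  proof
    fix x assume "x \<in> CC.Span \<rat> Us"
    then obtain Ks where Ks: "set Ks \<subseteq> \<rat>" "x = CC.combine Ks Us"
      using CC.Span_mem_iff_length_version[OF subfield_Rats, of Us x] by auto
    have "CC.combine Ks Us \<in> M" if "set Ks \<subseteq> M" "set Us \<subseteq> M" for Ks Us
      using that by (induction Ks Us rule: CC.combine.induct) (auto simp: subfield_CC_closed[OF assms(2)])
    with Ks Us show "x \<in> M" using Rats_subset_subfield[OF assms(2)] by blast
  qed
  moreover have "x \<in> CC.Span \<rat> Us" if "x \<in> M" for x
  proof (rule ccontr)
    assume "x \<notin> CC.Span \<rat> Us"
    then have "P (Suc k)"
      unfolding P_def using Us that CC.independent.li_Cons[of x \<rat> Us] by (intro exI[of _ "x # Us"]) auto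
    then show False using k(2) by fastforce
  qed
  ultimately have "CC.Span \<rat> Us = M" by blast
  then show ?thesis
    using CC.dimensionI[OF subfield_Rats Us(1)] assms(2)
    by (auto simp: number_field_def CC.finite_dimension_def)
qed

lemma number_field_adjoin:
  assumes "\<And>x. x \<in> set xs \<Longrightarrow> (CC.algebraic over \<rat>) x"
  shows "number_field (CC.finite_extension \<rat> xs)"
  using CC.finite_extension_is_subfield[OF subfield_Rats] CC.finite_extension_finite_dimension(1)[OF subfield_Rats] assms
  by (auto simp: number_field_def)

text \<open>Adjoin a basis of \<open>L\<close> to \<open>F\<close> one element at a time, and restrict the homomorphism obtained on the compositum to \<open>L\<close>.\<close>

lemma hom_on_extends_to_number_field:
  assumes F: "subfield F CC" and \<phi>: "hom_on F \<phi>" and L: "number_field L"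
  shows "\<exists>\<psi>. hom_on L \<psi> \<and> (\<forall>x\<in>F. \<psi> x = \<phi> x)"
proof -
  obtain Us where Us: "set Us \<subseteq> L" "\<And>M. subfield M CC \<Longrightarrow> set Us \<subseteq> M \<Longrightarrow> L \<subseteq> M"
    using number_field_generators[OF L] by blast
  have alg: "(CC.algebraic over F) x" if "x \<in> set Us" for x
    using that Us(1) number_field_algebraic[OF L] CC.algebraic_mono[OF Rats_subset_subfield[OF F]] by blast
  obtain \<psi> where \<psi>: "hom_on (CC.finite_extension F Us) \<psi>" "\<forall>x\<in>F. \<psi> x = \<phi> x"
    using hom_on_extends_to_finite_extension[OF F \<phi> alg] by blast
  have "L \<subseteq> CC.finite_extension F Us"
    using CC.finite_extension_is_subfield[OF F _ alg] CC.finite_extension_mem[OF subfieldE(1)[OF F]]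
    by (intro Us(2)) auto
  with \<psi> show ?thesis using hom_on_subset by blast
qed

lemma polys_over_Rats: "p \<in> polys_over \<rat> \<longleftrightarrow> (\<exists>q :: rat poly. p = map_poly of_rat q)"
proof
  assume p: "p \<in> polys_over \<rat>"
  define q :: "rat poly" where "q = map_poly (inv_into UNIV of_rat) p"
  have inv0: "inv_into UNIV of_rat (0 :: complex) = (0 :: rat)"
    by (metis inv_f_f of_rat_0 of_rat_eq_iff injI)
  have "p = map_poly of_rat q"
  proof (rule poly_eqI)
    fix i
    have "coeff p i \<in> range of_rat"
      using polys_over_coeff[OF p] by (simp add: Rats_def)
    then show "coeff p i = coeff (map_poly of_rat q) i"
      by (simp add: q_def coeff_map_poly inv0 f_inv_into_f)
  qed
  then show "\<exists>q :: rat poly. p = map_poly of_rat q" by blast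
qed (auto simp: polys_over_def coeff_map_poly)

lemma map_poly_of_rat_mult:
  "map_poly of_rat (p * q) = (map_poly of_rat p * map_poly of_rat q :: complex poly)"
  by (rule poly_eqI) (simp add: coeff_mult coeff_map_poly of_rat_sum of_rat_mult)

lemma map_poly_of_rat_eq_iff: "(map_poly of_rat p :: complex poly) = map_poly of_rat q \<longleftrightarrow> p = q"
  by (auto simp: poly_eq_iff coeff_map_poly)

lemma hom_on_rat_poly:
  assumes "subfield F CC" "hom_on F \<phi>" "x \<in> F"
  shows "poly (map_poly of_rat p) (\<phi> x) = \<phi> (poly (map_poly of_rat p) x)"
proof -
  let ?p = "map_poly of_rat p"
  have p: "?p \<in> polys_over \<rat>" using polys_over_Rats by blast
  then have "?p \<in> polys_over F"
    using Rats_subset_subfield[OF assms(1)] by (auto simp: polys_over_def)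
  moreover have "map_poly \<phi> ?p = ?p"
    by (rule poly_eqI) (use assms in \<open>simp add: coeff_map_hom[OF assms(1,2)] coeff_map_poly hom_on_Rats\<close>)
  ultimately show ?thesis
    using poly_map_hom[OF assms(1,2) _ assms(3)] by metis
qed

text \<open>A nonzero polynomial of least degree with root \<open>x\<close> is irreducible, because \<open>x\<close> is a root of one of the
factors in any factorisation.\<close>

lemma irreducible_rat_poly_exists:
  assumes "(CC.algebraic over \<rat>) x"
  obtains p :: "rat poly" where "Factorial_Ring.irreducible p" "poly (map_poly of_rat p) x = 0"
proof -
  define P where "P = (\<lambda>p :: rat poly. p \<noteq> 0 \<and> poly (map_poly of_rat p) x = 0)"
  obtain p0 where "P p0"
    using assms unfolding algebraic_CC_iff[OF subfield_Rats] P_def by (metis polys_over_Rats map_poly_0)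
  then obtain m where m: "P m" "\<And>p. Polynomial.degree p < Polynomial.degree m \<Longrightarrow> \<not> P p"
    using exists_least_iff[of "\<lambda>n. \<exists>p. P p \<and> Polynomial.degree p = n"] by blast
  have m0: "m \<noteq> 0" "poly (map_poly of_rat m) x = 0" using m(1) by (auto simp: P_def)
  have "\<not> is_unit m"
  proof
    assume "is_unit m"
    then obtain c where "m = [:c:]" "c \<noteq> 0"
      using is_unit_polyE by (metis m0(1) pCons_0_0)
    with m0(2) show False by (simp add: map_poly_pCons)
  qed
  moreover have "is_unit a \<or> is_unit b" if ab: "m = a * b" for a b
  proof -
    have ab0: "a \<noteq> 0" "b \<noteq> 0" using ab m0 by auto
    then have deg: "Polynomial.degree m = Polynomial.degree a + Polynomial.degree b"
      using ab degree_mult_eq by blast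
    have "P a \<or> P b" using m0(2) ab ab0 by (simp add: P_def map_poly_of_rat_mult)
    then have "Polynomial.degree a = 0 \<or> Polynomial.degree b = 0"
      using m(2)[of a] m(2)[of b] deg by linarith
    then show ?thesis using ab0 by (simp add: is_unit_iff_degree)
  qed
  ultimately have "Factorial_Ring.irreducible m"
    using m0(1) by (rule Factorial_Ring.irreducibleI[rotated 1])
  with m0(2) that show thesis by blast
qed

text \<open>Up to a constant, \<open>p\<close> is the minimal polynomial of \<open>x\<close>; so sending \<open>x\<close> to \<open>y\<close> is compatible with all relations, and
the resulting embedding of \<open>\<rat>(x)\<close> extends to \<open>L\<close>.\<close>

lemma hom_on_conjugate:
  assumes L: "number_field L" and x: "x \<in> L" and p: "Factorial_Ring.irreducible (p :: rat poly)"
    "poly (map_poly of_rat p) x = 0" "poly (map_poly of_rat p) y = 0"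
  shows "\<exists>\<psi>. hom_on L \<psi> \<and> \<psi> x = y"
proof -
  have alg: "(CC.algebraic over \<rat>) x" using number_field_algebraic[OF L x] .
  obtain m where m: "m \<in> polys_over \<rat>" "m \<noteq> 0" "poly m x = 0"
    "\<And>p. p \<in> polys_over \<rat> \<Longrightarrow> poly p x = 0 \<Longrightarrow> \<exists>q\<in>polys_over \<rat>. p = q * m"
    using minimal_polynomial_exists[OF subfield_Rats alg] by blast
  obtain q where q: "q \<in> polys_over \<rat>" "map_poly of_rat p = q * m"
    using m(4) p(2) polys_over_Rats by blast
  obtain m' q' where m': "m = map_poly of_rat m'" and q': "q = map_poly of_rat q'"
    using m(1) q(1) polys_over_Rats by blast
  have "p = q' * m'"
    using q(2) unfolding m' q' by (simp flip: map_poly_of_rat_mult add: map_poly_of_rat_eq_iff)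
  moreover have "\<not> is_unit m'"
  proof
    assume "is_unit m'"
    then obtain c where "m' = [:c:]" "c \<noteq> 0"
      using is_unit_polyE by (metis m(2) m' map_poly_0 pCons_0_0)
    with m(3) show False by (simp add: m' map_poly_pCons)
  qed
  ultimately have "is_unit q'" using p(1) Factorial_Ring.irreducibleD by blast
  then obtain c where "q' = [:c:]" "c \<noteq> 0"
    using is_unit_polyE by (metis not_is_unit_0)
  then have my: "poly m y = 0"
    using p(3) q(2) by (simp add: q' map_poly_pCons)
  have "poly (map_poly (\<lambda>x. x) r) y = 0" if "r \<in> polys_over \<rat>" "poly r x = 0" for r
    using m(4)[OF that] my by auto
  then obtain \<psi>' where \<psi>': "hom_on (CC.simple_extension \<rat> x) \<psi>'" "\<psi>' x = y"
    using hom_on_simple_extension[OF subfield_Rats hom_on_id] by blast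
  have "subfield (CC.simple_extension \<rat> x) CC" "x \<in> CC.simple_extension \<rat> x"
    using CC.simple_extension_is_subfield[OF subfield_Rats, of x] alg
      CC.simple_extension_mem[OF subfieldE(1)[OF subfield_Rats], of x] by auto
  with hom_on_extends_to_number_field[OF _ \<psi>'(1) L] \<psi>'(2) show ?thesis by metis
qed

section \<open>Galois theory of number fields\<close>

text \<open>Normality in terms of embeddings instead of polynomials. This form is inherited by intersections and is
easy to verify on generators.\<close>

lemma Galois_over_rat_iff:
  "Galois_over_rat L \<longleftrightarrow> number_field L \<and> (\<forall>\<psi>. hom_on L \<psi> \<longrightarrow> \<psi> ` L \<subseteq> L)"
proof (intro iffI conjI allI impI)
  show "number_field L" if "Galois_over_rat L"
    using that by (simp add: Galois_over_rat_def)
next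
  fix \<psi> assume L: "Galois_over_rat L" and \<psi>: "hom_on L \<psi>"
  then have nf: "number_field L" by (simp add: Galois_over_rat_def)
  show "\<psi> ` L \<subseteq> L"
  proof clarify
    fix x assume x: "x \<in> L"
    obtain p :: "rat poly" where p: "Factorial_Ring.irreducible p" "poly (map_poly of_rat p) x = 0"
      using irreducible_rat_poly_exists[OF number_field_algebraic[OF nf x]] .
    have "poly (map_poly of_rat p) (\<psi> x) = 0"
      using hom_on_rat_poly[OF number_field_subfield[OF nf] \<psi> x] p(2)
        hom_on_zero[OF number_field_subfield[OF nf] \<psi>] by simp
    with L p x show "\<psi> x \<in> L" unfolding Galois_over_rat_def by blast
  qed
next
  assume *: "number_field L \<and> (\<forall>\<psi>. hom_on L \<psi> \<longrightarrow> \<psi> ` L \<subseteq> L)"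
  show "Galois_over_rat L"
    unfolding Galois_over_rat_def
  proof (intro conjI allI impI subsetI)
    fix p :: "rat poly" and y :: complex
    assume p: "Factorial_Ring.irreducible p" "\<exists>x\<in>L. poly (map_poly of_rat p) x = 0"
      and y: "y \<in> {x. poly (map_poly of_rat p) x = 0}"
    then obtain x where "x \<in> L" "poly (map_poly of_rat p) x = 0" by blast
    with hom_on_conjugate[OF _ _ p(1), of L x y] * y show "y \<in> L" by blast
  qed (use * in blast)
qed

lemma finite_roots_irreducible:
  "Factorial_Ring.irreducible (p :: rat poly) \<Longrightarrow> finite {x :: complex. poly (map_poly of_rat p) x = 0}"
  by (rule poly_roots_finite) (metis irreducible_def map_poly_0 map_poly_of_rat_eq_iff)

text \<open>Adjoin all conjugates of a finite set of generators. Every embedding of the resulting field permutes these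
conjugates, hence maps the field to itself.\<close>

lemma Galois_extension_exists:
  assumes K: "number_field K"
  shows "\<exists>L. K \<subseteq> L \<and> Galois_over_rat L"
proof -
  obtain Us where Us: "set Us \<subseteq> K" "\<And>M. subfield M CC \<Longrightarrow> set Us \<subseteq> M \<Longrightarrow> K \<subseteq> M"
    using number_field_generators[OF K] by blast
  have "\<forall>u\<in>set Us. \<exists>p :: rat poly. Factorial_Ring.irreducible p \<and> poly (map_poly of_rat p) u = 0"
    using irreducible_rat_poly_exists[OF number_field_algebraic[OF K]] Us(1) by (metis subsetD)
  then obtain p :: "complex \<Rightarrow> rat poly" where
    p: "\<And>u. u \<in> set Us \<Longrightarrow> Factorial_Ring.irreducible (p u) \<and> poly (map_poly of_rat (p u)) u = 0"
    by metis
  define S where "S = (\<Union>u\<in>set Us. {x :: complex. poly (map_poly of_rat (p u)) x = 0})"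
  have "finite S" unfolding S_def using p finite_roots_irreducible by blast
  then obtain xs where xs: "set xs = S" using finite_list by blast
  have alg: "(CC.algebraic over \<rat>) x" if x: "x \<in> set xs" for x
  proof -
    from x obtain u where u: "u \<in> set Us" "poly (map_poly of_rat (p u)) x = 0"
      unfolding xs S_def by blast
    moreover have "(map_poly of_rat (p u) :: complex poly) \<noteq> 0"
      using p[OF u(1)] by (metis irreducible_def map_poly_0 map_poly_of_rat_eq_iff)
    ultimately show ?thesis
      unfolding algebraic_CC_iff[OF subfield_Rats] using polys_over_Rats by blast
  qed
  define L where "L = CC.finite_extension \<rat> xs"
  have L: "number_field L" unfolding L_def by (rule number_field_adjoin[OF alg])
  note sub = number_field_subfield[OF L]
  have SL: "S \<subseteq> L"
    unfolding L_def xs[symmetric] using CC.finite_extension_mem[OF subfieldE(1)[OF subfield_Rats]] by simp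
  have "K \<subseteq> L"
  proof (rule Us(2)[OF sub])
    show "set Us \<subseteq> L" using SL p unfolding S_def by blast
  qed
  moreover have "\<psi> ` L \<subseteq> L" if \<psi>: "hom_on L \<psi>" for \<psi>
  proof -
    let ?M = "{x \<in> L. \<psi> x \<in> L}"
    have M: "subfield ?M CC" by (rule subfield_preimage[OF sub sub \<psi>])
    have "S \<subseteq> ?M"
    proof
      fix x assume x: "x \<in> S"
      then obtain u where u: "u \<in> set Us" "poly (map_poly of_rat (p u)) x = 0"
        unfolding S_def by blast
      have "poly (map_poly of_rat (p u)) (\<psi> x) = 0"
        using hom_on_rat_poly[OF sub \<psi>, of x "p u"] x SL u hom_on_zero[OF sub \<psi>] by auto
      then have "\<psi> x \<in> S" using u(1) unfolding S_def by blast
      with x SL show "x \<in> ?M" by blast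
    qed
    then have "L \<subseteq> ?M"
      unfolding L_def
      using CC.finite_extension_subring_incl[OF subfieldE(1)[OF M] Rats_subset_subfield[OF M], of xs]
      by (simp add: xs L_def)
    then show ?thesis by blast
  qed
  ultimately show ?thesis using L Galois_over_rat_iff by blast
qed

lemma subfield_Inter:
  assumes "\<And>F. F \<in> C \<Longrightarrow> subfield F CC"
  shows "subfield (\<Inter>C) CC"
  by (rule subfield_CC_I) (use assms in \<open>auto simp: subfield_CC_closed\<close>)

text \<open>An embedding of the intersection extends to each Galois field that contains \<open>K\<close>, where it takes values in
that field; so it preserves the intersection.\<close>

lemma Galois_closure:
  assumes K: "number_field K"
  shows "K \<subseteq> galois_closure K" "Galois_over_rat (galois_closure K)"
    "\<And>L. K \<subseteq> L \<Longrightarrow> Galois_over_rat L \<Longrightarrow> galois_closure K \<subseteq> L"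
proof -
  let ?C = "{L. K \<subseteq> L \<and> Galois_over_rat L}"
  show "K \<subseteq> galois_closure K" "\<And>L. K \<subseteq> L \<Longrightarrow> Galois_over_rat L \<Longrightarrow> galois_closure K \<subseteq> L"
    by (auto simp: galois_closure_def)
  have sub: "subfield (galois_closure K) CC"
    unfolding galois_closure_def
    by (rule subfield_Inter) (auto simp: Galois_over_rat_def number_field_def)
  obtain L where L: "K \<subseteq> L" "Galois_over_rat L" using Galois_extension_exists[OF K] by blast
  have "number_field (galois_closure K)"
    by (rule number_field_mono[of L]) (use L sub in \<open>auto simp: galois_closure_def Galois_over_rat_def\<close>)
  moreover have "\<psi> x \<in> galois_closure K"
    if \<psi>: "hom_on (galois_closure K) \<psi>" and x: "x \<in> galois_closure K" for \<psi> x
    unfolding galois_closure_def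
  proof (intro InterI)
    fix M assume M: "M \<in> ?C"
    then have "number_field M" and norm: "\<And>\<psi>. hom_on M \<psi> \<Longrightarrow> \<psi> ` M \<subseteq> M"
      using Galois_over_rat_iff by blast+
    then obtain \<psi>' where \<psi>': "hom_on M \<psi>'" "\<forall>x\<in>galois_closure K. \<psi>' x = \<psi> x"
      using hom_on_extends_to_number_field[OF sub \<psi>] by blast
    have "x \<in> M" using x M by (auto simp: galois_closure_def)
    with norm[OF \<psi>'(1)] \<psi>'(2) x show "\<psi> x \<in> M" by force
  qed
  ultimately show "Galois_over_rat (galois_closure K)"
    using Galois_over_rat_iff by blast
qed

lemma finite_at_most_one: "(\<And>x y. x \<in> S \<Longrightarrow> y \<in> S \<Longrightarrow> x = y) \<Longrightarrow> finite S"
proof (cases "S = {}")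
  case False
  then obtain a where "a \<in> S" by blast
  then show "finite S" if "\<And>x y. x \<in> S \<Longrightarrow> y \<in> S \<Longrightarrow> x = y"
    using that by (intro finite_subset[of S "{a}"]) auto
qed simp

context
  fixes L assumes Gal: "Galois_over_rat L"
begin

lemma Galois_number_field: "number_field L"
  using Gal by (simp add: Galois_over_rat_def)

lemma Galois_subfield: "subfield L CC"
  using Galois_number_field number_field_subfield by blast

lemma hom_on_Galois_image: "hom_on L \<psi> \<Longrightarrow> x \<in> L \<Longrightarrow> \<psi> x \<in> L"
  using Gal Galois_over_rat_iff by blast

text \<open>Surjectivity holds because an injective map of the finite root set of an irreducible polynomial to itself is onto.\<close>

lemma hom_on_Galois_bij:
  assumes \<psi>: "hom_on L \<psi>" shows "bij_betw \<psi> L L"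
proof -
  note inj = hom_on_inj[OF Galois_subfield \<psi>]
  have "y \<in> \<psi> ` L" if y: "y \<in> L" for y
  proof -
    obtain p :: "rat poly" where p: "Factorial_Ring.irreducible p" "poly (map_poly of_rat p) y = 0"
      using irreducible_rat_poly_exists[OF number_field_algebraic[OF Galois_number_field y]] .
    define S where "S = {x :: complex. poly (map_poly of_rat p) x = 0}"
    have S: "finite S" "S \<subseteq> L" "y \<in> S"
      using finite_roots_irreducible[OF p(1)] Gal p y unfolding S_def Galois_over_rat_def by blast+
    have "\<psi> ` S \<subseteq> S"
      using S(2) hom_on_rat_poly[OF Galois_subfield \<psi>] hom_on_zero[OF Galois_subfield \<psi>]
      unfolding S_def by (auto simp: subset_iff)
    then have "\<psi> ` S = S"
      using S inj by (metis endo_inj_surj inj_on_subset)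
    with S show ?thesis by blast
  qed
  with inj hom_on_Galois_image[OF \<psi>] show ?thesis
    by (auto simp: bij_betw_def)
qed

lemma mem_gal_iff:
  "\<sigma> \<in> gal L F \<longleftrightarrow> hom_on L \<sigma> \<and> \<sigma> \<in> extensional L \<and> (\<forall>x\<in>F. \<sigma> x = x)"
  using hom_on_Galois_bij[of \<sigma>]
  by (auto simp: gal_def ring_iso_def ring_hom_CC_iff bij_betw_def)

lemma mem_gal_Rats_iff: "\<sigma> \<in> gal L \<rat> \<longleftrightarrow> hom_on L \<sigma> \<and> \<sigma> \<in> extensional L"
  using hom_on_Rats[OF Galois_subfield] by (auto simp: mem_gal_iff)

lemma gal_eq: "gal L F = {\<sigma> \<in> gal L \<rat>. \<forall>x\<in>F. \<sigma> x = x}"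
  by (auto simp: mem_gal_iff hom_on_Rats[OF Galois_subfield])

lemma gal_closed: "\<sigma> \<in> gal L \<rat> \<Longrightarrow> x \<in> L \<Longrightarrow> \<sigma> x \<in> L"
  using hom_on_Galois_image mem_gal_Rats_iff by blast

lemma gal_eqI: "\<sigma> \<in> gal L \<rat> \<Longrightarrow> \<tau> \<in> gal L \<rat> \<Longrightarrow> (\<And>x. x \<in> L \<Longrightarrow> \<sigma> x = \<tau> x) \<Longrightarrow> \<sigma> = \<tau>"
  using extensionalityI[of \<sigma> L \<tau>] by (auto simp: mem_gal_Rats_iff)

lemma restrict_mem_gal: "hom_on L \<psi> \<Longrightarrow> restrict \<psi> L \<in> gal L \<rat>"
  by (simp add: mem_gal_Rats_iff hom_on_restrict[OF Galois_subfield])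

lemma gal_subset_Bij: "gal L \<rat> \<subseteq> Bij L"
  using hom_on_Galois_bij by (auto simp: mem_gal_Rats_iff Bij_def)

lemma carrier_gal_group [simp]: "carrier (gal_group L) = gal L \<rat>"
  by (simp add: gal_group_def)

lemma gal_mult: "\<sigma> \<in> gal L \<rat> \<Longrightarrow> \<tau> \<in> gal L \<rat> \<Longrightarrow> \<sigma> \<otimes>\<^bsub>gal_group L\<^esub> \<tau> = compose L \<sigma> \<tau>"
  using gal_subset_Bij by (auto simp: gal_group_def BijGroup_def subset_iff)

lemma gal_mult_apply:
  "\<sigma> \<in> gal L \<rat> \<Longrightarrow> \<tau> \<in> gal L \<rat> \<Longrightarrow> x \<in> L \<Longrightarrow> (\<sigma> \<otimes>\<^bsub>gal_group L\<^esub> \<tau>) x = \<sigma> (\<tau> x)"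
  by (simp add: gal_mult compose_def)

lemma gal_one: "\<one>\<^bsub>gal_group L\<^esub> = restrict (\<lambda>x. x) L"
  by (simp add: gal_group_def BijGroup_def)

lemma gal_compose_closed: "\<sigma> \<in> gal L \<rat> \<Longrightarrow> \<tau> \<in> gal L \<rat> \<Longrightarrow> compose L \<sigma> \<tau> \<in> gal L \<rat>"
  unfolding compose_def
  by (rule restrict_mem_gal, rule hom_on_comp[of L _ L]) (auto simp: mem_gal_Rats_iff hom_on_Galois_image)

lemma gal_m_closed: "\<sigma> \<in> gal L \<rat> \<Longrightarrow> \<tau> \<in> gal L \<rat> \<Longrightarrow> \<sigma> \<otimes>\<^bsub>gal_group L\<^esub> \<tau> \<in> gal L \<rat>"
  by (simp add: gal_mult gal_compose_closed)

lemma gal_inverse_exists: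
  assumes \<sigma>: "\<sigma> \<in> gal L \<rat>"
  shows "\<exists>\<tau>\<in>gal L \<rat>. \<tau> \<otimes>\<^bsub>gal_group L\<^esub> \<sigma> = \<one>\<^bsub>gal_group L\<^esub>"
proof -
  have hom: "hom_on L \<sigma>" using \<sigma> mem_gal_Rats_iff by blast
  have bij: "bij_betw \<sigma> L L" using hom by (rule hom_on_Galois_bij)
  define \<tau> where "\<tau> = inv_into L \<sigma>"
  have \<tau>: "\<tau> x \<in> L" "\<sigma> (\<tau> x) = x" "\<tau> (\<sigma> x) = x" if "x \<in> L" for x
    using that bij by (auto simp: \<tau>_def bij_betw_def inv_into_into f_inv_into_f)
  note cl = subfield_CC_closed[OF Galois_subfield]
  have "hom_on L \<tau>"
    unfolding hom_on_def
  proof (intro conjI ballI)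
    show "\<tau> 1 = 1" using \<tau>(3)[OF cl(2)] hom_on_one[OF hom] by simp
  next
    fix x y assume xy: "x \<in> L" "y \<in> L"
    then have "\<sigma> (\<tau> x + \<tau> y) = x + y" "\<sigma> (\<tau> x * \<tau> y) = x * y"
      using \<tau> hom_on_add[OF hom] hom_on_mult[OF hom] by auto
    then show "\<tau> (x + y) = \<tau> x + \<tau> y" "\<tau> (x * y) = \<tau> x * \<tau> y"
      using \<tau>(1)[OF xy(1)] \<tau>(1)[OF xy(2)] \<tau>(3) cl by metis+
  qed
  then have r: "restrict \<tau> L \<in> gal L \<rat>" by (rule restrict_mem_gal)
  moreover have "restrict \<tau> L \<otimes>\<^bsub>gal_group L\<^esub> \<sigma> = \<one>\<^bsub>gal_group L\<^esub>"
    using \<tau>(3) gal_closed[OF \<sigma>] by (auto simp: gal_mult[OF r \<sigma>] gal_one compose_def)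
  ultimately show ?thesis by blast
qed

lemma group_gal_group: "group (gal_group L)"
proof (rule groupI)
  show "\<one>\<^bsub>gal_group L\<^esub> \<in> carrier (gal_group L)"
    by (simp add: gal_one restrict_mem_gal hom_on_id)
  show "x \<otimes>\<^bsub>gal_group L\<^esub> y \<in> carrier (gal_group L)"
    if "x \<in> carrier (gal_group L)" "y \<in> carrier (gal_group L)" for x y
    using that by (simp add: gal_mult gal_compose_closed)
  show "x \<otimes>\<^bsub>gal_group L\<^esub> y \<otimes>\<^bsub>gal_group L\<^esub> z = x \<otimes>\<^bsub>gal_group L\<^esub> (y \<otimes>\<^bsub>gal_group L\<^esub> z)"
    if "x \<in> carrier (gal_group L)" "y \<in> carrier (gal_group L)" "z \<in> carrier (gal_group L)" for x y z
    using that by (intro gal_eqI) (simp_all add: gal_m_closed gal_mult_apply gal_closed)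
  show "\<one>\<^bsub>gal_group L\<^esub> \<otimes>\<^bsub>gal_group L\<^esub> x = x" if "x \<in> carrier (gal_group L)" for x
  proof -
    have "restrict (\<lambda>x. x) L \<in> gal L \<rat>" by (simp add: restrict_mem_gal hom_on_id)
    with that show ?thesis
      using gal_closed[of x]
      by (intro gal_eqI) (simp_all add: gal_one gal_m_closed gal_mult_apply)
  qed
  show "\<exists>y\<in>carrier (gal_group L). y \<otimes>\<^bsub>gal_group L\<^esub> x = \<one>\<^bsub>gal_group L\<^esub>"
    if "x \<in> carrier (gal_group L)" for x
    using that gal_inverse_exists by simp
qed

lemma gal_extends_hom:
  assumes "subfield F CC" "F \<subseteq> L" "hom_on F \<phi>"
  shows "\<exists>\<sigma>\<in>gal L \<rat>. \<forall>x\<in>F. \<sigma> x = \<phi> x"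
proof -
  obtain \<psi> where "hom_on L \<psi>" "\<forall>x\<in>F. \<psi> x = \<phi> x"
    using hom_on_extends_to_number_field[OF assms(1,3) Galois_number_field] by blast
  with assms(2) restrict_mem_gal[of \<psi>] show ?thesis by (intro bexI[of _ "restrict \<psi> L"]) auto
qed

text \<open>An automorphism is determined by its values on finitely many generators, and each generator has finitely many
conjugates.\<close>

lemma finite_gal: "finite (gal L \<rat>)"
proof -
  obtain Us where Us: "set Us \<subseteq> L" "\<And>M. subfield M CC \<Longrightarrow> set Us \<subseteq> M \<Longrightarrow> L \<subseteq> M"
    using number_field_generators[OF Galois_number_field] by blast
  have "\<forall>u\<in>set Us. \<exists>p :: rat poly. Factorial_Ring.irreducible p \<and> poly (map_poly of_rat p) u = 0"
    using irreducible_rat_poly_exists[OF number_field_algebraic[OF Galois_number_field]] Us(1)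
    by (metis subsetD)
  then obtain p :: "complex \<Rightarrow> rat poly" where
    p: "\<And>u. u \<in> set Us \<Longrightarrow> Factorial_Ring.irreducible (p u) \<and> poly (map_poly of_rat (p u)) u = 0"
    by metis
  let ?S = "\<lambda>u. {x :: complex. poly (map_poly of_rat (p u)) x = 0}"
  have "inj_on (\<lambda>\<sigma>. restrict \<sigma> (set Us)) (gal L \<rat>)"
  proof (rule inj_onI)
    fix \<sigma> \<tau> assume st: "\<sigma> \<in> gal L \<rat>" "\<tau> \<in> gal L \<rat>" "restrict \<sigma> (set Us) = restrict \<tau> (set Us)"
    then have "set Us \<subseteq> {x \<in> L. \<sigma> x = \<tau> x}"
      using Us(1) by (auto simp: restrict_def fun_eq_iff) (metis)
    then have "L \<subseteq> {x \<in> L. \<sigma> x = \<tau> x}"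
      using st by (intro Us(2) subfield_equalizer[OF Galois_subfield]) (auto simp: mem_gal_Rats_iff)
    with st show "\<sigma> = \<tau>" by (intro gal_eqI) auto
  qed
  moreover have "(\<lambda>\<sigma>. restrict \<sigma> (set Us)) ` gal L \<rat> \<subseteq> PiE (set Us) ?S"
  proof clarify
    fix \<sigma> assume "\<sigma> \<in> gal L \<rat>"
    then have "hom_on L \<sigma>" using mem_gal_Rats_iff by blast
    then have "\<sigma> u \<in> ?S u" if "u \<in> set Us" for u
      using that p[OF that] Us(1) hom_on_rat_poly[OF Galois_subfield _ subsetD[OF Us(1) that]]
        hom_on_zero[OF Galois_subfield] by simp
    then show "restrict \<sigma> (set Us) \<in> PiE (set Us) ?S" by simp
  qed
  moreover have "finite (PiE (set Us) ?S)"
    using p finite_roots_irreducible by (intro finite_PiE) auto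
  ultimately show ?thesis by (metis finite_subset finite_imageD)
qed

text \<open>Plays the role of a primitive element. The equalizers of pairs of distinct automorphisms are finitely many
proper rational subspaces of \<open>L\<close>, and these cannot cover \<open>L\<close>.\<close>

lemma gal_separating_element:
  "\<exists>\<theta>\<in>L. \<forall>\<sigma>\<in>gal L \<rat>. \<forall>\<tau>\<in>gal L \<rat>. \<sigma> \<theta> = \<tau> \<theta> \<longrightarrow> \<sigma> = \<tau>"
proof -
  have "\<exists>\<theta>\<in>L. \<forall>(\<sigma>, \<tau>)\<in>D. \<sigma> \<theta> \<noteq> \<tau> \<theta>"
    if "finite D" "D \<subseteq> {(\<sigma>, \<tau>). \<sigma> \<in> gal L \<rat> \<and> \<tau> \<in> gal L \<rat> \<and> \<sigma> \<noteq> \<tau>}" for D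
    using that
  proof (induction D rule: finite_induct)
    case empty
    then show ?case using subfield_CC_closed(1)[OF Galois_subfield] by blast
  next
    case (insert d D)
    then obtain \<theta> where \<theta>: "\<theta> \<in> L" "\<forall>(\<sigma>, \<tau>)\<in>D. \<sigma> \<theta> \<noteq> \<tau> \<theta>" by auto
    obtain \<alpha> \<beta> where d: "d = (\<alpha>, \<beta>)" "\<alpha> \<in> gal L \<rat>" "\<beta> \<in> gal L \<rat>" "\<alpha> \<noteq> \<beta>"
      using insert.prems by auto
    then obtain y where y: "y \<in> L" "\<alpha> y \<noteq> \<beta> y" using gal_eqI by blast
    have lin: "\<sigma> (\<theta> + of_nat n * y) = \<sigma> \<theta> + of_nat n * \<sigma> y" if "\<sigma> \<in> gal L \<rat>" for \<sigma> n
    proof -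
      have h: "hom_on L \<sigma>" using that mem_gal_Rats_iff by blast
      have n: "of_nat n \<in> L" using Rats_subset_subfield[OF Galois_subfield] by (meson Rats_of_nat subsetD)
      show ?thesis
        using \<theta>(1) y(1) n hom_on_Rats[OF Galois_subfield h, of "of_nat n"]
        by (simp add: hom_on_add[OF h] hom_on_mult[OF h] subfield_CC_closed[OF Galois_subfield])
    qed
    \<comment> \<open>Every pair of automorphisms spoils at most one translate of \<open>\<theta>\<close> along \<open>y\<close>.\<close>
    let ?bad = "\<lambda>(\<sigma>, \<tau>). {n. \<sigma> (\<theta> + of_nat n * y) = \<tau> (\<theta> + of_nat n * y)}"
    have "finite (?bad e)" if eD: "e \<in> insert d D" for e
    proof -
      obtain \<sigma> \<tau> where e: "e = (\<sigma>, \<tau>)" "\<sigma> \<in> gal L \<rat>" "\<tau> \<in> gal L \<rat>"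
        using subsetD[OF insert.prems eD] by blast
      have ne: "\<sigma> \<theta> \<noteq> \<tau> \<theta> \<or> \<sigma> y \<noteq> \<tau> y"
        using eD \<theta>(2) y(2) d(1) e(1) by auto
      have "n = m" if "n \<in> ?bad e" "m \<in> ?bad e" for n m
      proof -
        have nm: "\<sigma> \<theta> + of_nat n * \<sigma> y = \<tau> \<theta> + of_nat n * \<tau> y"
             "\<sigma> \<theta> + of_nat m * \<sigma> y = \<tau> \<theta> + of_nat m * \<tau> y"
          using that e lin by auto
        have "(of_nat n - of_nat m) * (\<sigma> y - \<tau> y) =
            (\<sigma> \<theta> + of_nat n * \<sigma> y - (\<tau> \<theta> + of_nat n * \<tau> y)) -
            (\<sigma> \<theta> + of_nat m * \<sigma> y - (\<tau> \<theta> + of_nat m * \<tau> y))"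
          by (simp add: algebra_simps)
        then have "(of_nat n - of_nat m) * (\<sigma> y - \<tau> y) = 0"
          using nm by simp
        moreover have "\<sigma> y \<noteq> \<tau> y" using ne nm by auto
        ultimately show ?thesis by simp
      qed
      then show ?thesis by (rule finite_at_most_one)
    qed
    then have "finite (\<Union>e\<in>insert d D. ?bad e)" using insert.hyps by blast
    from ex_new_if_finite[OF infinite_UNIV_nat this]
    obtain n where n: "n \<notin> (\<Union>e\<in>insert d D. ?bad e)" ..
    have "of_nat n \<in> L" using Rats_subset_subfield[OF Galois_subfield] by (meson Rats_of_nat subsetD)
    then have "\<theta> + of_nat n * y \<in> L"
      using \<theta>(1) y(1) by (simp add: subfield_CC_closed[OF Galois_subfield])
    with n show ?case by (intro bexI[of _ "\<theta> + of_nat n * y"]) auto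
  qed
  from this[of "{(\<sigma>, \<tau>). \<sigma> \<in> gal L \<rat> \<and> \<tau> \<in> gal L \<rat> \<and> \<sigma> \<noteq> \<tau>}"]
  have "\<exists>\<theta>\<in>L. \<forall>(\<sigma>, \<tau>)\<in>{(\<sigma>, \<tau>). \<sigma> \<in> gal L \<rat> \<and> \<tau> \<in> gal L \<rat> \<and> \<sigma> \<noteq> \<tau>}. \<sigma> \<theta> \<noteq> \<tau> \<theta>"
    using finite_subset[of _ "gal L \<rat> \<times> gal L \<rat>"] finite_gal by (auto simp: subset_iff)
  then show ?thesis by blast
qed

lemma map_poly_hom_prod_linear:
  assumes \<sigma>: "hom_on L \<sigma>" and "finite A" "\<And>a. a \<in> A \<Longrightarrow> f a \<in> L"
  shows "(\<Prod>a\<in>A. [:- f a, 1:]) \<in> polys_over L \<and>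
    map_poly \<sigma> (\<Prod>a\<in>A. [:- f a, 1:]) = (\<Prod>a\<in>A. [:- \<sigma> (f a), 1:])"
  using assms(2,3)
proof (induction A rule: finite_induct)
  case empty
  then show ?case
    using polys_over_closed(2)[OF Galois_subfield] hom_on_one[OF \<sigma>] by simp
next
  case (insert a A)
  note cl = polys_over_closed[OF Galois_subfield] and cl' = subfield_CC_closed[OF Galois_subfield]
  have l: "[:- f a, 1:] \<in> polys_over L"
    using insert.prems by (intro cl cl') auto
  have "map_poly \<sigma> [:- f a, 1:] = [:- \<sigma> (f a), 1:]"
    using insert.prems
    by (simp add: map_poly_hom_pCons[OF Galois_subfield \<sigma>] hom_on_one[OF \<sigma>] hom_on_minus[OF Galois_subfield \<sigma>])
  with l insert show ?case
    by (simp add: cl map_poly_hom_mult[OF Galois_subfield \<sigma>] del: mult_pCons_left)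
qed

text \<open>Artin's half of the Galois correspondence. The conjugates of a separating element are distinct, so an
automorphism that permutes its \<open>A\<close>-orbit already belongs to \<open>A\<close>.\<close>

theorem gal_fixed_field:
  assumes A: "subgroup A (gal_group L)"
  shows "gal L (fixed_field L A) = A"
proof
  have AG: "A \<subseteq> gal L \<rat>" using subgroup.subset[OF A] by simp
  then show "A \<subseteq> gal L (fixed_field L A)"
    unfolding gal_eq[of "fixed_field L A"] by (auto simp: fixed_field_def)
  show "gal L (fixed_field L A) \<subseteq> A"
  proof
    fix \<sigma> assume \<sigma>: "\<sigma> \<in> gal L (fixed_field L A)"
    then have \<sigma>G: "\<sigma> \<in> gal L \<rat>" using gal_eq by blast
    obtain \<theta> where \<theta>: "\<theta> \<in> L" "\<And>\<sigma> \<tau>. \<sigma> \<in> gal L \<rat> \<Longrightarrow> \<tau> \<in> gal L \<rat> \<Longrightarrow> \<sigma> \<theta> = \<tau> \<theta> \<Longrightarrow> \<sigma> = \<tau>"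
      using gal_separating_element by blast
    \<comment> \<open>The orbit polynomial of \<open>\<theta>\<close> under \<open>A\<close> has coefficients in the fixed field, so \<open>\<sigma>\<close> permutes its roots.\<close>
    define p where "p = (\<Prod>\<tau>\<in>A. [:- \<tau> \<theta>, 1:])"
    have finA: "finite A" using finite_gal AG finite_subset by blast
    have \<theta>L: "\<tau> \<theta> \<in> L" if "\<tau> \<in> A" for \<tau> using that AG gal_closed \<theta>(1) by blast
    have hom: "hom_on L \<rho>" if "\<rho> \<in> A" for \<rho>
      using that AG mem_gal_Rats_iff by blast
    have inv: "map_poly \<rho> p = p" if \<rho>: "\<rho> \<in> A" for \<rho>
    proof -
      have "map_poly \<rho> p = (\<Prod>\<tau>\<in>A. [:- \<rho> (\<tau> \<theta>), 1:])"
        unfolding p_def using map_poly_hom_prod_linear[OF hom[OF \<rho>] finA, of "\<lambda>\<tau>. \<tau> \<theta>"] \<theta>L by simp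
      also have "\<dots> = (\<Prod>\<tau>\<in>A. [:- (\<rho> \<otimes>\<^bsub>gal_group L\<^esub> \<tau>) \<theta>, 1:])"
        using \<rho> AG \<theta>(1) by (intro prod.cong) (auto simp: gal_mult_apply subset_iff)
      also have "\<dots> = (\<Prod>\<tau>\<in>(\<lambda>\<tau>. \<rho> \<otimes>\<^bsub>gal_group L\<^esub> \<tau>) ` A. [:- \<tau> \<theta>, 1:])"
      proof (subst prod.reindex)
        show "inj_on (\<lambda>\<tau>. \<rho> \<otimes>\<^bsub>gal_group L\<^esub> \<tau>) A"
          using group.inj_on_cmult[OF group_gal_group, of \<rho>] \<rho> AG by (auto intro: inj_on_subset)
      qed simp
      also have "(\<lambda>\<tau>. \<rho> \<otimes>\<^bsub>gal_group L\<^esub> \<tau>) ` A = A"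
      proof (rule endo_inj_surj[OF finA])
        show "inj_on (\<lambda>\<tau>. \<rho> \<otimes>\<^bsub>gal_group L\<^esub> \<tau>) A"
          using group.inj_on_cmult[OF group_gal_group, of \<rho>] \<rho> AG by (auto intro: inj_on_subset)
        show "(\<lambda>\<tau>. \<rho> \<otimes>\<^bsub>gal_group L\<^esub> \<tau>) ` A \<subseteq> A"
          using subgroup.m_closed[OF A \<rho>] by blast
      qed
      finally show ?thesis by (simp add: p_def)
    qed
    have oneA: "\<one>\<^bsub>gal_group L\<^esub> \<in> A" using subgroup.one_closed[OF A] .
    have pL: "p \<in> polys_over L"
      unfolding p_def using map_poly_hom_prod_linear[OF hom[OF oneA] finA, of "\<lambda>\<tau>. \<tau> \<theta>"] \<theta>L by simp
    have "coeff p i \<in> fixed_field L A" for i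
      unfolding fixed_field_def
    proof (intro CollectI conjI ballI)
      show "coeff p i \<in> L" using pL by (rule polys_over_coeff)
      fix \<rho> assume \<rho>: "\<rho> \<in> A"
      from coeff_map_hom[OF Galois_subfield hom[OF \<rho>], of p i] inv[OF \<rho>]
      show "\<rho> (coeff p i) = coeff p i" by simp
    qed
    then have "map_poly \<sigma> p = p"
      using \<sigma> \<sigma>G by (intro poly_eqI)
        (auto simp: coeff_map_hom[OF Galois_subfield] mem_gal_iff)
    then have "poly p (\<sigma> \<theta>) = \<sigma> (poly p \<theta>)"
      using poly_map_hom[OF Galois_subfield _ pL \<theta>(1), of \<sigma>] \<sigma>G mem_gal_Rats_iff by simp
    also have "poly p \<theta> = 0"
      unfolding p_def poly_prod using finA oneA \<theta>(1)
      by (intro prod_zero) (auto simp: gal_one intro!: bexI[of _ "\<one>\<^bsub>gal_group L\<^esub>"])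
    also have "\<sigma> 0 = 0"
      using \<sigma>G mem_gal_Rats_iff hom_on_zero[OF Galois_subfield] by blast
    finally have "(\<Prod>\<tau>\<in>A. \<sigma> \<theta> - \<tau> \<theta>) = 0"
      by (simp add: p_def poly_prod)
    then obtain \<tau> where "\<tau> \<in> A" "\<sigma> \<theta> = \<tau> \<theta>" using finA by auto
    with \<theta>(2)[OF \<sigma>G, of \<tau>] AG show "\<sigma> \<in> A" by auto
  qed
qed

end

section \<open>Sums over orbit representatives\<close>

context group
begin

text \<open>The fibres of \<open>x \<mapsto> a x p\<close> over the orbit are cosets of the stabiliser.\<close>

lemma sum_over_orbit:
  fixes f :: "'p \<Rightarrow> complex"
  assumes fin: "finite (carrier G)"
    and one: "\<And>p. p \<in> P \<Longrightarrow> a \<one> p = p"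
    and mult: "\<And>g h p. g \<in> carrier G \<Longrightarrow> h \<in> carrier G \<Longrightarrow> p \<in> P \<Longrightarrow> a (g \<otimes> h) p = a g (a h p)"
    and p: "p \<in> P"
  shows "(\<Sum>x\<in>carrier G. f (a x p)) = of_nat (card (stabilizer G a p)) * (\<Sum>q\<in>orbit G a p. f q)"
proof -
  have orb: "orbit G a p = (\<lambda>x. a x p) ` carrier G"
    by (auto simp: orbit_def)
  have fiber: "card {x \<in> carrier G. a x p = q} = card (stabilizer G a p)" if q: "q \<in> orbit G a p" for q
  proof -
    obtain y where y: "y \<in> carrier G" "q = a y p" using q unfolding orb by blast
    have "bij_betw (\<lambda>x. y \<otimes> x) (stabilizer G a p) {x \<in> carrier G. a x p = q}"
    proof (rule bij_betw_byWitness[where f' = "\<lambda>x. inv y \<otimes> x"])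
      show "\<forall>x\<in>stabilizer G a p. inv y \<otimes> (y \<otimes> x) = x"
        using y by (auto simp: stabilizer_def m_assoc[symmetric])
      show "\<forall>x\<in>{x \<in> carrier G. a x p = q}. y \<otimes> (inv y \<otimes> x) = x"
        using y by (auto simp: m_assoc[symmetric])
      show "(\<lambda>x. y \<otimes> x) ` stabilizer G a p \<subseteq> {x \<in> carrier G. a x p = q}"
        using y p mult by (auto simp: stabilizer_def)
      show "(\<lambda>x. inv y \<otimes> x) ` {x \<in> carrier G. a x p = q} \<subseteq> stabilizer G a p"
      proof clarify
        fix x assume x: "x \<in> carrier G" "q = a x p"
        have "a (inv y \<otimes> x) p = a (inv y \<otimes> y) p"
          using x y p mult by (metis inv_closed)
        with x y p one show "inv y \<otimes> x \<in> stabilizer G a p"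
          by (simp add: stabilizer_def)
      qed
    qed
    from bij_betw_same_card[OF this] show ?thesis by simp
  qed
  have "(\<Sum>x\<in>carrier G. f (a x p)) = (\<Sum>q\<in>orbit G a p. \<Sum>x | x \<in> carrier G \<and> a x p = q. f (a x p))"
    unfolding orb by (rule sum.image_gen[OF fin])
  also have "\<dots> = (\<Sum>q\<in>orbit G a p. of_nat (card (stabilizer G a p)) * f q)"
  proof (rule sum.cong[OF refl])
    fix q assume q: "q \<in> orbit G a p"
    have "(\<Sum>x | x \<in> carrier G \<and> a x p = q. f (a x p)) = (\<Sum>x\<in>{x \<in> carrier G. a x p = q}. f q)"
      by (rule sum.cong) auto
    then show "(\<Sum>x | x \<in> carrier G \<and> a x p = q. f (a x p)) = of_nat (card (stabilizer G a p)) * f q"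
      using fiber[OF q] by simp
  qed
  finally show ?thesis by (simp add: sum_distrib_left)
qed

lemma sum_over_orbit_representatives:
  fixes f :: "'p \<Rightarrow> complex"
  assumes finP: "finite P" and closed: "\<And>g p. g \<in> carrier G \<Longrightarrow> p \<in> P \<Longrightarrow> a g p \<in> P"
    and one: "\<And>p. p \<in> P \<Longrightarrow> a \<one> p = p"
    and mult: "\<And>g h p. g \<in> carrier G \<Longrightarrow> h \<in> carrier G \<Longrightarrow> p \<in> P \<Longrightarrow> a (g \<otimes> h) p = a g (a h p)"
    and R: "system_of_reps R (orbits G P a)"
  shows "(\<Sum>p\<in>R. \<Sum>q\<in>orbit G a p. f q) = (\<Sum>p\<in>P. f p)" "R \<subseteq> P"
proof -
  have self: "p \<in> orbit G a p" if "p \<in> P" for p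
    using one[OF that] unfolding orbit_def by (metis (mono_tags, lifting) mem_Collect_eq one_closed)
  have sub: "orbit G a p \<subseteq> P" if "p \<in> P" for p
    using closed that by (auto simp: orbit_def)
  have le: "orbit G a q \<subseteq> orbit G a p" if p: "p \<in> P" and q: "q \<in> orbit G a p" for p q
  proof
    fix z assume "z \<in> orbit G a q"
    then obtain h where h: "h \<in> carrier G" "z = a h q" by (auto simp: orbit_def)
    obtain g where g: "g \<in> carrier G" "q = a g p" using q by (auto simp: orbit_def)
    from g h p mult[of h g p] show "z \<in> orbit G a p"
      unfolding orbit_def by (metis (mono_tags, lifting) m_closed mem_Collect_eq)
  qed
  have sym: "p \<in> orbit G a q" if p: "p \<in> P" and q: "q \<in> orbit G a p" for p q
  proof -
    obtain g where g: "g \<in> carrier G" "q = a g p" using q by (auto simp: orbit_def)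
    then have "a (inv g) q = p"
      using mult[of "inv g" g p] one[OF p] p by simp
    with g show ?thesis unfolding orbit_def by (metis (mono_tags, lifting) inv_closed mem_Collect_eq)
  qed
  have eq: "orbit G a q = orbit G a p" if "p \<in> P" "q \<in> orbit G a p" for p q
    using le[OF that] le[OF subsetD[OF sub[OF that(1)] that(2)] sym[OF that]] by blast
  show RP: "R \<subseteq> P"
    using R sub by (auto simp: system_of_reps_def orbits_def) (blast)
  have reps: "\<exists>!x. x \<in> R \<inter> orbit G a p" if "p \<in> P" for p
    using R that by (auto simp: system_of_reps_def orbits_def)
  have "(\<Sum>p\<in>(\<Union>r\<in>R. orbit G a r). f p) = (\<Sum>p\<in>R. \<Sum>q\<in>orbit G a p. f q)"
  proof (rule sum.UNION_disjoint)
    show "finite R" using RP finP finite_subset by blast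
    show "\<forall>r\<in>R. finite (orbit G a r)" using RP sub finP finite_subset by (meson subsetD)
    show "\<forall>r\<in>R. \<forall>s\<in>R. r \<noteq> s \<longrightarrow> orbit G a r \<inter> orbit G a s = {}"
    proof (intro ballI impI, rule ccontr)
      fix r s assume rs: "r \<in> R" "s \<in> R" "r \<noteq> s" "orbit G a r \<inter> orbit G a s \<noteq> {}"
      then obtain z where "z \<in> orbit G a r" "z \<in> orbit G a s" by blast
      then have "orbit G a r = orbit G a s" using eq rs RP by (metis subsetD)
      with rs RP self reps show False by (metis IntI subsetD)
    qed
  qed
  also have "(\<Union>r\<in>R. orbit G a r) = P"
  proof
    show "(\<Union>r\<in>R. orbit G a r) \<subseteq> P" using RP sub by blast
    show "P \<subseteq> (\<Union>r\<in>R. orbit G a r)"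
    proof
      fix p assume p: "p \<in> P"
      then obtain r where "r \<in> R" "r \<in> orbit G a p" using reps by blast
      with sym[OF p] show "p \<in> (\<Union>r\<in>R. orbit G a r)" by blast
    qed
  qed
  finally show "(\<Sum>p\<in>R. \<Sum>q\<in>orbit G a p. f q) = (\<Sum>p\<in>P. f p)" by simp
qed

text \<open>The formula for an induced class function averages over conjugates of \<open>g\<close>. If the weights are equivariant,
conjugating \<open>g\<close> amounts to moving the point \<open>p\<close>, and the average over \<open>G\<close> becomes a sum over the orbit of \<open>p\<close>.\<close>

lemma sum_induced_over_orbit_representatives:
  fixes w :: "'p \<Rightarrow> 'a \<Rightarrow> complex"
  assumes fin: "finite (carrier G)" and finP: "finite P"
    and closed: "\<And>g p. g \<in> carrier G \<Longrightarrow> p \<in> P \<Longrightarrow> a g p \<in> P"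
    and one: "\<And>p. p \<in> P \<Longrightarrow> a \<one> p = p"
    and mult: "\<And>g h p. g \<in> carrier G \<Longrightarrow> h \<in> carrier G \<Longrightarrow> p \<in> P \<Longrightarrow> a (g \<otimes> h) p = a g (a h p)"
    and R: "system_of_reps R (orbits G P a)"
    and w: "\<And>x p. x \<in> carrier G \<Longrightarrow> p \<in> P \<Longrightarrow> w p (inv x \<otimes> g \<otimes> x) = w (a x p) g"
  shows "(\<Sum>p\<in>R. (\<Sum>x\<in>carrier G. w p (inv x \<otimes> g \<otimes> x)) / of_nat (card (stabilizer G a p))) =
    (\<Sum>p\<in>P. w p g)"
proof -
  note RP = sum_over_orbit_representatives(2)[OF finP closed one mult R]
  have "(\<Sum>x\<in>carrier G. w p (inv x \<otimes> g \<otimes> x)) / of_nat (card (stabilizer G a p)) =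
      (\<Sum>q\<in>orbit G a p. w q g)" if "p \<in> R" for p
  proof -
    have p: "p \<in> P" using that RP by blast
    have "\<one> \<in> stabilizer G a p" using one[OF p] by (simp add: stabilizer_def)
    moreover have "finite (stabilizer G a p)" using fin by (auto simp: stabilizer_def)
    ultimately have "card (stabilizer G a p) \<noteq> 0" by auto
    moreover have "(\<Sum>x\<in>carrier G. w p (inv x \<otimes> g \<otimes> x)) = (\<Sum>x\<in>carrier G. w (a x p) g)"
      using w p by (intro sum.cong) auto
    ultimately show ?thesis
      using sum_over_orbit[OF fin one mult p, of "\<lambda>q. w q g"] by simp
  qed
  then show ?thesis
    using sum_over_orbit_representatives(1)[OF finP closed one mult R, of "\<lambda>q. w q g"] by simp
qed

end

section \<open>Counting fixed points by Fourier inversion\<close>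

lemma sum_Pow_prod:
  fixes h :: "'x \<Rightarrow> complex"
  shows "finite Y \<Longrightarrow> (\<Sum>f\<in>Pow Y. \<Prod>x\<in>f. h x) = (\<Prod>x\<in>Y. 1 + h x)"
  using prod_add[of Y h "\<lambda>_. 1"] by (simp add: add.commute)

text \<open>Orthogonality of the characters of \<open>(\<int>/2)\<^sup>Y\<close>. In terms of \<open>h\<close> the sum over \<open>f\<close> factors over the points of \<open>Y\<close>, and a point in
exactly one of \<open>I\<close> and \<open>J\<close> contributes the factor 0.\<close>

lemma sum_Pow_signs:
  fixes Y :: "'x set"
  assumes "finite Y" "I \<subseteq> Y" "J \<subseteq> Y"
  shows "(\<Sum>f\<in>Pow Y. (\<Prod>x\<in>I. if x \<in> f then -1 else 1) * (\<Prod>x\<in>J. if x \<in> f then -1 else 1)) =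
    (if I = J then 2 ^ card Y else (0 :: complex))"
proof -
  define h :: "'x \<Rightarrow> complex" where
    "h = (\<lambda>x. (if x \<in> I then -1 else 1) * (if x \<in> J then -1 else 1))"
  \<comment> \<open>Both products are \<open>(-1) ^ card (A \<inter> f)\<close>.\<close>
  have swap: "(\<Prod>x\<in>A. if x \<in> f then -1 else 1 :: complex) = (\<Prod>x\<in>f. if x \<in> A then -1 else 1)"
    if "finite A" "finite f" for A f :: "'x set"
    using that by (simp add: prod.If_cases Int_commute)
  have "(\<Sum>f\<in>Pow Y. (\<Prod>x\<in>I. if x \<in> f then -1 else 1) * (\<Prod>x\<in>J. if x \<in> f then -1 else 1 :: complex)) =
      (\<Sum>f\<in>Pow Y. \<Prod>x\<in>f. h x)"
  proof (rule sum.cong[OF refl])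
    fix f assume "f \<in> Pow Y"
    then have "finite f" "finite I" "finite J" using assms finite_subset by blast+
    then show "(\<Prod>x\<in>I. if x \<in> f then -1 else 1) * (\<Prod>x\<in>J. if x \<in> f then -1 else 1 :: complex) = (\<Prod>x\<in>f. h x)"
      by (simp only: swap h_def prod.distrib)
  qed
  also have "\<dots> = (\<Prod>x\<in>Y. 1 + h x)"
    by (rule sum_Pow_prod[OF assms(1)])
  also have "\<dots> = (if I = J then 2 ^ card Y else 0)"
  proof (cases "I = J")
    case True
    then have "1 + h x = 2" for x by (simp add: h_def)
    with True show ?thesis by simp
  next
    case False
    then obtain x where "x \<in> Y" "(x \<in> I) \<noteq> (x \<in> J)" using assms by blast
    then have "x \<in> Y" "1 + h x = 0" by (auto simp: h_def)
    with assms(1) False show ?thesis by (auto intro: prod_zero)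
  qed
  finally show ?thesis .
qed

text \<open>The left-hand side counts the vectors \<open>f\<close> in \<open>(\<int>/2)\<^sup>Y\<close> with \<open>f = f \<circ> \<pi> + r\<close>. Writing the indicator of this condition
as a product over \<open>Y\<close> and expanding it gives a sum over \<open>I\<close> of the inner products of the characters of \<open>I\<close>
and \<open>\<pi> ` I\<close>, and by orthogonality only the sets with \<open>\<pi> ` I = I\<close> survive.\<close>

lemma card_twisted_invariant_subsets:
  fixes r :: "'x \<Rightarrow> nat"
  assumes Y: "finite Y" and \<pi>: "bij_betw \<pi> Y Y"
  shows "of_nat (card {f \<in> Pow Y. \<forall>x\<in>Y. x \<in> f \<longleftrightarrow> (\<pi> x \<in> f \<longleftrightarrow> even (r x))}) =
    (\<Sum>I | I \<in> Pow Y \<and> \<pi> ` I = I. (-1 :: complex) ^ (\<Sum>x\<in>I. r x))"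
proof -
  \<comment> \<open>\<open>s f x\<close> is the sign of the \<open>x\<close>-coordinate of \<open>f\<close>, and \<open>t f x\<close> is 1 or -1 according to whether \<open>f\<close>
    satisfies the condition at \<open>x\<close>; hence \<open>(1 + t f x) / 2\<close> is its indicator.\<close>
  define s :: "'x set \<Rightarrow> 'x \<Rightarrow> complex" where "s = (\<lambda>f x. if x \<in> f then -1 else 1)"
  define t where "t = (\<lambda>f x. s f x * s f (\<pi> x) * (-1) ^ r x)"
  have "(\<Prod>x\<in>Y. 1 + t f x) =
      (if \<forall>x\<in>Y. x \<in> f \<longleftrightarrow> (\<pi> x \<in> f \<longleftrightarrow> even (r x)) then 2 ^ card Y else 0)" for f
  proof -
    have *: "1 + t f x = (if x \<in> f \<longleftrightarrow> (\<pi> x \<in> f \<longleftrightarrow> even (r x)) then 2 else 0)" for x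
      by (auto simp: t_def s_def)
    show ?thesis
      unfolding * using Y by (auto intro: prod_zero)
  qed
  then have "of_nat (card {f \<in> Pow Y. \<forall>x\<in>Y. x \<in> f \<longleftrightarrow> (\<pi> x \<in> f \<longleftrightarrow> even (r x))}) * 2 ^ card Y =
      (\<Sum>f\<in>Pow Y. \<Prod>x\<in>Y. 1 + t f x)"
    using Y by (simp add: sum.If_cases Int_def)
  also have "\<dots> = (\<Sum>f\<in>Pow Y. \<Sum>I\<in>Pow Y. \<Prod>x\<in>I. t f x)"
    by (simp add: sum_Pow_prod[OF Y])
  also have "\<dots> = (\<Sum>I\<in>Pow Y. \<Sum>f\<in>Pow Y. \<Prod>x\<in>I. t f x)"
    by (rule sum.swap)
  also have "\<dots> = (\<Sum>I\<in>Pow Y. if \<pi> ` I = I then 2 ^ card Y * (-1) ^ (\<Sum>x\<in>I. r x) else 0)"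
  proof (rule sum.cong[OF refl])
    fix I assume "I \<in> Pow Y"
    then have I: "I \<subseteq> Y" "\<pi> ` I \<subseteq> Y" "inj_on \<pi> I"
      using \<pi> by (auto simp: bij_betw_def intro: inj_on_subset)
    have "(\<Sum>f\<in>Pow Y. \<Prod>x\<in>I. t f x) =
        (\<Sum>f\<in>Pow Y. (\<Prod>x\<in>I. s f x) * (\<Prod>x\<in>\<pi> ` I. s f x)) * (-1) ^ (\<Sum>x\<in>I. r x)"
      by (simp add: t_def prod.distrib prod.reindex[OF I(3)] power_sum sum_distrib_right)
    also have "\<dots> = (if I = \<pi> ` I then 2 ^ card Y else 0) * (-1) ^ (\<Sum>x\<in>I. r x)"
      using sum_Pow_signs[OF Y I(1,2)] by (simp add: s_def)
    finally show "(\<Sum>f\<in>Pow Y. \<Prod>x\<in>I. t f x) =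
        (if \<pi> ` I = I then 2 ^ card Y * (-1) ^ (\<Sum>x\<in>I. r x) else 0)"
      by auto
  qed
  also have "\<dots> = (\<Sum>I | I \<in> Pow Y \<and> \<pi> ` I = I. (-1) ^ (\<Sum>x\<in>I. r x)) * 2 ^ card Y"
    using Y by (simp add: sum.inter_filter[symmetric] sum_distrib_left mult.commute)
  finally show ?thesis by simp
qed

section \<open>Half-systems of a set with a free central involution\<close>

text \<open>The combinatorial content of complex multiplication: \<open>E\<close> stands for the embeddings, \<open>c\<close> for complex conjugation, and
\<open>q\<close> for the passage from an embedding to its coset of \<open>H\<^sub>0\<close>, that is, to the quotient of \<open>E\<close> by conjugation.\<close>

locale half_system_action = group G for G (structure) +
  fixes E :: "'e set" and act :: "'a \<Rightarrow> 'e \<Rightarrow> 'e" and c :: 'a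
    and q :: "'e \<Rightarrow> 'x" and actq :: "'a \<Rightarrow> 'x \<Rightarrow> 'x"
  assumes finite_group: "finite (carrier G)" and finite_E: "finite E" and E_nonempty: "E \<noteq> {}"
    and act_closed: "g \<in> carrier G \<Longrightarrow> e \<in> E \<Longrightarrow> act g e \<in> E"
    and act_one: "e \<in> E \<Longrightarrow> act \<one> e = e"
    and act_mult: "g \<in> carrier G \<Longrightarrow> h \<in> carrier G \<Longrightarrow> e \<in> E \<Longrightarrow> act (g \<otimes> h) e = act g (act h e)"
    and c_closed: "c \<in> carrier G" and c_involution: "c \<otimes> c = \<one>"
    and c_central: "g \<in> carrier G \<Longrightarrow> c \<otimes> g = g \<otimes> c"
    and c_free: "e \<in> E \<Longrightarrow> act c e \<noteq> e"
    and q_eq_iff: "e \<in> E \<Longrightarrow> e' \<in> E \<Longrightarrow> q e = q e' \<longleftrightarrow> e' = e \<or> e' = act c e"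
    and q_act: "g \<in> carrier G \<Longrightarrow> e \<in> E \<Longrightarrow> q (act g e) = actq g (q e)"
begin

text \<open>CM-types, in this abstract setting.\<close>

definition half_systems :: "'e set set" where
  "half_systems = {\<Phi>. \<Phi> \<inter> act c ` \<Phi> = {} \<and> \<Phi> \<union> act c ` \<Phi> = E}"

definition odd_sets :: "'x set set" where
  "odd_sets = {I. I \<subseteq> q ` E \<and> odd (card I)}"

lemma act_inv: "g \<in> carrier G \<Longrightarrow> e \<in> E \<Longrightarrow> act (inv g) (act g e) = e"
  and act_inv': "g \<in> carrier G \<Longrightarrow> e \<in> E \<Longrightarrow> act g (act (inv g) e) = e"
  by (simp_all add: act_mult[symmetric] act_one)

lemma inv_c: "inv c = c"
  by (rule inv_equality[OF c_involution c_closed c_closed])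

lemma act_c_commute: "g \<in> carrier G \<Longrightarrow> e \<in> E \<Longrightarrow> act g (act c e) = act c (act g e)"
  by (simp add: act_mult[symmetric] c_closed c_central)

lemma mem_image_act_iff:
  assumes "g \<in> carrier G" "\<Phi> \<subseteq> E" "e \<in> E"
  shows "e \<in> act g ` \<Phi> \<longleftrightarrow> act (inv g) e \<in> \<Phi>"
proof
  assume "e \<in> act g ` \<Phi>"
  then obtain e' where "e' \<in> \<Phi>" "e = act g e'" by blast
  with assms act_inv[of g e'] show "act (inv g) e \<in> \<Phi>" by auto
next
  assume "act (inv g) e \<in> \<Phi>"
  then show "e \<in> act g ` \<Phi>" using act_inv'[OF assms(1,3)] by (intro image_eqI[of _ _ "act (inv g) e"]) auto
qed

lemma image_act_mult:
  "g \<in> carrier G \<Longrightarrow> h \<in> carrier G \<Longrightarrow> \<Phi> \<subseteq> E \<Longrightarrow> act (g \<otimes> h) ` \<Phi> = act g ` act h ` \<Phi>"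
  using act_mult[of g h] by (force simp: image_iff subset_iff)

lemma image_act_one: "\<Phi> \<subseteq> E \<Longrightarrow> act \<one> ` \<Phi> = \<Phi>"
  by (auto simp: act_one subset_iff image_iff)

lemma image_act_subset: "g \<in> carrier G \<Longrightarrow> \<Phi> \<subseteq> E \<Longrightarrow> act g ` \<Phi> \<subseteq> E"
  using act_closed by auto

lemma half_systems_iff:
  "\<Phi> \<in> half_systems \<longleftrightarrow> \<Phi> \<subseteq> E \<and> (\<forall>e\<in>E. act c e \<in> \<Phi> \<longleftrightarrow> e \<notin> \<Phi>)"
proof (cases "\<Phi> \<subseteq> E")
  case True
  then have "e \<in> act c ` \<Phi> \<longleftrightarrow> act c e \<in> \<Phi>" if "e \<in> E" for e
    using mem_image_act_iff[OF c_closed True that] by (simp add: inv_c)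
  moreover have "act c ` \<Phi> \<subseteq> E" using image_act_subset[OF c_closed True] .
  ultimately show ?thesis
    using True unfolding half_systems_def by blast
qed (auto simp: half_systems_def)

lemma half_systems_subset: "\<Phi> \<in> half_systems \<Longrightarrow> \<Phi> \<subseteq> E"
  by (simp add: half_systems_iff)

lemma half_systems_c: "\<Phi> \<in> half_systems \<Longrightarrow> e \<in> E \<Longrightarrow> act c e \<in> \<Phi> \<longleftrightarrow> e \<notin> \<Phi>"
  by (simp add: half_systems_iff)

lemma act_half_systems: "g \<in> carrier G \<Longrightarrow> \<Phi> \<in> half_systems \<Longrightarrow> act g ` \<Phi> \<in> half_systems"
  unfolding half_systems_iff
  by (auto simp: mem_image_act_iff act_closed c_closed act_c_commute image_act_subset image_subset_iff subset_iff)

lemma finite_half_systems: "finite half_systems"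
  using finite_subset[of half_systems "Pow E"] half_systems_subset finite_E by auto

lemma c_moves_half_system: "\<Phi> \<in> half_systems \<Longrightarrow> act c ` \<Phi> \<noteq> \<Phi>"
  using E_nonempty by (auto simp: half_systems_def)

lemma actq_closed: "g \<in> carrier G \<Longrightarrow> x \<in> q ` E \<Longrightarrow> actq g x \<in> q ` E"
  by (auto simp: q_act[symmetric] act_closed)

lemma actq_one: "x \<in> q ` E \<Longrightarrow> actq \<one> x = x"
  using q_act[OF one_closed] act_one by force

lemma actq_mult:
  "g \<in> carrier G \<Longrightarrow> h \<in> carrier G \<Longrightarrow> x \<in> q ` E \<Longrightarrow> actq (g \<otimes> h) x = actq g (actq h x)"
  by (auto simp: q_act[symmetric] act_closed act_mult)

lemma actq_inv: "g \<in> carrier G \<Longrightarrow> x \<in> q ` E \<Longrightarrow> actq (inv g) (actq g x) = x"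
  and actq_inv': "g \<in> carrier G \<Longrightarrow> x \<in> q ` E \<Longrightarrow> actq g (actq (inv g) x) = x"
  by (simp_all add: actq_mult[symmetric] actq_one)

lemma inj_on_actq: "g \<in> carrier G \<Longrightarrow> inj_on (actq g) (q ` E)"
  by (rule inj_on_inverseI) (rule actq_inv)

lemma bij_betw_actq: "g \<in> carrier G \<Longrightarrow> bij_betw (actq g) (q ` E) (q ` E)"
  by (rule bij_betw_byWitness[where f' = "actq (inv g)"]) (auto simp: actq_inv actq_inv' actq_closed)

lemma image_actq_mult:
  "g \<in> carrier G \<Longrightarrow> h \<in> carrier G \<Longrightarrow> I \<subseteq> q ` E \<Longrightarrow> actq (g \<otimes> h) ` I = actq g ` actq h ` I"
  using actq_mult[of g h] by (force simp: image_iff subset_iff)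

lemma image_actq_one: "I \<subseteq> q ` E \<Longrightarrow> actq \<one> ` I = I"
  using actq_one by (force simp: image_iff)

lemma image_actq_subset: "g \<in> carrier G \<Longrightarrow> I \<subseteq> q ` E \<Longrightarrow> actq g ` I \<subseteq> q ` E"
  using actq_closed by blast

lemma act_odd_sets: "g \<in> carrier G \<Longrightarrow> I \<in> odd_sets \<Longrightarrow> actq g ` I \<in> odd_sets"
  unfolding odd_sets_def
  using image_actq_subset card_image[OF inj_on_subset[OF inj_on_actq]] by auto

lemma finite_odd_sets: "finite odd_sets"
  using finite_subset[of odd_sets "Pow (q ` E)"] finite_E by (auto simp: odd_sets_def)

lemma actq_inv_image_iff:
  assumes "g \<in> carrier G" "I \<subseteq> q ` E"
  shows "actq (inv g) ` I = I \<longleftrightarrow> actq g ` I = I"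
proof -
  have "actq g ` actq (inv g) ` I = I" "actq (inv g) ` actq g ` I = I"
    using assms image_actq_mult[of g "inv g" I] image_actq_mult[of "inv g" g I] image_actq_one by auto
  then show ?thesis by metis
qed

end

text \<open>The choice of \<open>\<Phi>\<^sub>0\<close> is the choice of an origin in the affine space of half-systems. The set \<open>\<Phi>\<^sub>0\<close> is the image of
the section \<open>s\<close> of \<open>q\<close> defined below, and \<open>r g x\<close> is 1 at those \<open>x\<close> where the inverse of \<open>g\<close> carries \<open>s x\<close> out of \<open>\<Phi>\<^sub>0\<close>.\<close>

locale based_half_system_action = half_system_action G E act c q actq
  for G :: "('a, 'm) monoid_scheme" (structure) and E :: "'e set" and act c
    and q :: "'e \<Rightarrow> 'x" and actq +
  fixes \<Phi>\<^sub>0 :: "'e set"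
  assumes \<Phi>\<^sub>0: "\<Phi>\<^sub>0 \<in> half_systems"
begin

definition s :: "'x \<Rightarrow> 'e" where
  "s x = (THE e. e \<in> \<Phi>\<^sub>0 \<and> q e = x)"

definition r :: "'a \<Rightarrow> 'x \<Rightarrow> nat" where
  "r g x = (if act (inv g) (s x) \<in> \<Phi>\<^sub>0 then 0 else 1)"

lemma s_q: "e \<in> \<Phi>\<^sub>0 \<Longrightarrow> s (q e) = e"
proof -
  assume e: "e \<in> \<Phi>\<^sub>0"
  have "e' = e" if "e' \<in> \<Phi>\<^sub>0" "q e' = q e" for e'
    using that e q_eq_iff[of e e'] half_systems_c[OF \<Phi>\<^sub>0, of e] half_systems_subset[OF \<Phi>\<^sub>0] by auto
  with e show ?thesis unfolding s_def by blast
qed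

lemma s_mem: "x \<in> q ` E \<Longrightarrow> s x \<in> \<Phi>\<^sub>0" and q_s: "x \<in> q ` E \<Longrightarrow> q (s x) = x"
proof -
  have "s x \<in> \<Phi>\<^sub>0 \<and> q (s x) = x" if x: "x \<in> q ` E"
  proof -
    obtain e where e: "e \<in> E" "x = q e" using x by blast
    have "q (act c e) = q e"
      using e q_eq_iff[of e "act c e"] act_closed[OF c_closed] by auto
    moreover have "e \<in> \<Phi>\<^sub>0 \<or> act c e \<in> \<Phi>\<^sub>0"
      using e half_systems_c[OF \<Phi>\<^sub>0] by blast
    ultimately show ?thesis using e s_q by metis
  qed
  then show "x \<in> q ` E \<Longrightarrow> s x \<in> \<Phi>\<^sub>0" "x \<in> q ` E \<Longrightarrow> q (s x) = x" by auto
qed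

lemma s_mem_E: "x \<in> q ` E \<Longrightarrow> s x \<in> E"
  using s_mem half_systems_subset[OF \<Phi>\<^sub>0] by blast

text \<open>Either \<open>e\<close> is the chosen point over its class, or it is the conjugate of that point.\<close>

lemma mem_half_system_iff:
  assumes \<Phi>: "\<Phi> \<in> half_systems" and e: "e \<in> E"
  shows "e \<in> \<Phi> \<longleftrightarrow> (s (q e) \<in> \<Phi> \<longleftrightarrow> e \<in> \<Phi>\<^sub>0)"
proof (cases "e \<in> \<Phi>\<^sub>0")
  case False
  then have "act c e \<in> \<Phi>\<^sub>0" using half_systems_c[OF \<Phi>\<^sub>0 e] by blast
  moreover have "q (act c e) = q e"
    using e q_eq_iff[of e "act c e"] act_closed[OF c_closed] by auto
  ultimately have "s (q e) = act c e" using s_q by metis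
  with False show ?thesis using half_systems_c[OF \<Phi> e] by simp
qed (simp add: s_q)

lemma half_systems_eqI:
  assumes "\<Phi> \<in> half_systems" "\<Psi> \<in> half_systems" "\<And>x. x \<in> q ` E \<Longrightarrow> s x \<in> \<Phi> \<longleftrightarrow> s x \<in> \<Psi>"
  shows "\<Phi> = \<Psi>"
  using mem_half_system_iff[OF assms(1)] mem_half_system_iff[OF assms(2)] assms(3)
    half_systems_subset[OF assms(1)] half_systems_subset[OF assms(2)] by blast

lemma bij_betw_half_systems:
  "bij_betw (\<lambda>\<Phi>. {x \<in> q ` E. s x \<in> \<Phi>}) half_systems (Pow (q ` E))"
proof -
  have "{x \<in> q ` E. s x \<in> \<Phi>} = {x \<in> q ` E. s x \<in> \<Psi>} \<Longrightarrow> \<Phi> = \<Psi>"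
    if "\<Phi> \<in> half_systems" "\<Psi> \<in> half_systems" for \<Phi> \<Psi>
    by (rule half_systems_eqI[OF that]) blast
  moreover have "f \<in> (\<lambda>\<Phi>. {x \<in> q ` E. s x \<in> \<Phi>}) ` half_systems" if f: "f \<subseteq> q ` E" for f
  proof -
    \<comment> \<open>Agree with \<open>\<Phi>\<^sub>0\<close> over \<open>f\<close> and with its conjugate elsewhere.\<close>
    define \<Phi> where "\<Phi> = {e \<in> E. e \<in> \<Phi>\<^sub>0 \<longleftrightarrow> q e \<in> f}"
    have "q (act c e) = q e" if "e \<in> E" for e
      using that q_eq_iff[of e "act c e"] act_closed[OF c_closed] by auto
    then have "\<Phi> \<in> half_systems"
      unfolding half_systems_iff \<Phi>_def using act_closed[OF c_closed] half_systems_c[OF \<Phi>\<^sub>0] by auto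
    moreover have "{x \<in> q ` E. s x \<in> \<Phi>} = f"
      unfolding \<Phi>_def using f s_mem s_mem_E q_s by auto
    ultimately show ?thesis by (metis (no_types, lifting) image_eqI)
  qed
  ultimately show ?thesis by (auto simp: bij_betw_def inj_on_def)
qed

text \<open>In the coordinates \<open>f = {x. s x \<in> \<Phi>}\<close>, this is the affine action \<open>f \<mapsto> gf + r(g)\<close>.\<close>

lemma s_mem_act_iff:
  assumes "g \<in> carrier G" "\<Phi> \<in> half_systems" "x \<in> q ` E"
  shows "s x \<in> act g ` \<Phi> \<longleftrightarrow> (s (actq (inv g) x) \<in> \<Phi> \<longleftrightarrow> even (r g x))"
proof -
  have E: "act (inv g) (s x) \<in> E"
    using assms act_closed s_mem_E by simp
  have "q (act (inv g) (s x)) = actq (inv g) x"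
    using assms by (simp add: q_act s_mem_E q_s)
  then show ?thesis
    using mem_half_system_iff[OF assms(2) E] mem_image_act_iff[OF assms(1) half_systems_subset[OF assms(2)]]
      s_mem_E[OF assms(3)] by (simp add: r_def)
qed

lemma act_eq_iff:
  assumes "g \<in> carrier G" "\<Phi> \<in> half_systems"
  shows "act g ` \<Phi> = \<Phi> \<longleftrightarrow>
      (\<forall>x\<in>q ` E. s x \<in> \<Phi> \<longleftrightarrow> (s (actq (inv g) x) \<in> \<Phi> \<longleftrightarrow> even (r g x)))" (is ?th1)
    and "act g ` \<Phi> = act c ` \<Phi> \<longleftrightarrow>
      (\<forall>x\<in>q ` E. s x \<in> \<Phi> \<longleftrightarrow> (s (actq (inv g) x) \<in> \<Phi> \<longleftrightarrow> even (r g x + 1)))" (is ?th2)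
proof -
  have "act g ` \<Phi> = \<Phi> \<longleftrightarrow> (\<forall>x\<in>q ` E. s x \<in> act g ` \<Phi> \<longleftrightarrow> s x \<in> \<Phi>)"
    using half_systems_eqI[OF act_half_systems[OF assms] assms(2)] by blast
  then show ?th1 using s_mem_act_iff[OF assms] by auto
  have "act g ` \<Phi> = act c ` \<Phi> \<longleftrightarrow> (\<forall>x\<in>q ` E. s x \<in> act g ` \<Phi> \<longleftrightarrow> s x \<in> act c ` \<Phi>)"
    using half_systems_eqI[OF act_half_systems[OF assms] act_half_systems[OF c_closed assms(2)]] by blast
  moreover have "s x \<in> act c ` \<Phi> \<longleftrightarrow> s x \<notin> \<Phi>" if "x \<in> q ` E" for x
    using mem_image_act_iff[OF c_closed half_systems_subset[OF assms(2)] s_mem_E[OF that]]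
      half_systems_c[OF assms(2) s_mem_E[OF that]] by (simp add: inv_c)
  ultimately show ?th2 using s_mem_act_iff[OF assms] by auto
qed

lemma card_half_systems_Collect:
  assumes "\<And>\<Phi>. \<Phi> \<in> half_systems \<Longrightarrow> P \<Phi> \<longleftrightarrow>
    (\<forall>x\<in>q ` E. s x \<in> \<Phi> \<longleftrightarrow> (s (actq (inv g) x) \<in> \<Phi> \<longleftrightarrow> even (k x)))" and g: "g \<in> carrier G"
  shows "of_nat (card {\<Phi> \<in> half_systems. P \<Phi>}) =
    (\<Sum>I | I \<subseteq> q ` E \<and> actq g ` I = I. (-1 :: complex) ^ (\<Sum>x\<in>I. k x))"
proof -
  let ?f = "\<lambda>\<Phi>. {x \<in> q ` E. s x \<in> \<Phi>}"
  let ?A = "{f \<in> Pow (q ` E). \<forall>x\<in>q ` E. x \<in> f \<longleftrightarrow> (actq (inv g) x \<in> f \<longleftrightarrow> even (k x))}"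
  have P: "P \<Phi> \<longleftrightarrow> ?f \<Phi> \<in> ?A" if "\<Phi> \<in> half_systems" for \<Phi>
    using assms(1)[OF that] actq_closed[of "inv g"] g by auto
  have "bij_betw ?f {\<Phi> \<in> half_systems. P \<Phi>} ?A"
    unfolding bij_betw_def
  proof
    show "inj_on ?f {\<Phi> \<in> half_systems. P \<Phi>}"
      using bij_betw_half_systems by (auto simp: bij_betw_def intro: inj_on_subset)
    have "?f ` half_systems = Pow (q ` E)" using bij_betw_half_systems by (simp add: bij_betw_def)
    then have A: "?A = {f \<in> ?f ` half_systems. \<forall>x\<in>q ` E. x \<in> f \<longleftrightarrow> (actq (inv g) x \<in> f \<longleftrightarrow> even (k x))}"
      by simp
    have image_Collect: "F ` {x \<in> H. P x} = {y \<in> F ` H. Q y}"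
      if "\<And>x. x \<in> H \<Longrightarrow> P x \<longleftrightarrow> Q (F x)" for F :: "'e set \<Rightarrow> 'x set" and H P Q
      using that by auto
    show "?f ` {\<Phi> \<in> half_systems. P \<Phi>} = ?A"
      unfolding A by (rule image_Collect) (use P A in auto)
  qed
  then have "card {\<Phi> \<in> half_systems. P \<Phi>} = card ?A" by (rule bij_betw_same_card)
  also have "of_nat (card ?A) = (\<Sum>I | I \<in> Pow (q ` E) \<and> actq (inv g) ` I = I. (-1 :: complex) ^ (\<Sum>x\<in>I. k x))"
    using finite_E bij_betw_actq g by (intro card_twisted_invariant_subsets) auto
  also have "{I. I \<in> Pow (q ` E) \<and> actq (inv g) ` I = I} = {I. I \<subseteq> q ` E \<and> actq g ` I = I}"
    using actq_inv_image_iff[OF g] by auto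
  finally show ?thesis .
qed

text \<open>Acting by \<open>c\<close> adds 1 to every coordinate, so the second count is the first one with \<open>r + 1\<close> instead of \<open>r\<close>. This
multiplies the term of \<open>I\<close> by \<open>(-1) ^ card I\<close>, so that even sets cancel in the difference and odd sets are doubled.\<close>

lemma fixed_minus_antifixed:
  assumes g: "g \<in> carrier G"
  shows "of_nat (card {\<Phi> \<in> half_systems. act g ` \<Phi> = \<Phi>}) -
      of_nat (card {\<Phi> \<in> half_systems. act g ` \<Phi> = act c ` \<Phi>}) =
    2 * (\<Sum>I | I \<in> odd_sets \<and> actq g ` I = I. (-1 :: complex) ^ (\<Sum>x\<in>I. r g x))"
proof -
  let ?S = "{I. I \<subseteq> q ` E \<and> actq g ` I = I}" and ?h = "\<lambda>I. (-1 :: complex) ^ (\<Sum>x\<in>I. r g x)"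
  have fin: "finite ?S" using finite_E finite_subset[of ?S "Pow (q ` E)"] by auto
  have "of_nat (card {\<Phi> \<in> half_systems. act g ` \<Phi> = \<Phi>}) -
      of_nat (card {\<Phi> \<in> half_systems. act g ` \<Phi> = act c ` \<Phi>}) =
    (\<Sum>I\<in>?S. ?h I - (-1) ^ (\<Sum>x\<in>I. r g x + 1))"
    unfolding sum_subtractf
    by (intro arg_cong2[where f = "(-)"] card_half_systems_Collect[OF _ g] act_eq_iff[OF g])
  also have "\<dots> = (\<Sum>I\<in>?S. if odd (card I) then 2 * ?h I else 0)"
    unfolding sum.distrib power_add by (intro sum.cong) auto
  also have "\<dots> = (\<Sum>I | I \<in> ?S \<and> odd (card I). 2 * ?h I)"
    by (rule sum.inter_filter[OF fin, symmetric])
  also have "{I. I \<in> ?S \<and> odd (card I)} = {I. I \<in> odd_sets \<and> actq g ` I = I}"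
    by (auto simp: odd_sets_def)
  finally show ?thesis by (simp add: sum_distrib_left)
qed

text \<open>The cocycle identity \<open>r(gh) = r(g) + g r(h)\<close> modulo 2, written multiplicatively.\<close>

lemma sign_cocycle:
  assumes g: "g \<in> carrier G" and h: "h \<in> carrier G" and x: "x \<in> q ` E"
  shows "(-1 :: complex) ^ r (g \<otimes> h) x = (-1) ^ r g x * (-1) ^ r h (actq (inv g) x)"
proof -
  let ?e = "act (inv g) (s x)"
  have e: "?e \<in> E" "q ?e = actq (inv g) x"
    using g x by (auto simp: act_closed s_mem_E q_act q_s)
  have "act (inv (g \<otimes> h)) (s x) = act (inv h) ?e"
    using g h x by (simp add: inv_mult_group act_mult s_mem_E)
  moreover have "act (inv h) ?e \<in> \<Phi>\<^sub>0 \<longleftrightarrow> ?e \<in> act h ` \<Phi>\<^sub>0"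
    using mem_image_act_iff[OF h half_systems_subset[OF \<Phi>\<^sub>0] e(1)] by simp
  moreover have "\<dots> \<longleftrightarrow> (s (q ?e) \<in> act h ` \<Phi>\<^sub>0 \<longleftrightarrow> ?e \<in> \<Phi>\<^sub>0)"
    using mem_half_system_iff[OF act_half_systems[OF h \<Phi>\<^sub>0] e(1)] .
  moreover have "s (q ?e) \<in> act h ` \<Phi>\<^sub>0 \<longleftrightarrow> act (inv h) (s (actq (inv g) x)) \<in> \<Phi>\<^sub>0"
    using mem_image_act_iff[OF h half_systems_subset[OF \<Phi>\<^sub>0]] s_mem_E e by force
  ultimately show ?thesis by (auto simp: r_def)
qed

text \<open>Equivariance of the signs, which makes the right-hand induced characters amenable to
\<open>sum_induced_over_orbit_representatives\<close>. The orders in which \<open>y\<close> and \<open>g\<close> act differ by a cocycle term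
for \<open>y\<close> that is the same on both sides because \<open>g\<close> stabilises \<open>actq y ` I\<close>.\<close>

lemma sign_conjugate:
  assumes g: "g \<in> carrier G" and y: "y \<in> carrier G" and I: "I \<subseteq> q ` E"
    and stable: "actq g ` actq y ` I = actq y ` I"
  shows "(-1 :: complex) ^ (\<Sum>x\<in>I. r (inv y \<otimes> g \<otimes> y) x) = (-1) ^ (\<Sum>x\<in>actq y ` I. r g x)"
proof -
  let ?J = "actq y ` I" and ?g = "inv y \<otimes> g \<otimes> y"
  define \<epsilon> where "\<epsilon> = (\<lambda>g I. \<Prod>x\<in>I. (-1 :: complex) ^ r g x)"
  have eps: "(-1 :: complex) ^ (\<Sum>x\<in>I. r g x) = \<epsilon> g I" for g I
    by (simp add: \<epsilon>_def power_sum)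
  have J: "?J \<subseteq> q ` E" using image_actq_subset[OF y I] .
  have gJ: "actq (inv g) ` ?J = ?J"
    using actq_inv_image_iff[OF g J] stable by simp
  have yJ: "actq (inv y) ` ?J = I"
    using image_actq_mult[of "inv y" y I] y I image_actq_one by simp
  have split: "\<epsilon> (a \<otimes> b) ?J = \<epsilon> a ?J * \<epsilon> b (actq (inv a) ` ?J)"
    if "a \<in> carrier G" "b \<in> carrier G" for a b
  proof -
    have "inj_on (actq (inv a)) ?J"
      using that inj_on_subset[OF inj_on_actq[of "inv a"] J] by simp
    moreover have "\<epsilon> (a \<otimes> b) ?J = (\<Prod>x\<in>?J. (-1) ^ r a x * (-1) ^ r b (actq (inv a) x))"
      unfolding \<epsilon>_def using sign_cocycle that J by (intro prod.cong) auto
    ultimately show ?thesis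
      by (simp add: \<epsilon>_def prod.distrib prod.reindex)
  qed
  \<comment> \<open>Expand the sign of \<open>y \<otimes> ?g = g \<otimes> y\<close> on \<open>?J\<close> in both ways; the factor \<open>\<epsilon> y ?J\<close> occurs in both and cancels.\<close>
  have "y \<otimes> ?g = g \<otimes> y"
    using g y by (simp add: m_assoc[symmetric])
  then have "\<epsilon> y ?J * \<epsilon> ?g I = \<epsilon> g ?J * \<epsilon> y ?J"
    using split[OF y, of ?g] split[OF g y] g y gJ yJ by auto
  moreover have "\<epsilon> y ?J \<noteq> 0"
    by (simp add: \<epsilon>_def flip: power_sum)
  ultimately show ?thesis by (simp add: eps)
qed

abbreviation "stab_half \<equiv> stabilizer G (\<lambda>g \<Phi>. act g ` \<Phi>)"
abbreviation "stab_set \<equiv> stabilizer G (\<lambda>g I. actq g ` I)"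

lemma sum_Ind_odd_sets:
  assumes R: "system_of_reps R (orbits G odd_sets (\<lambda>g I. actq g ` I))" and g: "g \<in> carrier G"
  shows "(\<Sum>I\<in>R. Ind G (stab_set I) (\<lambda>\<sigma>. (-1) ^ (\<Sum>x\<in>I. r \<sigma> x)) g) =
    (\<Sum>I | I \<in> odd_sets \<and> actq g ` I = I. (-1) ^ (\<Sum>x\<in>I. r g x))"
proof -
  define w :: "'x set \<Rightarrow> 'a \<Rightarrow> complex" where
    "w = (\<lambda>I y. if actq y ` I = I then (-1) ^ (\<Sum>x\<in>I. r y x) else 0)"
  have sub: "I \<subseteq> q ` E" if "I \<in> odd_sets" for I using that by (simp add: odd_sets_def)
  have "Ind G (stab_set I) (\<lambda>\<sigma>. (-1) ^ (\<Sum>x\<in>I. r \<sigma> x)) g =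
      (\<Sum>x\<in>carrier G. w I (inv x \<otimes> g \<otimes> x)) / of_nat (card (stab_set I))" for I
  proof -
    have "{x. x \<in> carrier G \<and> inv x \<otimes> g \<otimes> x \<in> stab_set I} =
        {x \<in> carrier G. actq (inv x \<otimes> g \<otimes> x) ` I = I}"
      using g by (auto simp: stabilizer_def)
    then show ?thesis
      unfolding Ind_def w_def using finite_group by (simp add: sum.inter_filter)
  qed
  then have "(\<Sum>I\<in>R. Ind G (stab_set I) (\<lambda>\<sigma>. (-1) ^ (\<Sum>x\<in>I. r \<sigma> x)) g) =
      (\<Sum>I\<in>R. (\<Sum>x\<in>carrier G. w I (inv x \<otimes> g \<otimes> x)) / of_nat (card (stab_set I)))"
    by simp
  also have "\<dots> = (\<Sum>I\<in>odd_sets. w I g)"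
  proof (rule sum_induced_over_orbit_representatives[OF finite_group finite_odd_sets _ _ _ R])
    fix x I assume x: "x \<in> carrier G" and I: "I \<in> odd_sets"
    have "actq (inv x \<otimes> g \<otimes> x) ` I = actq (inv x) ` actq g ` actq x ` I"
      using x g sub[OF I] by (simp add: image_actq_mult image_actq_subset)
    moreover have "actq (inv x) ` actq g ` actq x ` I = I \<longleftrightarrow> actq g ` actq x ` I = actq x ` I"
    proof -
      have "actq x ` actq (inv x) ` J = J" "actq (inv x) ` actq x ` J = J" if "J \<subseteq> q ` E" for J
        using that x image_actq_mult[of x "inv x" J] image_actq_mult[of "inv x" x J] image_actq_one by auto
      then show ?thesis
        using sub[OF I] x g image_actq_subset by metis
    qed
    ultimately show "w I (inv x \<otimes> g \<otimes> x) = w (actq x ` I) g"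
      using sign_conjugate[OF g x sub[OF I]] by (simp add: w_def)
  qed (use act_odd_sets image_actq_one image_actq_mult sub in auto)
  also have "\<dots> = (\<Sum>I | I \<in> odd_sets \<and> actq g ` I = I. (-1) ^ (\<Sum>x\<in>I. r g x))"
    unfolding w_def by (rule sum.inter_filter[OF finite_odd_sets, symmetric])
  finally show ?thesis .
qed

text \<open>The group \<open>B = S \<union> cS\<close> has twice the order of the stabiliser \<open>S\<close>, which accounts for the factor 1/2. Membership of
\<open>x\<inverse>gx\<close> in \<open>S\<close> or in \<open>cS\<close> says that \<open>g\<close> fixes \<open>x\<Phi>\<close> or sends it to its conjugate.\<close>

lemma sum_Ind_half_systems:
  assumes R: "system_of_reps R (orbits G half_systems (\<lambda>g \<Phi>. act g ` \<Phi>))" and g: "g \<in> carrier G"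
  shows "(\<Sum>\<Phi>\<in>R. Ind G (stab_half \<Phi> \<union> (\<lambda>\<sigma>. c \<otimes> \<sigma>) ` stab_half \<Phi>) (index2_char (stab_half \<Phi>)) g) =
    (of_nat (card {\<Phi> \<in> half_systems. act g ` \<Phi> = \<Phi>}) -
      of_nat (card {\<Phi> \<in> half_systems. act g ` \<Phi> = act c ` \<Phi>})) / 2"
proof -
  define w :: "'e set \<Rightarrow> 'a \<Rightarrow> complex" where
    "w = (\<lambda>\<Phi> y. (if act y ` \<Phi> = \<Phi> then 1 else 0) - (if act y ` \<Phi> = act c ` \<Phi> then 1 else 0))"
  note sub = half_systems_subset
  have RP: "R \<subseteq> half_systems"
    by (rule sum_over_orbit_representatives(2)[OF finite_half_systems _ _ _ R])
      (use act_half_systems image_act_one image_act_mult sub in auto)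
  have "Ind G (stab_half \<Phi> \<union> (\<lambda>\<sigma>. c \<otimes> \<sigma>) ` stab_half \<Phi>) (index2_char (stab_half \<Phi>)) g =
      (\<Sum>x\<in>carrier G. w \<Phi> (inv x \<otimes> g \<otimes> x)) / of_nat (card (stab_half \<Phi>)) / 2"
    if \<Phi>: "\<Phi> \<in> half_systems" for \<Phi>
  proof -
    let ?S = "stab_half \<Phi>"
    let ?B = "?S \<union> (\<lambda>\<sigma>. c \<otimes> \<sigma>) ` ?S"
    have S: "y \<in> ?S \<longleftrightarrow> act y ` \<Phi> = \<Phi>" if "y \<in> carrier G" for y
      using that by (simp add: stabilizer_def)
    have cS: "y \<in> (\<lambda>\<sigma>. c \<otimes> \<sigma>) ` ?S \<longleftrightarrow> act y ` \<Phi> = act c ` \<Phi>" if y: "y \<in> carrier G" for y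
    proof
      assume "y \<in> (\<lambda>\<sigma>. c \<otimes> \<sigma>) ` ?S"
      then obtain \<sigma> where "\<sigma> \<in> carrier G" "act \<sigma> ` \<Phi> = \<Phi>" "y = c \<otimes> \<sigma>"
        by (auto simp: stabilizer_def)
      then show "act y ` \<Phi> = act c ` \<Phi>"
        using image_act_mult[OF c_closed _ sub[OF \<Phi>], of \<sigma>] by simp
    next
      assume "act y ` \<Phi> = act c ` \<Phi>"
      then have "act (c \<otimes> y) ` \<Phi> = \<Phi>"
        using image_act_mult[OF c_closed y sub[OF \<Phi>]] image_act_mult[OF c_closed c_closed sub[OF \<Phi>]]
          image_act_one[OF sub[OF \<Phi>]] c_involution by simp
      then have "c \<otimes> y \<in> ?S" using y c_closed by (simp add: stabilizer_def)
      moreover have "y = c \<otimes> (c \<otimes> y)" using y c_closed c_involution by (simp add: m_assoc[symmetric])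
      ultimately show "y \<in> (\<lambda>\<sigma>. c \<otimes> \<sigma>) ` ?S" by blast
    qed
    have SG: "?S \<subseteq> carrier G" by (auto simp: stabilizer_def)
    have disj: "?S \<inter> (\<lambda>\<sigma>. c \<otimes> \<sigma>) ` ?S = {}"
    proof (intro equalityI subsetI)
      fix y assume y: "y \<in> ?S \<inter> (\<lambda>\<sigma>. c \<otimes> \<sigma>) ` ?S"
      then have "y \<in> carrier G" using SG by blast
      with S[of y] cS[of y] y c_moves_half_system[OF \<Phi>] show "y \<in> {}" by auto
    qed simp
    have "card ((\<lambda>\<sigma>. c \<otimes> \<sigma>) ` ?S) = card ?S"
      by (rule card_image[OF inj_on_subset[OF inj_on_cmult[OF c_closed] SG]])
    then have card: "card ?B = 2 * card ?S"
      using disj finite_subset[OF SG finite_group] by (simp add: card_Un_disjoint)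
    have "(\<Sum>x | x \<in> carrier G \<and> inv x \<otimes> g \<otimes> x \<in> ?B. index2_char ?S (inv x \<otimes> g \<otimes> x)) =
        (\<Sum>x\<in>carrier G. w \<Phi> (inv x \<otimes> g \<otimes> x))"
      unfolding sum.inter_filter[OF finite_group]
    proof (rule sum.cong[OF refl])
      fix x assume x: "x \<in> carrier G"
      then have y: "inv x \<otimes> g \<otimes> x \<in> carrier G" using g by simp
      show "(if inv x \<otimes> g \<otimes> x \<in> ?B then index2_char ?S (inv x \<otimes> g \<otimes> x) else 0) =
          w \<Phi> (inv x \<otimes> g \<otimes> x)"
        using S[OF y] cS[OF y] c_moves_half_system[OF \<Phi>] by (auto simp: w_def index2_char_def)
    qed
    then show ?thesis by (simp add: Ind_def card)
  qed
  then have "(\<Sum>\<Phi>\<in>R. Ind G (stab_half \<Phi> \<union> (\<lambda>\<sigma>. c \<otimes> \<sigma>) ` stab_half \<Phi>) (index2_char (stab_half \<Phi>)) g) =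
      (\<Sum>\<Phi>\<in>R. (\<Sum>x\<in>carrier G. w \<Phi> (inv x \<otimes> g \<otimes> x)) / of_nat (card (stab_half \<Phi>))) / 2"
    using RP by (simp add: sum_divide_distrib subset_iff)
  also have "(\<Sum>\<Phi>\<in>R. (\<Sum>x\<in>carrier G. w \<Phi> (inv x \<otimes> g \<otimes> x)) / of_nat (card (stab_half \<Phi>))) =
      (\<Sum>\<Phi>\<in>half_systems. w \<Phi> g)"
  proof (rule sum_induced_over_orbit_representatives[OF finite_group finite_half_systems _ _ _ R])
    fix x \<Phi> assume x: "x \<in> carrier G" and \<Phi>: "\<Phi> \<in> half_systems"
    have "act (inv x \<otimes> g \<otimes> x) ` \<Phi> = act (inv x) ` act g ` act x ` \<Phi>"
      using x g sub[OF \<Phi>] by (simp add: image_act_mult image_act_subset)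
    moreover have "act (inv x) ` act g ` act x ` \<Phi> = \<Psi> \<longleftrightarrow> act g ` act x ` \<Phi> = act x ` \<Psi>"
      if "\<Psi> \<subseteq> E" for \<Psi>
    proof -
      have "act x ` act (inv x) ` J = J" "act (inv x) ` act x ` J = J" if "J \<subseteq> E" for J
        using that x image_act_mult[of x "inv x" J] image_act_mult[of "inv x" x J] image_act_one by auto
      then show ?thesis
        using sub[OF \<Phi>] that x g image_act_subset by metis
    qed
    moreover have "act x ` act c ` \<Phi> = act c ` act x ` \<Phi>"
      using x sub[OF \<Phi>] c_closed c_central image_act_mult by metis
    ultimately show "w \<Phi> (inv x \<otimes> g \<otimes> x) = w (act x ` \<Phi>) g"
      using sub[OF \<Phi>] image_act_subset[OF c_closed sub[OF \<Phi>]] by (simp add: w_def)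
  qed (use act_half_systems image_act_one image_act_mult sub in auto)
  also have "\<dots> = of_nat (card {\<Phi> \<in> half_systems. act g ` \<Phi> = \<Phi>}) -
      of_nat (card {\<Phi> \<in> half_systems. act g ` \<Phi> = act c ` \<Phi>})"
    unfolding w_def sum_subtractf using finite_half_systems
    by (simp add: sum.inter_filter[symmetric])
  finally show ?thesis .
qed

theorem sum_Ind_half_systems_eq_sum_Ind_odd_sets:
  assumes "system_of_reps R (orbits G half_systems (\<lambda>g \<Phi>. act g ` \<Phi>))"
    and "system_of_reps R' (orbits G odd_sets (\<lambda>g I. actq g ` I))" and "g \<in> carrier G"
  shows "(\<Sum>\<Phi>\<in>R. Ind G (stab_half \<Phi> \<union> (\<lambda>\<sigma>. c \<otimes> \<sigma>) ` stab_half \<Phi>) (index2_char (stab_half \<Phi>)) g) =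
    (\<Sum>I\<in>R'. Ind G (stab_set I) (\<lambda>\<sigma>. (-1) ^ (\<Sum>x\<in>I. r \<sigma> x)) g)"
  using sum_Ind_half_systems[OF assms(1,3)] sum_Ind_odd_sets[OF assms(2,3)] fixed_minus_antifixed[OF assms(3)]
  by simp

end

lemma (in group) subgroup_Un_central_translate:
  assumes S: "subgroup S G" and c: "c \<in> carrier G" "c \<otimes> c = \<one>"
    and central: "\<And>g. g \<in> carrier G \<Longrightarrow> c \<otimes> g = g \<otimes> c"
  shows "subgroup (S \<union> (\<lambda>\<sigma>. c \<otimes> \<sigma>) ` S) G"
proof (rule subgroupI)
  note SG = subgroup.mem_carrier[OF S]
  have inv_c: "inv c = c" by (rule inv_equality[OF c(2) c(1) c(1)])
  show "S \<union> (\<lambda>\<sigma>. c \<otimes> \<sigma>) ` S \<subseteq> carrier G" using SG c(1) by auto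
  show "S \<union> (\<lambda>\<sigma>. c \<otimes> \<sigma>) ` S \<noteq> {}" using subgroup.one_closed[OF S] by blast
  show "inv a \<in> S \<union> (\<lambda>\<sigma>. c \<otimes> \<sigma>) ` S" if a: "a \<in> S \<union> (\<lambda>\<sigma>. c \<otimes> \<sigma>) ` S" for a
  proof -
    have "inv (c \<otimes> \<sigma>) = c \<otimes> inv \<sigma>" if "\<sigma> \<in> S" for \<sigma>
      using SG[OF that] c(1) by (simp add: inv_mult_group inv_c central)
    then show ?thesis using a subgroup.m_inv_closed[OF S] by auto
  qed
  show "a \<otimes> b \<in> S \<union> (\<lambda>\<sigma>. c \<otimes> \<sigma>) ` S"
    if a: "a \<in> S \<union> (\<lambda>\<sigma>. c \<otimes> \<sigma>) ` S" and b: "b \<in> S \<union> (\<lambda>\<sigma>. c \<otimes> \<sigma>) ` S" for a b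
  proof -
    have 1: "(c \<otimes> \<sigma>) \<otimes> \<tau> = c \<otimes> (\<sigma> \<otimes> \<tau>)" "\<sigma> \<otimes> (c \<otimes> \<tau>) = c \<otimes> (\<sigma> \<otimes> \<tau>)"
        "(c \<otimes> \<sigma>) \<otimes> (c \<otimes> \<tau>) = \<sigma> \<otimes> \<tau>" if st: "\<sigma> \<in> S" "\<tau> \<in> S" for \<sigma> \<tau>
    proof -
      note G = SG[OF st(1)] SG[OF st(2)] c(1)
      show "(c \<otimes> \<sigma>) \<otimes> \<tau> = c \<otimes> (\<sigma> \<otimes> \<tau>)" using G by (simp add: m_assoc)
      show 2: "\<sigma> \<otimes> (c \<otimes> \<tau>) = c \<otimes> (\<sigma> \<otimes> \<tau>)"
        using G central[of \<sigma>] m_assoc[of \<sigma> c \<tau>] m_assoc[of c \<sigma> \<tau>] by simp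
      have "(c \<otimes> \<sigma>) \<otimes> (c \<otimes> \<tau>) = c \<otimes> (c \<otimes> (\<sigma> \<otimes> \<tau>))" using G 2 by (simp add: m_assoc)
      also have "\<dots> = \<sigma> \<otimes> \<tau>" using G c(2) by (simp add: m_assoc[symmetric])
      finally show "(c \<otimes> \<sigma>) \<otimes> (c \<otimes> \<tau>) = \<sigma> \<otimes> \<tau>" .
    qed
    show ?thesis using a b 1 subgroup.m_closed[OF S] by auto
  qed
qed

lemma (in half_system_action) subgroup_stabilizer_half_system:
  assumes "\<Phi> \<subseteq> E"
  shows "subgroup (stabilizer G (\<lambda>g \<Phi>. act g ` \<Phi>) \<Phi>) G"
proof (rule subgroupI)
  show "inv a \<in> stabilizer G (\<lambda>g \<Phi>. act g ` \<Phi>) \<Phi>" if "a \<in> stabilizer G (\<lambda>g \<Phi>. act g ` \<Phi>) \<Phi>" for a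
    using that image_act_mult[OF _ _ assms, of "inv a" a] image_act_one[OF assms]
    by (auto simp: stabilizer_def)
  show "stabilizer G (\<lambda>g \<Phi>. act g ` \<Phi>) \<Phi> \<noteq> {}"
    using image_act_one[OF assms] one_closed by (auto simp: stabilizer_def simp del: one_closed)
qed (auto simp: stabilizer_def image_act_mult[OF _ _ assms])

section \<open>CM-fields\<close>

text \<open>The other root is the complex conjugate, and the two roots add up to \<open>v\<close>.\<close>

lemma nonreal_root_of_real_quadratic:
  fixes a u v :: complex
  assumes "u \<in> \<real>" "v \<in> \<real>" "a \<notin> \<real>" "a * a = u + v * a"
  shows "cnj a = v - a"
proof -
  have uv: "cnj u = u" "cnj v = v" using assms(1,2) by (simp_all add: Reals_cnj_iff)
  have "cnj a * cnj a = u + v * cnj a"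
    using arg_cong[OF assms(4), of cnj] uv by simp
  with assms(4) have "(a - cnj a) * (a + cnj a - v) = 0"
    by (simp add: algebra_simps)
  moreover have "a - cnj a \<noteq> 0" using assms(3) by (simp add: Reals_cnj_iff)
  ultimately have "a + cnj a - v = 0" by (metis mult_eq_0_iff)
  then show ?thesis by (simp add: algebra_simps)
qed

lemma totally_real_hom_Reals:
  assumes "totally_real F" "hom_on F \<phi>" "x \<in> F" shows "\<phi> x \<in> \<real>"
proof -
  have "restrict \<phi> F \<in> embeddings F"
    using assms hom_on_restrict[of F \<phi>] by (auto simp: embeddings_eq totally_real_def number_field_def)
  then show ?thesis using assms(1,3) unfolding totally_real_def by force
qed

lemma totally_real_subset_Reals: "totally_real F \<Longrightarrow> F \<subseteq> \<real>"
  using totally_real_hom_Reals[OF _ hom_on_id] by blast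

lemma quadratic_extension_basis:
  assumes F: "subfield F CC" and dim: "CC.dimension 2 F K" and a: "a \<in> K" "a \<notin> F" and one: "1 \<in> K"
    and x: "x \<in> K"
  shows "\<exists>u\<in>F. \<exists>v\<in>F. x = u + v * a"
proof -
  have sp1: "CC.Span F [1] = F"
    by (auto simp: CC.line_extension_mem_iff set_eq_iff)
  have "CC.independent F [a, 1]"
  proof (intro CC.independent.intros)
    show "a \<notin> CC.Span F [1]" using a sp1 by simp
  qed auto
  then have "CC.Span F [a, 1] = K"
    using CC.independent_length_eq_dimension[OF F dim, of "[a, 1]"] a one by simp
  then have "x \<in> CC.line_extension F a (CC.Span F [1])" using x by simp
  then show ?thesis
    unfolding sp1 CC.line_extension_mem_iff by (auto simp: add.commute)
qed

locale CM =
  fixes K :: "complex set"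
  assumes CM: "CM_field K"
begin

abbreviation "L \<equiv> galois_closure K"

lemma number_field_K: "number_field K"
  using CM by (simp add: CM_field_def totally_imaginary_def)

lemma subfield_K: "subfield K CC"
  using number_field_K by (rule number_field_subfield)

lemma hom_on_K_not_real:
  assumes "hom_on K \<phi>" shows "\<not> \<phi> ` K \<subseteq> \<real>"
proof -
  have "restrict \<phi> K \<in> embeddings K"
    using assms hom_on_restrict[OF subfield_K] by (simp add: embeddings_eq)
  then have "\<not> restrict \<phi> K ` K \<subseteq> \<real>"
    using CM unfolding CM_field_def totally_imaginary_def by blast
  then show ?thesis by simp
qed

text \<open>The form in which the CM property enters: \<open>K\<close> is \<open>F + F a\<close> with \<open>F = K \<inter> \<real>\<close> and \<open>a\<close> nonreal, and each embedding preserves the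
reality of \<open>F\<close> and the nonreality of \<open>a\<close>.\<close>

lemma real_quadratic_generator:
  obtains a u v where "a \<in> K" "u \<in> K \<inter> \<real>" "v \<in> K \<inter> \<real>" "a * a = u + v * a"
    "\<And>x. x \<in> K \<Longrightarrow> \<exists>y\<in>K \<inter> \<real>. \<exists>z\<in>K \<inter> \<real>. x = y + z * a"
    "\<And>\<phi>. hom_on K \<phi> \<Longrightarrow> \<phi> u \<in> \<real> \<and> \<phi> v \<in> \<real> \<and> \<phi> a \<notin> \<real>"
    "\<And>\<phi> x. hom_on K \<phi> \<Longrightarrow> x \<in> K \<inter> \<real> \<Longrightarrow> \<phi> x \<in> \<real>"
proof -
  obtain F where F: "totally_real F" "F \<subseteq> K" "CC.dimension 2 F K"
    using CM unfolding CM_field_def by blast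
  have sub: "subfield F CC" using F(1) by (simp add: totally_real_def number_field_def)
  have FR: "F \<subseteq> \<real>" using totally_real_subset_Reals[OF F(1)] .
  obtain a where a: "a \<in> K" "a \<notin> \<real>" using hom_on_K_not_real[OF hom_on_id] by auto
  have basis: "\<exists>y\<in>F. \<exists>z\<in>F. x = y + z * a" if "x \<in> K" for x
    using quadratic_extension_basis[OF sub F(3) a(1) _ _ that] a(2) FR subfield_CC_closed(2)[OF subfield_K] by blast
  \<comment> \<open>The real subfield from the definition of a CM-field is not prescribed, but it can only be \<open>K \<inter> \<real>\<close>.\<close>
  have F_eq: "K \<inter> \<real> = F"
  proof
    show "F \<subseteq> K \<inter> \<real>" using F(2) FR by blast
    show "K \<inter> \<real> \<subseteq> F"
    proof
      fix x assume x: "x \<in> K \<inter> \<real>"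
      then obtain y z where yz: "y \<in> F" "z \<in> F" "x = y + z * a" using basis by blast
      have "z = 0"
      proof (rule ccontr)
        assume "z \<noteq> 0"
        then have "a = (x - y) / z" using yz by simp
        then show False using x yz FR a(2) by (metis Int_iff Reals_diff Reals_divide subsetD)
      qed
      with yz show "x \<in> F" by simp
    qed
  qed
  have real: "\<phi> x \<in> \<real>" if "hom_on K \<phi>" "x \<in> F" for \<phi> x
    using totally_real_hom_Reals[OF F(1) hom_on_subset[OF that(1) F(2)] that(2)] .
  obtain u v where uv: "u \<in> F" "v \<in> F" "a * a = u + v * a"
    using basis subfield_CC_closed(4)[OF subfield_K a(1) a(1)] by blast
  have "\<phi> a \<notin> \<real>" if \<phi>: "hom_on K \<phi>" for \<phi>
  proof
    assume "\<phi> a \<in> \<real>"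
    moreover have "\<phi> (y + z * a) = \<phi> y + \<phi> z * \<phi> a" if "y \<in> F" "z \<in> F" for y z
      using that F(2) a(1) \<phi> subfield_CC_closed(4)[OF subfield_K]
      by (simp add: hom_on_add[OF \<phi>] hom_on_mult[OF \<phi>] subset_iff)
    ultimately have "\<phi> x \<in> \<real>" if "x \<in> K" for x
      using basis[OF that] real[OF \<phi>] by auto
    then show False using hom_on_K_not_real[OF \<phi>] by blast
  qed
  with a(1) uv basis real F_eq show thesis
    by (intro that[of a u v]) auto
qed

text \<open>Conjugation sends \<open>a\<close> to \<open>v - a\<close>, an expression that every embedding respects, since the image of \<open>a\<close> is again
a nonreal root of a real quadratic polynomial.\<close>

lemma embedding_cnj:
  assumes "x \<in> K"
  shows "cnj x \<in> K" "hom_on K \<phi> \<Longrightarrow> \<phi> (cnj x) = cnj (\<phi> x)"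
proof -
  obtain a u v where a: "a \<in> K" "u \<in> K \<inter> \<real>" "v \<in> K \<inter> \<real>" "a * a = u + v * a"
    and basis: "\<And>x. x \<in> K \<Longrightarrow> \<exists>y\<in>K \<inter> \<real>. \<exists>z\<in>K \<inter> \<real>. x = y + z * a"
    and nr: "\<And>\<phi>. hom_on K \<phi> \<Longrightarrow> \<phi> u \<in> \<real> \<and> \<phi> v \<in> \<real> \<and> \<phi> a \<notin> \<real>"
    and re: "\<And>\<phi> x. hom_on K \<phi> \<Longrightarrow> x \<in> K \<inter> \<real> \<Longrightarrow> \<phi> x \<in> \<real>"
    using real_quadratic_generator by blast
  note cl = subfield_CC_closed[OF subfield_K]
  have cnja: "cnj a = v - a"
    using nr[OF hom_on_id] a by (intro nonreal_root_of_real_quadratic) auto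
  then have aK: "cnj a \<in> K" using a cl by simp
  obtain y z where yz: "y \<in> K \<inter> \<real>" "z \<in> K \<inter> \<real>" "x = y + z * a" using basis[OF assms] by blast
  then have cx: "cnj x = y + z * cnj a" by (simp add: Reals_cnj_iff)
  then show "cnj x \<in> K" using yz aK cl by simp
  assume \<phi>: "hom_on K \<phi>"
  have "\<phi> a * \<phi> a = \<phi> (u + v * a)"
    using hom_on_mult[OF \<phi> a(1) a(1)] a(4) by simp
  then have "\<phi> a * \<phi> a = \<phi> u + \<phi> v * \<phi> a"
    using a(1-3) cl by (simp add: hom_on_add[OF \<phi>] hom_on_mult[OF \<phi>])
  then have "cnj (\<phi> a) = \<phi> v - \<phi> a"
    using nr[OF \<phi>] by (intro nonreal_root_of_real_quadratic) auto
  then have "\<phi> (cnj a) = cnj (\<phi> a)"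
    using a cnja by (simp add: hom_on_diff[OF subfield_K \<phi>])
  moreover have "cnj (\<phi> y) = \<phi> y" "cnj (\<phi> z) = \<phi> z"
    using re[OF \<phi>] yz by (simp_all add: Reals_cnj_iff)
  ultimately show "\<phi> (cnj x) = cnj (\<phi> x)"
    unfolding cx using yz a(1) aK cl by (simp add: hom_on_add[OF \<phi>] hom_on_mult[OF \<phi>])
qed

text \<open>This is why \<open>H\<^sub>0 = H \<union> \<iota>H\<close>: over each embedding of \<open>K \<inter> \<real>\<close> there are only two embeddings of \<open>K\<close>, and they are
conjugate.\<close>

lemma hom_on_K_determined:
  assumes \<phi>: "hom_on K \<phi>" and \<psi>: "hom_on K \<psi>" and agree: "\<And>x. x \<in> K \<inter> \<real> \<Longrightarrow> \<phi> x = \<psi> x"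
  shows "(\<forall>x\<in>K. \<psi> x = \<phi> x) \<or> (\<forall>x\<in>K. \<psi> x = cnj (\<phi> x))"
proof -
  obtain a u v where a: "a \<in> K" "u \<in> K \<inter> \<real>" "v \<in> K \<inter> \<real>" "a * a = u + v * a"
    and basis: "\<And>x. x \<in> K \<Longrightarrow> \<exists>y\<in>K \<inter> \<real>. \<exists>z\<in>K \<inter> \<real>. x = y + z * a"
    and nr: "\<And>\<phi>. hom_on K \<phi> \<Longrightarrow> \<phi> u \<in> \<real> \<and> \<phi> v \<in> \<real> \<and> \<phi> a \<notin> \<real>"
    and re: "\<And>\<phi> x. hom_on K \<phi> \<Longrightarrow> x \<in> K \<inter> \<real> \<Longrightarrow> \<phi> x \<in> \<real>"
    using real_quadratic_generator by blast
  note cl' = subfield_CC_closed[OF subfield_K]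
  \<comment> \<open>An embedding is determined by its values on \<open>K \<inter> \<real>\<close> and on \<open>a\<close>; the latter is a root of a quadratic
    polynomial that \<open>\<phi>\<close> and \<open>\<psi>\<close> share.\<close>
  have sq: "\<chi> a * \<chi> a = \<chi> u + \<chi> v * \<chi> a" if \<chi>: "hom_on K \<chi>" for \<chi>
  proof -
    have "\<chi> a * \<chi> a = \<chi> (u + v * a)"
      using hom_on_mult[OF \<chi> a(1) a(1)] a(4) by simp
    then show ?thesis
      using a(1-3) cl' by (simp add: hom_on_add[OF \<chi>] hom_on_mult[OF \<chi>])
  qed
  have lin: "\<chi> (y + z * a) = \<chi> y + \<chi> z * \<chi> a" if \<chi>: "hom_on K \<chi>" and "y \<in> K" "z \<in> K" for \<chi> y z
    using that a(1) cl' by (simp add: hom_on_add[OF \<chi>] hom_on_mult[OF \<chi>])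
  have c: "cnj (\<phi> a) = \<phi> v - \<phi> a"
    using nr[OF \<phi>] sq[OF \<phi>] by (intro nonreal_root_of_real_quadratic) auto
  have "(\<psi> a - \<phi> a) * (\<psi> a + \<phi> a - \<phi> v) = 0"
    using sq[OF \<phi>] sq[OF \<psi>] agree[OF a(2)] agree[OF a(3)] by (simp add: algebra_simps)
  then have "\<psi> a - \<phi> a = 0 \<or> \<psi> a + \<phi> a - \<phi> v = 0"
    by (metis mult_eq_0_iff)
  then have "\<psi> a = \<phi> a \<or> \<psi> a = \<phi> v - \<phi> a"
    by (auto simp: eq_diff_eq)
  then consider "\<psi> a = \<phi> a" | "\<psi> a = cnj (\<phi> a)"
    unfolding c by blast
  then show ?thesis
  proof cases
    case 1
    have "\<psi> x = \<phi> x" if "x \<in> K" for x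
      using basis[OF that] lin[OF \<phi>] lin[OF \<psi>] agree 1 by auto
    then show ?thesis by blast
  next
    case 2
    have "\<psi> x = cnj (\<phi> x)" if x: "x \<in> K" for x
    proof -
      obtain y z where yz: "y \<in> K \<inter> \<real>" "z \<in> K \<inter> \<real>" "x = y + z * a" using basis[OF x] by blast
      then have "cnj (\<phi> y) = \<phi> y" "cnj (\<phi> z) = \<phi> z"
        using re[OF \<phi>] by (simp_all add: Reals_cnj_iff)
      with yz 2 agree[OF yz(1)] agree[OF yz(2)] show ?thesis
        using lin[OF \<phi>] lin[OF \<psi>] by simp
    qed
    then show ?thesis by blast
  qed
qed

lemma Galois_L: "Galois_over_rat L" and K_subset_L: "K \<subseteq> L"
  using Galois_closure[OF number_field_K] by auto

lemma subfield_L: "subfield L CC"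
  using Galois_subfield[OF Galois_L] .

lemma cnj_L: "x \<in> L \<Longrightarrow> cnj x \<in> L"
  using hom_on_Galois_image[OF Galois_L hom_on_cnj] .

lemma gal_hom: "\<sigma> \<in> gal L \<rat> \<Longrightarrow> hom_on L \<sigma>"
  using mem_gal_Rats_iff[OF Galois_L] by blast

text \<open>The elements on which all automorphisms commute with conjugation form a subfield which contains \<open>K\<close> by
\<open>embedding_cnj\<close> and is stable under the Galois group. So it is Galois over the rationals and must be the whole
Galois closure.\<close>

lemma gal_cnj:
  assumes \<sigma>: "\<sigma> \<in> gal L \<rat>" and x: "x \<in> L"
  shows "\<sigma> (cnj x) = cnj (\<sigma> x)"
proof -
  let ?M = "\<Inter>\<sigma>\<in>gal L \<rat>. {x \<in> L. \<sigma> (cnj x) = cnj (\<sigma> x)}"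
  have ne: "conj_elt K \<in> gal L \<rat>"
    unfolding conj_elt_def by (rule restrict_mem_gal[OF Galois_L hom_on_cnj])
  have sub: "subfield ?M CC"
  proof (rule subfield_Inter, clarify)
    fix \<sigma> assume \<sigma>: "\<sigma> \<in> gal L \<rat>"
    show "subfield {x \<in> L. \<sigma> (cnj x) = cnj (\<sigma> x)} CC"
      using cnj_L by (intro subfield_equalizer[OF subfield_L] hom_on_comp[OF hom_on_cnj gal_hom[OF \<sigma>]]
          hom_on_comp[OF gal_hom[OF \<sigma>] hom_on_cnj[of UNIV]]) auto
  qed
  have sub_L: "?M \<subseteq> L" using ne by blast
  have "K \<subseteq> ?M"
    using embedding_cnj(2)[OF _ hom_on_subset[OF gal_hom K_subset_L]] K_subset_L by blast
  moreover have "Galois_over_rat ?M"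
    unfolding Galois_over_rat_iff
  proof (intro conjI allI impI)
    show "number_field ?M"
      using number_field_mono[OF Galois_number_field[OF Galois_L] sub sub_L] .
    fix \<psi> assume "hom_on ?M \<psi>"
    then obtain \<tau> where \<tau>: "\<tau> \<in> gal L \<rat>" "\<And>x. x \<in> ?M \<Longrightarrow> \<tau> x = \<psi> x"
      using gal_extends_hom[OF Galois_L sub sub_L] by blast
    have \<tau>M: "\<tau> x \<in> ?M" if x: "x \<in> ?M" for x
    proof clarify
      fix \<sigma> assume \<sigma>: "\<sigma> \<in> gal L \<rat>"
      have xL: "x \<in> L" using x sub_L by blast
      have "\<sigma> (cnj (\<tau> x)) = \<sigma> (\<tau> (cnj x))" using x \<tau>(1) by auto
      also have "\<dots> = (\<sigma> \<otimes>\<^bsub>gal_group L\<^esub> \<tau>) (cnj x)"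
        using gal_mult_apply[OF Galois_L \<sigma> \<tau>(1) cnj_L[OF xL]] by simp
      also have "\<dots> = cnj ((\<sigma> \<otimes>\<^bsub>gal_group L\<^esub> \<tau>) x)"
        using x gal_m_closed[OF Galois_L \<sigma> \<tau>(1)] by blast
      also have "\<dots> = cnj (\<sigma> (\<tau> x))"
        using gal_mult_apply[OF Galois_L \<sigma> \<tau>(1) xL] by simp
      finally show "\<tau> x \<in> L \<and> \<sigma> (cnj (\<tau> x)) = cnj (\<sigma> (\<tau> x))"
        using gal_closed[OF Galois_L \<tau>(1) xL] by blast
    qed
    show "\<psi> ` ?M \<subseteq> ?M"
    proof (rule image_subsetI)
      fix x assume x: "x \<in> ?M"
      show "\<psi> x \<in> ?M" unfolding \<tau>(2)[OF x, symmetric] by (rule \<tau>M[OF x])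
    qed
  qed
  ultimately have "L \<subseteq> ?M" using Galois_closure(3)[OF number_field_K] by blast
  with \<sigma> x show ?thesis by blast
qed

text \<open>A totally real field is real because inclusion is one of its embeddings. Conversely, an embedding of \<open>M \<inter> \<real>\<close>
extends to an automorphism of \<open>L\<close>, and this commutes with conjugation.\<close>

lemma max_totally_real_eq:
  assumes M: "subfield M CC" "M \<subseteq> L"
  shows "max_totally_real M = M \<inter> \<real>"
  unfolding max_totally_real_def
proof (rule Greatest_equality)
  have sub: "subfield (M \<inter> \<real>) CC" using subfield_Reals_Int[OF M(1)] .
  have "\<phi> x \<in> \<real>" if \<phi>: "hom_on (M \<inter> \<real>) \<phi>" and x: "x \<in> M \<inter> \<real>" for \<phi> x
  proof -
    obtain \<sigma> where \<sigma>: "\<sigma> \<in> gal L \<rat>" "\<forall>x\<in>M \<inter> \<real>. \<sigma> x = \<phi> x"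
      using gal_extends_hom[OF Galois_L sub _ \<phi>] M(2) by blast
    then have "cnj (\<phi> x) = \<phi> x"
      using gal_cnj[OF \<sigma>(1), of x] x M(2) by (auto simp: Reals_cnj_iff)
    then show ?thesis by (simp add: Reals_cnj_iff)
  qed
  moreover have "number_field (M \<inter> \<real>)"
    using number_field_mono[OF Galois_number_field[OF Galois_L] sub] M(2) by blast
  ultimately show "M \<inter> \<real> \<subseteq> M \<and> totally_real (M \<inter> \<real>)"
    by (auto simp: totally_real_def embeddings_eq)
  show "F \<subseteq> M \<inter> \<real>" if "F \<subseteq> M \<and> totally_real F" for F
    using that totally_real_subset_Reals by blast
qed

end

section \<open>Embeddings, reflex groups and the comparison\<close>

context CM
begin

abbreviation "G \<equiv> gal L \<rat>"
abbreviation "\<iota> \<equiv> conj_elt K"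

lemma GG_eq: "GG K = gal_group L"
  by (simp add: GG_def)

lemma carrier_GG: "carrier (GG K) = G"
  using carrier_gal_group[OF Galois_L] by (simp add: GG_eq)

lemma group_GG: "group (GG K)"
  using group_gal_group[OF Galois_L] by (simp add: GG_eq)

lemma GG_apply: "\<sigma> \<in> G \<Longrightarrow> \<tau> \<in> G \<Longrightarrow> x \<in> L \<Longrightarrow> (\<sigma> \<otimes>\<^bsub>GG K\<^esub> \<tau>) x = \<sigma> (\<tau> x)"
  using gal_mult_apply[OF Galois_L] by (simp add: GG_eq)

lemma GG_closed: "\<sigma> \<in> G \<Longrightarrow> \<tau> \<in> G \<Longrightarrow> \<sigma> \<otimes>\<^bsub>GG K\<^esub> \<tau> \<in> G"
  using gal_m_closed[OF Galois_L] by (simp add: GG_eq)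

lemma GG_one: "\<one>\<^bsub>GG K\<^esub> = restrict (\<lambda>x. x) L"
  using gal_one[OF Galois_L] by (simp add: GG_eq)

lemma GG_inv: "\<sigma> \<in> G \<Longrightarrow> inv\<^bsub>GG K\<^esub> \<sigma> \<in> G"
  using group.inv_closed[OF group_GG] by (simp add: carrier_GG)

lemma GG_inv_apply: "\<sigma> \<in> G \<Longrightarrow> x \<in> L \<Longrightarrow> (inv\<^bsub>GG K\<^esub> \<sigma>) (\<sigma> x) = x"
  and GG_apply_inv: "\<sigma> \<in> G \<Longrightarrow> x \<in> L \<Longrightarrow> \<sigma> ((inv\<^bsub>GG K\<^esub> \<sigma>) x) = x"
proof -
  assume \<sigma>: "\<sigma> \<in> G" and x: "x \<in> L"
  show "(inv\<^bsub>GG K\<^esub> \<sigma>) (\<sigma> x) = x"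
    using GG_apply[OF GG_inv[OF \<sigma>] \<sigma> x] group.l_inv[OF group_GG, of \<sigma>] \<sigma> x by (simp add: carrier_GG GG_one)
  show "\<sigma> ((inv\<^bsub>GG K\<^esub> \<sigma>) x) = x"
    using GG_apply[OF \<sigma> GG_inv[OF \<sigma>] x] group.r_inv[OF group_GG, of \<sigma>] \<sigma> x by (simp add: carrier_GG GG_one)
qed

lemmas gal_L_closed = gal_closed[OF Galois_L]

lemma GG_mult_inv_cancel: "\<sigma> \<in> G \<Longrightarrow> \<rho> \<in> G \<Longrightarrow> \<sigma> \<otimes>\<^bsub>GG K\<^esub> (inv\<^bsub>GG K\<^esub> \<sigma> \<otimes>\<^bsub>GG K\<^esub> \<rho>) = \<rho>"
  by (rule gal_eqI[OF Galois_L]) (simp_all add: GG_closed GG_inv GG_apply GG_apply_inv gal_L_closed)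

lemma conj_elt_G: "\<iota> \<in> G"
  unfolding conj_elt_def by (rule restrict_mem_gal[OF Galois_L hom_on_cnj])

lemma conj_elt_apply: "x \<in> L \<Longrightarrow> \<iota> x = cnj x"
  by (simp add: conj_elt_def)

lemma conj_elt_involution: "\<iota> \<otimes>\<^bsub>GG K\<^esub> \<iota> = \<one>\<^bsub>GG K\<^esub>"
  using conj_elt_G
  by (intro gal_eqI[OF Galois_L])
    (simp_all add: GG_closed GG_apply GG_one conj_elt_apply cnj_L restrict_mem_gal[OF Galois_L hom_on_id])

lemma conj_elt_central: "\<sigma> \<in> G \<Longrightarrow> \<iota> \<otimes>\<^bsub>GG K\<^esub> \<sigma> = \<sigma> \<otimes>\<^bsub>GG K\<^esub> \<iota>"
  using conj_elt_G
  by (intro gal_eqI[OF Galois_L])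
    (simp_all add: GG_closed GG_apply conj_elt_apply cnj_L gal_cnj gal_L_closed)

lemma restrict_gal_embedding: "\<sigma> \<in> G \<Longrightarrow> restrict \<sigma> K \<in> embeddings K"
  using hom_on_restrict[OF subfield_K hom_on_subset[OF gal_hom K_subset_L]] by (simp add: embeddings_eq)

lemma embedding_extends: "\<phi> \<in> embeddings K \<Longrightarrow> \<exists>\<sigma>\<in>G. restrict \<sigma> K = \<phi>"
proof -
  assume \<phi>: "\<phi> \<in> embeddings K"
  then obtain \<sigma> where "\<sigma> \<in> G" "\<forall>x\<in>K. \<sigma> x = \<phi> x"
    using gal_extends_hom[OF Galois_L subfield_K K_subset_L] by (auto simp: embeddings_eq)
  moreover from this have "restrict \<sigma> K = \<phi>"
    using \<phi> by (intro extensionalityI[of _ K]) (auto simp: embeddings_eq)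
  ultimately show ?thesis by blast
qed

lemma compose_restrict_gal:
  "\<sigma> \<in> G \<Longrightarrow> \<tau> \<in> G \<Longrightarrow> compose K \<sigma> (restrict \<tau> K) = restrict (\<sigma> \<otimes>\<^bsub>GG K\<^esub> \<tau>) K"
  using K_subset_L by (auto simp: compose_def GG_apply subset_iff fun_eq_iff)

lemma embedding_cases:
  assumes "\<phi> \<in> embeddings K"
  obtains \<sigma> where "\<sigma> \<in> G" "\<phi> = restrict \<sigma> K"
  using embedding_extends[OF assms] by blast

lemma embeddingD: "\<phi> \<in> embeddings K \<Longrightarrow> hom_on K \<phi>"
  by (simp add: embeddings_eq)

lemma compose_embedding: "\<tau> \<in> G \<Longrightarrow> \<phi> \<in> embeddings K \<Longrightarrow> compose K \<tau> \<phi> \<in> embeddings K"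
  by (metis embedding_cases compose_restrict_gal restrict_gal_embedding GG_closed)

lemma H0_eq: "H0 K = {\<sigma> \<in> G. \<forall>x\<in>K \<inter> \<real>. \<sigma> x = x}"
  unfolding H0_def max_totally_real_eq[OF subfield_K K_subset_L] by (rule gal_eq[OF Galois_L])

text \<open>The coset of \<open>H\<^sub>0\<close> attached to an embedding consists of the automorphisms that agree with it on \<open>K \<inter> \<real>\<close>. In this
form the action on cosets and the fibres of \<open>\<phi> \<mapsto> \<phi>H\<^sub>0\<close> can be read off.\<close>

lemma emb_coset_mult_H0:
  assumes "\<phi> \<in> embeddings K"
  shows "emb_coset K \<phi> <#>\<^bsub>GG K\<^esub> H0 K = {\<sigma> \<in> G. \<forall>x\<in>K \<inter> \<real>. \<sigma> x = \<phi> x}" (is "?A = ?B")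
proof
  show "?A \<subseteq> ?B"
  proof
    fix \<rho> assume "\<rho> \<in> ?A"
    then obtain \<alpha> h where \<alpha>: "\<alpha> \<in> G" "restrict \<alpha> K = \<phi>" and h: "h \<in> G" "\<And>x. x \<in> K \<inter> \<real> \<Longrightarrow> h x = x"
      and \<rho>: "\<rho> = \<alpha> \<otimes>\<^bsub>GG K\<^esub> h"
      by (auto simp: set_mult_def emb_coset_def H0_eq carrier_GG)
    show "\<rho> \<in> ?B"
      using \<alpha> h \<rho> K_subset_L by (auto simp: GG_closed GG_apply subset_iff)
  qed
  show "?B \<subseteq> ?A"
  proof
    fix \<rho> assume \<rho>: "\<rho> \<in> ?B"
    obtain \<alpha> where \<alpha>: "\<alpha> \<in> G" "\<phi> = restrict \<alpha> K" using embedding_cases[OF assms] .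
    let ?h = "inv\<^bsub>GG K\<^esub> \<alpha> \<otimes>\<^bsub>GG K\<^esub> \<rho>"
    have "?h \<in> H0 K"
      unfolding H0_eq using \<rho> \<alpha> K_subset_L by (auto simp: GG_closed GG_inv GG_apply GG_inv_apply subset_iff)
    moreover have "\<alpha> \<in> emb_coset K \<phi>" using \<alpha> by (simp add: emb_coset_def carrier_GG)
    moreover have "\<rho> = \<alpha> \<otimes>\<^bsub>GG K\<^esub> ?h" using \<alpha> \<rho> GG_mult_inv_cancel by simp
    ultimately show "\<rho> \<in> ?A" unfolding set_mult_def by blast
  qed
qed

lemma emb_coset_mult_H0_act:
  assumes \<tau>: "\<tau> \<in> G" and \<phi>: "\<phi> \<in> embeddings K"
  shows "emb_coset K (compose K \<tau> \<phi>) <#>\<^bsub>GG K\<^esub> H0 K = \<tau> <#\<^bsub>GG K\<^esub> (emb_coset K \<phi> <#>\<^bsub>GG K\<^esub> H0 K)"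
  (is "?A = ?B")
proof -
  note A = emb_coset_mult_H0[OF compose_embedding[OF \<tau> \<phi>]] and B = emb_coset_mult_H0[OF \<phi>]
  have "\<tau> \<otimes>\<^bsub>GG K\<^esub> \<sigma> \<in> ?A" if "\<sigma> \<in> G" "\<forall>x\<in>K \<inter> \<real>. \<sigma> x = \<phi> x" for \<sigma>
    unfolding A using that \<tau> K_subset_L by (auto simp: GG_closed GG_apply compose_def subset_iff)
  moreover have "\<rho> \<in> ?B" if \<rho>: "\<rho> \<in> ?A" for \<rho>
  proof -
    obtain \<alpha> where \<alpha>: "\<alpha> \<in> G" "\<phi> = restrict \<alpha> K" using embedding_cases[OF \<phi>] .
    have "\<rho> \<in> G" "\<And>x. x \<in> K \<inter> \<real> \<Longrightarrow> \<rho> x = \<tau> (\<phi> x)"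
      using \<rho> unfolding A by (auto simp: compose_def)
    then have "inv\<^bsub>GG K\<^esub> \<tau> \<otimes>\<^bsub>GG K\<^esub> \<rho> \<in> {\<sigma> \<in> G. \<forall>x\<in>K \<inter> \<real>. \<sigma> x = \<phi> x}"
      using \<tau> \<alpha> K_subset_L gal_L_closed
      by (auto simp: GG_closed GG_inv GG_apply GG_inv_apply subset_iff)
    moreover have "\<rho> = \<tau> \<otimes>\<^bsub>GG K\<^esub> (inv\<^bsub>GG K\<^esub> \<tau> \<otimes>\<^bsub>GG K\<^esub> \<rho>)"
      using \<tau> \<open>\<rho> \<in> G\<close> GG_mult_inv_cancel by simp
    ultimately show ?thesis unfolding B l_coset_def by blast
  qed
  ultimately show ?thesis unfolding B l_coset_def by blast
qed

lemma lcosets_H0: "lcosets\<^bsub>GG K\<^esub> (H0 K) = (\<lambda>\<phi>. emb_coset K \<phi> <#>\<^bsub>GG K\<^esub> H0 K) ` embeddings K"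
proof -
  have one: "restrict (\<lambda>x. x) L \<in> G" by (rule restrict_mem_gal[OF Galois_L hom_on_id])
  have id: "restrict (\<lambda>x. x) K \<in> embeddings K"
    using hom_on_restrict[OF subfield_K hom_on_id] by (simp add: embeddings_eq)
  have "emb_coset K (restrict (\<lambda>x. x) K) <#>\<^bsub>GG K\<^esub> H0 K = H0 K"
    unfolding emb_coset_mult_H0[OF id] by (auto simp: H0_eq)
  moreover have "compose K \<sigma> (restrict (\<lambda>x. x) K) = restrict \<sigma> K" if "\<sigma> \<in> G" for \<sigma>
    by (auto simp: compose_def)
  ultimately have *: "\<sigma> <#\<^bsub>GG K\<^esub> H0 K = emb_coset K (restrict \<sigma> K) <#>\<^bsub>GG K\<^esub> H0 K" if "\<sigma> \<in> G" for \<sigma>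
    using emb_coset_mult_H0_act[OF that id] that by simp
  have "lcosets\<^bsub>GG K\<^esub> (H0 K) = (\<lambda>\<sigma>. emb_coset K (restrict \<sigma> K) <#>\<^bsub>GG K\<^esub> H0 K) ` G"
    unfolding LCOSETS_def carrier_GG using * by auto
  also have "\<dots> = (\<lambda>\<phi>. emb_coset K \<phi> <#>\<^bsub>GG K\<^esub> H0 K) ` (\<lambda>\<sigma>. restrict \<sigma> K) ` G"
    by (simp add: image_image)
  also have "(\<lambda>\<sigma>. restrict \<sigma> K) ` G = embeddings K"
    using restrict_gal_embedding embedding_extends by blast
  finally show ?thesis .
qed

lemma emb_coset_mult_H0_eq_iff:
  assumes \<phi>: "\<phi> \<in> embeddings K" and \<psi>: "\<psi> \<in> embeddings K"
  shows "emb_coset K \<phi> <#>\<^bsub>GG K\<^esub> H0 K = emb_coset K \<psi> <#>\<^bsub>GG K\<^esub> H0 K \<longleftrightarrow>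
    \<psi> = \<phi> \<or> \<psi> = compose K \<iota> \<phi>" (is "?L = ?R \<longleftrightarrow> _")
proof
  obtain \<alpha> where \<alpha>: "\<alpha> \<in> G" "\<phi> = restrict \<alpha> K" using embedding_cases[OF \<phi>] .
  have \<phi>L: "\<phi> x \<in> L" if "x \<in> K" for x
    using that \<alpha> K_subset_L gal_L_closed by auto
  have ext: "\<phi> \<in> extensional K" "\<psi> \<in> extensional K" using \<phi> \<psi> by (auto simp: embeddings_eq)
  {
    assume eq: "?L = ?R"
    have "\<alpha> \<in> ?L" unfolding emb_coset_mult_H0[OF \<phi>] using \<alpha> by auto
    then have "\<alpha> \<in> ?R" using eq by simp
    then have "\<phi> x = \<psi> x" if "x \<in> K \<inter> \<real>" for x
      unfolding emb_coset_mult_H0[OF \<psi>] using that \<alpha>(2) by auto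
    from hom_on_K_determined[OF embeddingD[OF \<phi>] embeddingD[OF \<psi>] this]
    show "\<psi> = \<phi> \<or> \<psi> = compose K \<iota> \<phi>"
    proof
      assume "\<forall>x\<in>K. \<psi> x = \<phi> x"
      then show ?thesis using ext by (auto intro: extensionalityI)
    next
      assume "\<forall>x\<in>K. \<psi> x = cnj (\<phi> x)"
      then have "\<psi> = compose K \<iota> \<phi>"
        using ext \<phi>L by (intro extensionalityI[of _ K]) (auto simp: compose_def conj_elt_apply)
      then show ?thesis ..
    qed
  }
  assume "\<psi> = \<phi> \<or> \<psi> = compose K \<iota> \<phi>"
  moreover have "(compose K \<iota> \<phi>) x = \<phi> x" if x: "x \<in> K \<inter> \<real>" for x
  proof -
    have "cnj (\<phi> x) = \<phi> (cnj x)" using embedding_cnj(2)[of x \<phi>] x embeddingD[OF \<phi>] by simp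
    also have "cnj x = x" using x by (simp add: Reals_cnj_iff)
    finally show ?thesis using x \<phi>L by (simp add: compose_def conj_elt_apply)
  qed
  ultimately show "?L = ?R"
    unfolding emb_coset_mult_H0[OF \<phi>] emb_coset_mult_H0[OF \<psi>] by auto
qed

lemma compose_conj_elt_neq:
  assumes \<phi>: "\<phi> \<in> embeddings K" shows "compose K \<iota> \<phi> \<noteq> \<phi>"
proof
  obtain \<alpha> where \<alpha>: "\<alpha> \<in> G" "\<phi> = restrict \<alpha> K" using embedding_cases[OF \<phi>] .
  assume eq: "compose K \<iota> \<phi> = \<phi>"
  have "\<phi> x \<in> \<real>" if x: "x \<in> K" for x
  proof -
    have "\<phi> x \<in> L" using x \<alpha> K_subset_L gal_L_closed by auto
    then have "cnj (\<phi> x) = \<phi> x" using fun_cong[OF eq, of x] x by (simp add: compose_def conj_elt_apply)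
    then show ?thesis by (simp add: Reals_cnj_iff)
  qed
  then show False using hom_on_K_not_real[OF embeddingD[OF \<phi>]] by blast
qed

lemma half_system_action_embeddings:
  "half_system_action (GG K) (embeddings K) (compose K) \<iota>
    (\<lambda>\<phi>. emb_coset K \<phi> <#>\<^bsub>GG K\<^esub> H0 K) (\<lambda>\<tau> C. \<tau> <#\<^bsub>GG K\<^esub> C)"
proof (intro half_system_action.intro half_system_action_axioms.intro, unfold carrier_GG)
  show "group (GG K)" by (rule group_GG)
  show "finite G" by (rule finite_gal[OF Galois_L])
  then show "finite (embeddings K)"
    using embedding_extends finite_surj[of G "embeddings K" "\<lambda>\<sigma>. restrict \<sigma> K"] by blast
  show "embeddings K \<noteq> {}" using restrict_gal_embedding[OF conj_elt_G] by blast
  fix \<phi> assume \<phi>: "\<phi> \<in> embeddings K"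
  then obtain \<alpha> where \<alpha>: "\<alpha> \<in> G" "\<phi> = restrict \<alpha> K" using embedding_cases by blast
  have one: "\<one>\<^bsub>GG K\<^esub> \<in> G" using group.is_monoid[OF group_GG] monoid.one_closed carrier_GG by metis
  show "compose K \<one>\<^bsub>GG K\<^esub> \<phi> = \<phi>"
    using \<alpha> one compose_restrict_gal[OF one \<alpha>(1)] group_GG
    by (simp add: carrier_GG monoid.l_one[OF group.is_monoid])
  show "compose K (g \<otimes>\<^bsub>GG K\<^esub> h) \<phi> = compose K g (compose K h \<phi>)" if "g \<in> G" "h \<in> G" for g h
    using that \<alpha> group_GG
    by (simp add: compose_restrict_gal GG_closed carrier_GG monoid.m_assoc[OF group.is_monoid])
qed (rule compose_embedding conj_elt_G conj_elt_involution conj_elt_central compose_conj_elt_neq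
      emb_coset_mult_H0_eq_iff emb_coset_mult_H0_act; assumption)+

sublocale half_system_action "GG K" "embeddings K" "compose K" \<iota>
    "\<lambda>\<phi>. emb_coset K \<phi> <#>\<^bsub>GG K\<^esub> H0 K" "\<lambda>\<tau> C. \<tau> <#\<^bsub>GG K\<^esub> C"
  by (rule half_system_action_embeddings)

lemma CM_types_eq: "CM_types K = half_systems"
  by (simp add: CM_types_def half_systems_def act_type_def)

lemma odd_subsets_eq: "odd_subsets K = odd_sets"
  by (simp add: odd_subsets_def odd_sets_def lcosets_H0)

lemma act_type_eq: "act_type K = (\<lambda>\<tau> \<Phi>. compose K \<tau> ` \<Phi>)"
  by (simp add: act_type_def fun_eq_iff)

lemma act_subset_eq: "act_subset K = (\<lambda>\<tau> I. (\<lambda>C. \<tau> <#\<^bsub>GG K\<^esub> C) ` I)"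
  by (simp add: act_subset_def fun_eq_iff)

lemma H0tilde_eq: "H0tilde K I = stabilizer (GG K) (\<lambda>\<tau> I. (\<lambda>C. \<tau> <#\<^bsub>GG K\<^esub> C) ` I) I"
  by (simp add: H0tilde_def stabilizer_def act_subset_def)

lemma mem_S_type: "\<sigma> \<in> S_type K \<Phi> \<longleftrightarrow> \<sigma> \<in> G \<and> restrict \<sigma> K \<in> \<Phi>"
  by (auto simp: S_type_def emb_coset_def carrier_GG)

lemma S_type_inj:
  assumes "\<Phi> \<subseteq> embeddings K" "\<Psi> \<subseteq> embeddings K" "S_type K \<Phi> = S_type K \<Psi>"
  shows "\<Phi> = \<Psi>"
proof -
  have "\<Phi> = (\<lambda>\<sigma>. restrict \<sigma> K) ` S_type K \<Phi>" if "\<Phi> \<subseteq> embeddings K" for \<Phi>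
    using that embedding_extends by (fastforce simp: mem_S_type image_iff)
  from this[OF assms(1)] this[OF assms(2)] assms(3) show ?thesis by simp
qed

lemma S_type_act:
  assumes \<sigma>: "\<sigma> \<in> G" and \<Phi>: "\<Phi> \<subseteq> embeddings K"
  shows "\<sigma> <#\<^bsub>GG K\<^esub> S_type K \<Phi> = S_type K (compose K \<sigma> ` \<Phi>)"
proof (intro equalityI subsetI)
  fix \<rho> assume "\<rho> \<in> \<sigma> <#\<^bsub>GG K\<^esub> S_type K \<Phi>"
  then obtain \<tau> where "\<tau> \<in> G" "restrict \<tau> K \<in> \<Phi>" "\<rho> = \<sigma> \<otimes>\<^bsub>GG K\<^esub> \<tau>"
    by (auto simp: l_coset_def mem_S_type)
  then show "\<rho> \<in> S_type K (compose K \<sigma> ` \<Phi>)"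
    using \<sigma> by (auto simp: mem_S_type GG_closed compose_restrict_gal[symmetric])
next
  fix \<rho> assume "\<rho> \<in> S_type K (compose K \<sigma> ` \<Phi>)"
  then obtain \<phi> where \<rho>: "\<rho> \<in> G" "\<phi> \<in> \<Phi>" "restrict \<rho> K = compose K \<sigma> \<phi>"
    by (auto simp: mem_S_type)
  have inv: "inv\<^bsub>GG K\<^esub> \<sigma> \<in> G" using GG_inv[OF \<sigma>] .
  have "restrict (inv\<^bsub>GG K\<^esub> \<sigma> \<otimes>\<^bsub>GG K\<^esub> \<rho>) K = compose K (inv\<^bsub>GG K\<^esub> \<sigma>) (compose K \<sigma> \<phi>)"
    using compose_restrict_gal[OF inv \<rho>(1)] \<rho>(3) by simp
  also have "\<dots> = \<phi>"
    using act_inv[of \<sigma> \<phi>] \<sigma> \<rho>(2) \<Phi> by (auto simp: carrier_GG)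
  finally have "inv\<^bsub>GG K\<^esub> \<sigma> \<otimes>\<^bsub>GG K\<^esub> \<rho> \<in> S_type K \<Phi>"
    using \<rho> inv by (simp add: mem_S_type GG_closed)
  moreover have "\<rho> = \<sigma> \<otimes>\<^bsub>GG K\<^esub> (inv\<^bsub>GG K\<^esub> \<sigma> \<otimes>\<^bsub>GG K\<^esub> \<rho>)"
    using GG_mult_inv_cancel[OF \<sigma> \<rho>(1)] by simp
  ultimately show "\<rho> \<in> \<sigma> <#\<^bsub>GG K\<^esub> S_type K \<Phi>" unfolding l_coset_def by blast
qed

text \<open>The set \<open>S_type K \<Phi>\<close> of all extensions of members of \<open>\<Phi>\<close> determines \<open>\<Phi>\<close> and is compatible with the action, so
both have the same stabiliser.\<close>

lemma Hstar_eq: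
  assumes "\<Phi> \<in> CM_types K"
  shows "Hstar K \<Phi> = stabilizer (GG K) (\<lambda>\<tau> \<Phi>. compose K \<tau> ` \<Phi>) \<Phi>"
proof -
  have \<Phi>: "\<Phi> \<subseteq> embeddings K" using assms half_systems_subset by (simp add: CM_types_eq)
  have "\<sigma> <#\<^bsub>GG K\<^esub> S_type K \<Phi> = S_type K \<Phi> \<longleftrightarrow> compose K \<sigma> ` \<Phi> = \<Phi>" if \<sigma>: "\<sigma> \<in> G" for \<sigma>
  proof -
    have "compose K \<sigma> ` \<Phi> \<subseteq> embeddings K" using compose_embedding[OF \<sigma>] \<Phi> by blast
    from S_type_inj[OF this \<Phi>] show ?thesis unfolding S_type_act[OF \<sigma> \<Phi>] by metis
  qed
  then show ?thesis by (auto simp: Hstar_def stabilizer_def carrier_GG)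
qed

text \<open>The real elements of the reflex field are those fixed by \<open>H\<^sup>*(\<Phi>)\<close> and by conjugation, that is, the fixed field of
\<open>H\<^sup>*(\<Phi>) \<union> \<iota> H\<^sup>*(\<Phi>)\<close>. This union is a subgroup because \<open>\<iota>\<close> is a central involution, and the
Galois correspondence applies.\<close>

lemma H0star_eq:
  assumes \<Phi>: "\<Phi> \<in> CM_types K"
  shows "H0star K \<Phi> = Hstar K \<Phi> \<union> (\<lambda>\<sigma>. \<iota> \<otimes>\<^bsub>GG K\<^esub> \<sigma>) ` Hstar K \<Phi>"
proof -
  let ?S = "Hstar K \<Phi>"
  let ?A = "?S \<union> (\<lambda>\<sigma>. \<iota> \<otimes>\<^bsub>GG K\<^esub> \<sigma>) ` ?S"
  have S: "subgroup ?S (GG K)"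
    unfolding Hstar_eq[OF \<Phi>]
    using \<Phi> by (intro subgroup_stabilizer_half_system half_systems_subset) (simp add: CM_types_eq)
  have SG: "?S \<subseteq> G" using subgroup.subset[OF S] by (simp add: carrier_GG)
  have A: "subgroup ?A (gal_group L)"
    unfolding GG_eq[symmetric]
    by (rule subgroup_Un_central_translate[OF S])
      (simp_all only: carrier_GG conj_elt_G conj_elt_involution conj_elt_central)
  have one: "\<one>\<^bsub>GG K\<^esub> \<in> ?S" using subgroup.one_closed[OF S] .
  have sub: "subfield (reflex_field K \<Phi>) CC"
  proof -
    have "reflex_field K \<Phi> = (\<Inter>\<sigma>\<in>?S. {x \<in> L. \<sigma> x = x})"
      using one by (auto simp: reflex_field_def fixed_field_def)
    then show ?thesis
      using SG by (auto intro!: subfield_Inter subfield_equalizer[OF subfield_L gal_hom hom_on_id])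
  qed
  have "reflex_field K \<Phi> \<inter> \<real> = fixed_field L ?A"
  proof (intro equalityI subsetI)
    fix x assume x: "x \<in> reflex_field K \<Phi> \<inter> \<real>"
    then have "cnj x = x" by (simp add: Reals_cnj_iff)
    with x SG conj_elt_G show "x \<in> fixed_field L ?A"
      by (auto simp: reflex_field_def fixed_field_def GG_apply conj_elt_apply subset_iff)
  next
    fix x assume x: "x \<in> fixed_field L ?A"
    then have xL: "x \<in> L" by (simp add: fixed_field_def)
    have "(\<iota> \<otimes>\<^bsub>GG K\<^esub> \<one>\<^bsub>GG K\<^esub>) x = x" using x one unfolding fixed_field_def by blast
    moreover have "(\<iota> \<otimes>\<^bsub>GG K\<^esub> \<one>\<^bsub>GG K\<^esub>) x = cnj x"
      using xL one SG conj_elt_G GG_apply[of \<iota> "\<one>\<^bsub>GG K\<^esub>" x] by (auto simp: GG_one conj_elt_apply)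
    ultimately have "x \<in> \<real>" by (simp add: Reals_cnj_iff)
    with x show "x \<in> reflex_field K \<Phi> \<inter> \<real>" by (auto simp: reflex_field_def fixed_field_def)
  qed
  moreover have "reflex_field K \<Phi> \<subseteq> L" by (auto simp: reflex_field_def fixed_field_def)
  ultimately show ?thesis
    using max_totally_real_eq[OF sub] gal_fixed_field[OF Galois_L A] by (simp add: H0star_def)
qed

end

theorem theorem3p1:
  fixes K :: "complex set"
    and N :: nat
    and \<Lambda> :: "(complex \<Rightarrow> complex) set set"
    and J_odd :: "(complex \<Rightarrow> complex) set set set"
    and \<Phi>\<^sub>0 :: "(complex \<Rightarrow> complex) set"
  assumes "CM_field K"
    and "ring.dimension CC (2 * N) \<rat> K"
    and "\<Phi>\<^sub>0 \<in> CM_types K"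
    and "system_of_reps \<Lambda> (orbits (GG K) (CM_types K) (act_type K))"
    and "system_of_reps J_odd (orbits (GG K) (odd_subsets K) (act_subset K))"
  shows "\<forall>g\<in>carrier (GG K).
    (\<Sum>\<Phi>\<in>\<Lambda>. Ind (GG K) (H0star K \<Phi>) (index2_char (Hstar K \<Phi>)) g) =
    (\<Sum>I\<in>J_odd. Ind (GG K) (H0tilde K I) (chi_tilde K \<Phi>\<^sub>0 I) g)"
proof
  fix g assume g: "g \<in> carrier (GG K)"
  interpret CM K using assms(1) by unfold_locales
  interpret based: based_half_system_action "GG K" "embeddings K" "compose K" "conj_elt K"
      "\<lambda>\<phi>. emb_coset K \<phi> <#>\<^bsub>GG K\<^esub> H0 K" "\<lambda>\<tau> C. \<tau> <#\<^bsub>GG K\<^esub> C" \<Phi>\<^sub>0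
    by unfold_locales (use assms(3) in \<open>simp add: CM_types_eq\<close>)
  have r: "r_fun K \<Phi>\<^sub>0 \<tau> C = based.r \<tau> C" for \<tau> C
    by (simp add: r_fun_def based.r_def based.s_def Let_def)
  have chi: "chi_tilde K \<Phi>\<^sub>0 I = (\<lambda>\<sigma>. (-1) ^ (\<Sum>C\<in>I. based.r \<sigma> C))" for I
    by (simp add: chi_tilde_def r fun_eq_iff)
  have \<Lambda>: "system_of_reps \<Lambda> (orbits (GG K) half_systems (\<lambda>\<tau> \<Phi>. compose K \<tau> ` \<Phi>))"
    using assms(4) by (simp add: CM_types_eq act_type_eq)
  have J: "system_of_reps J_odd (orbits (GG K) odd_sets (\<lambda>\<tau> I. (\<lambda>C. \<tau> <#\<^bsub>GG K\<^esub> C) ` I))"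
    using assms(5) by (simp add: odd_subsets_eq act_subset_eq)
  have "\<Lambda> \<subseteq> half_systems"
    by (rule sum_over_orbit_representatives(2)[OF finite_half_systems _ _ _ \<Lambda>])
      (use act_half_systems image_act_one image_act_mult half_systems_subset in auto)
  then have "(\<Sum>\<Phi>\<in>\<Lambda>. Ind (GG K) (H0star K \<Phi>) (index2_char (Hstar K \<Phi>)) g) =
      (\<Sum>\<Phi>\<in>\<Lambda>. Ind (GG K) (based.stab_half \<Phi> \<union> (\<lambda>\<sigma>. conj_elt K \<otimes>\<^bsub>GG K\<^esub> \<sigma>) ` based.stab_half \<Phi>)
        (index2_char (based.stab_half \<Phi>)) g)"
    by (intro sum.cong) (auto simp: H0star_eq Hstar_eq CM_types_eq)
  also have "\<dots> = (\<Sum>I\<in>J_odd. Ind (GG K) (H0tilde K I) (chi_tilde K \<Phi>\<^sub>0 I) g)"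
    unfolding H0tilde_eq chi by (rule based.sum_Ind_half_systems_eq_sum_Ind_odd_sets[OF \<Lambda> J g])
  finally show "(\<Sum>\<Phi>\<in>\<Lambda>. Ind (GG K) (H0star K \<Phi>) (index2_char (Hstar K \<Phi>)) g) =
      (\<Sum>I\<in>J_odd. Ind (GG K) (H0tilde K I) (chi_tilde K \<Phi>\<^sub>0 I) g)" .
qed

end
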